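(* Let $G=\mathrm{GL}_3$ and let $$\gamma=\begin{bmatrix}0&b_0\epsilon^{n_1}&c_0\epsilon^{n_2}\\ c_0\epsilon^{n_2+1}&0&b_0\epsilon^{n_1}\\ b_0\epsilon^{n_1+1}&c_0\epsilon^{n_2+1}&0\end{bmatrix},\qquad b_0,c_0\in\mathcal O^\times,\ n_1,n_2\in\mathbf N.$$ Suppose $n_2<n_1$ (so that $\gamma$ is equivalued of valuation $n_2+\frac23$). Then \begin{align*} I_\gamma^G=|\mathcal X_\gamma^0(\mathbf F_q)|=\ &1+2\sum_{i=1}^{\lfloor n_2/3\rfloor}q^{2(3i-1)}(q^2+q+1)\\ &+\sum_{i=1}^{n_2}\Big(i-2\Big\lfloor\frac i3\Big\rfloor-1\Big)q^{2i-3}(q^3+2q^2+2q+1)\\ &+\Big(n_2-2\Big\lceil\frac{n_2-1}{3}\Big\rceil\Big)q^{2n_2-1}(1+2q^2)\\ &+\sum_{i=n_2+2}^{2n_2}\Big(2n_2-i-2\Big\lceil\frac{2n_2-i}{3}\Big\rceil+1\Big)q^{i+n_2-1}(1+2q)\\ &+2\sum_{i=0}^{\lfloor(n_2-2)/3\rfloor}q^{3(n_2-i)-2}(1+q)+2q^{2n_2}\Big(\Big\lceil\frac{2n_2-1}{3}\Big\rceil-\Big\lfloor\frac{n_2-2}{3}\Big\rfloor-1\Big)+q^{3n_2+1}. \end{align*}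
   Context: $F=\mathbf F_q((\epsilon))$, $\mathcal O=\mathbf F_q[[\epsilon]]$, $\mathrm{char}(\mathbf F_q)>3$, $K=G(\mathcal O)$; $\mathfrak g$ is the Lie algebra of $G$. $\lfloor x\rfloor$ (resp. $\lceil x\rceil$) is the largest integer $\le x$ (resp. smallest integer $\ge x$). Sums whose lower index exceeds the upper index are zero. The centralizer $T$ of $\gamma$ satisfies $T(F)\cong E_3^\times$ with $E_3=\mathbf F_q((\epsilon^{1/3}))$. $\mathcal X_\gamma=\{[g]\in G(F)/K:\mathrm{Ad}(g^{-1})\gamma\in\mathfrak g(\mathcal O)\}$ is the affine Springer fiber and $\mathcal X_\gamma^0=\{[g]\in\mathcal X_\gamma:\mathrm{val}(\det g)=0\}$. The orbital integral is $$I_\gamma^G=\int_{T(F)\backslash G(F)}\mathbf 1_{\mathfrak g(\mathcal O)}(\mathrm{Ad}(g^{-1})\gamma)\,\frac{dg}{dt}$$ with Haar measures normalized by $\mathrm{vol}(K)=1$ and $\mathrm{vol}(\mathcal O_{E_3}^\times)=1$. *)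

theory Defs
  imports
    "HOL-Analysis.Analysis"
    "HOL-Algebra.Left_Coset"
    "HOL-Computational_Algebra.Formal_Laurent_Series"
begin

section \<open>Haar measures and quotient measures\<close>

definition Radon_measure :: "'a topology \<Rightarrow> 'a measure \<Rightarrow> bool" where
  "Radon_measure X M \<longleftrightarrow>
     space M = topspace X \<and>
     sets M = sigma_sets (topspace X) {U. openin X U} \<and>
     (\<forall>C. compactin X C \<longrightarrow> emeasure M C < \<infinity>) \<and>
     (\<forall>A\<in>sets M. emeasure M A = (INF U\<in>{U. openin X U \<and> A \<subseteq> U}. emeasure M U)) \<and>
     (\<forall>U. openin X U \<longrightarrow> emeasure M U = (SUP C\<in>{C. compactin X C \<and> C \<subseteq> U}. emeasure M C))"

definition left_Haar_measure :: "('a, 'b) monoid_scheme \<Rightarrow> 'a topology \<Rightarrow> 'a measure \<Rightarrow> bool" where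
  "left_Haar_measure G X M \<longleftrightarrow>
     Radon_measure X M \<and> emeasure M (space M) \<noteq> 0 \<and>
     (\<forall>g\<in>carrier G. \<forall>A\<in>sets M. emeasure M (g <#\<^bsub>G\<^esub> A) = emeasure M A)"

definition quotient_topology :: "'a topology \<Rightarrow> ('a \<Rightarrow> 'b) \<Rightarrow> 'b topology" where
  "quotient_topology X p =
     topology (\<lambda>U. U \<subseteq> p ` topspace X \<and> openin X {x \<in> topspace X. p x \<in> U})"

lemma openin_quotient_topology:
  "openin (quotient_topology X p) U \<longleftrightarrow>
     U \<subseteq> p ` topspace X \<and> openin X {x \<in> topspace X. p x \<in> U}"
proof -
  have "istopology (\<lambda>U. U \<subseteq> p ` topspace X \<and> openin X {x \<in> topspace X. p x \<in> U})"
    unfolding istopology_def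
  proof (intro conjI allI impI)
    fix S T
    assume "S \<subseteq> p ` topspace X \<and> openin X {x \<in> topspace X. p x \<in> S}"
      and "T \<subseteq> p ` topspace X \<and> openin X {x \<in> topspace X. p x \<in> T}"
    moreover have "{x \<in> topspace X. p x \<in> S \<inter> T} =
        {x \<in> topspace X. p x \<in> S} \<inter> {x \<in> topspace X. p x \<in> T}"
      by auto
    ultimately show "S \<inter> T \<subseteq> p ` topspace X" "openin X {x \<in> topspace X. p x \<in> S \<inter> T}"
      by auto
  next
    fix \<K>
    assume *: "\<forall>K\<in>\<K>. K \<subseteq> p ` topspace X \<and> openin X {x \<in> topspace X. p x \<in> K}"
    then show "\<Union>\<K> \<subseteq> p ` topspace X"
      by blast
    have "{x \<in> topspace X. p x \<in> \<Union>\<K>} = (\<Union>K\<in>\<K>. {x \<in> topspace X. p x \<in> K})"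
      by auto
    with * show "openin X {x \<in> topspace X. p x \<in> \<Union>\<K>}"
      by auto
  qed
  then show ?thesis
    by (simp add: quotient_topology_def topology_inverse')
qed

lemma topspace_quotient_topology: "topspace (quotient_topology X p) = p ` topspace X"
proof -
  have "{x \<in> topspace X. p x \<in> p ` topspace X} = topspace X"
    by auto
  then have "openin (quotient_topology X p) (p ` topspace X)"
    by (simp add: openin_quotient_topology)
  then show ?thesis
    by (metis openin_quotient_topology openin_subset openin_topspace subset_antisym)
qed

lemma quotient_map_quotient_topology: "quotient_map X (quotient_topology X p) p"
  by (auto simp: quotient_map_def topspace_quotient_topology openin_quotient_topology)

text \<open>
  For \<open>G\<close> and \<open>H\<close> unimodular with Haar measures \<open>M\<close> and \<open>N\<close>, \<open>Q\<close> is the quotient measure on the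
  space \<open>H\G\<close> of cosets \<open>Hg\<close>, characterised by Weil's formula for \<open>f \<in> C\<^sub>c(G)\<close>, \<open>f \<ge> 0\<close>.
  By right invariance of \<open>N\<close> the inner integral does not depend on the representative of the coset.
\<close>

definition quotient_Haar_measure ::
    "('a, 'b) monoid_scheme \<Rightarrow> 'a topology \<Rightarrow> 'a set \<Rightarrow> 'a measure \<Rightarrow> 'a measure \<Rightarrow> 'a set measure \<Rightarrow> bool"
  where
  "quotient_Haar_measure G X H M N Q \<longleftrightarrow>
     Radon_measure (quotient_topology X (\<lambda>g. H #>\<^bsub>G\<^esub> g)) Q \<and>
     (\<forall>f :: 'a \<Rightarrow> real.
        continuous_map X euclideanreal f \<and> (\<forall>g\<in>topspace X. 0 \<le> f g) \<and>
        (\<exists>C. compactin X C \<and> (\<forall>g\<in>topspace X - C. f g = 0)) \<longrightarrow>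
        (\<integral>\<^sup>+ g. ennreal (f g) \<partial>M) =
        (\<integral>\<^sup>+ x. (\<integral>\<^sup>+ t. ennreal (f (t \<otimes>\<^bsub>G\<^esub> (SOME g. g \<in> x))) \<partial>N) \<partial>Q))"


section \<open>The group \<open>GL\<^sub>3\<close> over \<open>F = k((\<epsilon>))\<close>\<close>

text \<open>
  \<open>F\<close> is the type \<open>'k fls\<close> with \<open>\<epsilon> = fls_X\<close>, its valuation is \<open>fls_subdegree\<close>, and its metric
  induces the \<open>\<epsilon>\<close>-adic topology; \<open>\<O>\<close> is \<open>'k fps\<close>, embedded by \<open>fps_to_fls\<close>.
\<close>

definition GL3 :: "('k::field fls ^ 3 ^ 3) monoid" where
  "GL3 = \<lparr>carrier = {g. invertible g}, mult = (**), one = mat 1\<rparr>"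

definition GL3_O :: "('k::field fls ^ 3 ^ 3) set" where
  "GL3_O = map_matrix fps_to_fls ` {k :: 'k fps ^ 3 ^ 3. invertible k}"

definition gl3_O :: "('k::field fls ^ 3 ^ 3) set" where
  "gl3_O = range (map_matrix fps_to_fls)"

definition Ad :: "'k::field fls ^ 3 ^ 3 \<Rightarrow> 'k fls ^ 3 ^ 3 \<Rightarrow> 'k fls ^ 3 ^ 3" where
  "Ad g A = g ** A ** matrix_inv g"

definition centralizer :: "'k::field fls ^ 3 ^ 3 \<Rightarrow> ('k fls ^ 3 ^ 3) set" where
  "centralizer \<gamma> = {t \<in> carrier GL3. t ** \<gamma> = \<gamma> ** t}"

definition affine_Springer_fiber :: "'k::field fls ^ 3 ^ 3 \<Rightarrow> ('k fls ^ 3 ^ 3) set set" where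
  "affine_Springer_fiber \<gamma> =
     {g <#\<^bsub>GL3\<^esub> GL3_O | g. g \<in> carrier GL3 \<and> Ad (matrix_inv g) \<gamma> \<in> gl3_O}"

definition affine_Springer_fiber0 :: "'k::field fls ^ 3 ^ 3 \<Rightarrow> ('k fls ^ 3 ^ 3) set set" where
  "affine_Springer_fiber0 \<gamma> =
     {x \<in> affine_Springer_fiber \<gamma>. \<forall>g\<in>x. fls_subdegree (det g) = 0}"

definition orbital_integral ::
    "('k::field fls ^ 3 ^ 3) set measure \<Rightarrow> 'k fls ^ 3 ^ 3 \<Rightarrow> ennreal" where
  "orbital_integral Q \<gamma> =
     (\<integral>\<^sup>+ x. indicator gl3_O (Ad (matrix_inv (SOME g. g \<in> x)) \<gamma>) \<partial>Q)"


section \<open>The cubic extension \<open>E\<^sub>3 = k((\<epsilon>\<^sup>1\<^sup>/\<^sup>3))\<close>\<close>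

text \<open>
  \<open>E\<^sub>3\<close> is again \<open>'k fls\<close>, now with \<open>\<epsilon>\<^sup>1\<^sup>/\<^sup>3 = fls_X\<close>, and \<open>F \<rightarrow> E\<^sub>3\<close> is \<open>\<lambda>a. fls_compose_power a 3\<close>.
  The matrix \<open>E3_mat x\<close> describes multiplication by \<open>x\<close> in the \<open>F\<close>-basis \<open>1, \<epsilon>\<^sup>1\<^sup>/\<^sup>3, \<epsilon>\<^sup>2\<^sup>/\<^sup>3\<close>:
  see \<open>E3_mat_eigenvector\<close>.
\<close>

definition E3_part :: "int \<Rightarrow> 'k::field fls \<Rightarrow> 'k fls" where
  "E3_part r x = Abs_fls (\<lambda>n. fls_nth x (3 * n + r))"

definition E3_mat :: "'k::field fls \<Rightarrow> 'k fls ^ 3 ^ 3" where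
  "E3_mat x = vector
     [vector [E3_part 0 x, E3_part 1 x, E3_part 2 x],
      vector [E3_part (-1) x, E3_part 0 x, E3_part 1 x],
      vector [E3_part (-2) x, E3_part (-1) x, E3_part 0 x]]"

definition E3_units :: "'k::field fls set" where
  "E3_units = fps_to_fls ` {u. is_unit u}"

lemma E3_part_nth: "fls_nth (E3_part r x) n = fls_nth x (3 * n + r)"
  unfolding E3_part_def
proof (rule nth_Abs_fls_ex_lower_bound)
  show "\<exists>N. \<forall>n<N. fls_nth x (3 * n + r) = 0"
    by (rule exI[of _ "min (fls_subdegree x - r) 0 div 3 - 1"]) (auto intro!: fls_eq0_below_subdegree)
qed

lemma E3_mat_eigenvector:
  fixes x :: "'k::field fls"
  shows "map_matrix (\<lambda>a. fls_compose_power a 3) (E3_mat x) *v vector [1, fls_X, fls_X ^ 2] =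
         x *s vector [1, fls_X, fls_X ^ 2]"
proof -
  have p: "fls_X ^ j * y = fls_shift (- int j) y" "y * fls_X ^ j = fls_shift (- int j) y"
    for j and y :: "'k fls"
    by (rule fls_X_power_times_conv_shift)+
  note p1 = p[of 1, simplified] fls_X_intpow_times_conv_shift[where 'a='k]
  have d: "fls_nth (fls_compose_power (E3_part r x) 3) n = (if 3 dvd n then fls_nth x (n + r) else 0)" for r n
    by (auto simp: fls_nth_compose_power E3_part_nth)
  have c: "3 dvd n \<and> \<not> 3 dvd n - 1 \<and> \<not> 3 dvd n - 2 \<or> \<not> 3 dvd n \<and> 3 dvd n - 1 \<and> \<not> 3 dvd n - 2 \<or>
      \<not> 3 dvd n \<and> \<not> 3 dvd n - 1 \<and> 3 dvd n - 2" for n :: int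
    by presburger
  show ?thesis
    unfolding vec_eq_iff forall_3 fls_eq_iff
    apply (intro conjI allI)
    subgoal for n using c[of n] by (auto simp: E3_mat_def matrix_vector_mult_def sum_3 p p1 d algebra_simps)
    subgoal for n using c[of n] by (auto simp: E3_mat_def matrix_vector_mult_def sum_3 p p1 d algebra_simps)
    subgoal for n using c[of n] by (auto simp: E3_mat_def matrix_vector_mult_def sum_3 p p1 d algebra_simps)
    done
qed

end

theory Submission
  imports Defs
begin

text \<open>
  Identify \<open>F\<^sup>3\<close> with \<open>E\<^sub>3\<close>, so that \<open>\<gamma>\<close> becomes multiplication by an element of valuation \<open>3 n\<^sub>2 + 2\<close>
  in \<open>\<epsilon>\<^sup>1\<^sup>/\<^sup>3\<close> and the points of the affine Springer fiber become the \<open>\<gamma>\<close>-stable lattices in \<open>E\<^sub>3\<close>.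
  Dividing a lattice by an element of minimal valuation gives a lattice \<open>\<Lambda> \<subseteq> \<O>\<^sub>E\<close> containing 1.
  Such a \<open>\<Lambda>\<close> is spanned over \<open>\<O>\<close> by 1 and two further elements of valuations \<open>3 \<beta> + r\<close> and
  \<open>3 \<kappa> + 3 - r\<close> with \<open>r \<in> {1, 2}\<close>, and depends on one more parameter \<open>p\<close>; stability under \<open>\<gamma>\<close> only bounds
  \<open>\<beta>\<close> and \<open>\<kappa>\<close> and, for \<open>r = 2\<close>, prescribes some coefficients of \<open>p\<close>. The divisor is unique once its
  coefficients at the valuations occurring in the lattice are required to vanish, which leaves \<open>\<beta> + \<kappa>\<close> free
  coefficients. Hence the fiber has
  \<open>\<Sum>\<^sub>k\<^sub>\<le>\<^sub>n (k + 1) (q\<^sup>2\<^sup>k + q\<^sup>2\<^sup>k\<^sup>+\<^sup>1) + \<Sum>\<^sub>j\<^sub><\<^sub>n (j + 1) q\<^sup>3\<^sup>n\<^sup>+\<^sup>1\<^sup>-\<^sup>j\<close> points for \<open>n = n\<^sub>2\<close>.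
\<close>

text \<open>For r = 1 a pair \<beta> \<le> \<kappa> \<le> n leaves \<kappa> - \<beta> free
  coefficients of p, so p and the divisor together contribute q^(2 \<kappa>), whatever \<beta> is;
  this gives (k + 1) q^(2k). For r = 2 put d = \<kappa> - \<beta> - 1. Then (\<beta>, d) runs
  through the square {0..n} x {0..n}, and the contribution depends only on s = \<beta> + d: its
  exponent is min (2s + 1) (n + s + 1). The antidiagonal s = n cuts the square into the odd powers
  of the first sum and the whole second sum. No index appears between the orbital integral and the
  degree-zero fiber because E3 is totally ramified: the norm, which is the determinant of
  \<open>E3_mat\<close>, preserves valuations, so T has elements of every determinant valuation. The
  formula to be proved spreads the same powers of q over overlapping blocks with coefficients
  depending on residues modulo 3. It is matched with the count separately below q^(2n), above
  q^(2n+1), and at these two powers, where the leftovers of both sides meet.\<close>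

no_notation fps_nth (infixl \<open>$\<close> 75)

section \<open>Lower bounds for valuations of Laurent series\<close>

definition vge :: "int \<Rightarrow> 'k::zero fls \<Rightarrow> bool" where
  "vge n f \<longleftrightarrow> (\<forall>k<n. fls_nth f k = 0)"

text \<open>Zero needs its own disjunct because \<open>fls_subdegree 0 = 0\<close>; working with
  \<open>vge\<close> keeps this case split out of sums and matrix entries.\<close>

lemma vge_iff: "vge n f \<longleftrightarrow> f = 0 \<or> n \<le> fls_subdegree f"
  unfolding vge_def
  by (metis fls_eq0_below_subdegree fls_subdegree_geI fls_zero_nth order_less_le_trans)

lemma vge_0 [simp]: "vge n 0"
  by (simp add: vge_def)

lemma vge_add: "vge n f \<Longrightarrow> vge n g \<Longrightarrow> vge n (f + g)"
  for f :: "'k::monoid_add fls"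
  by (simp add: vge_def)

lemma vge_diff: "vge n f \<Longrightarrow> vge n g \<Longrightarrow> vge n (f - g)"
  for f :: "'k::group_add fls"
  by (simp add: vge_def)

lemma vge_uminus [simp]: "vge n (- f) \<longleftrightarrow> vge n f"
  for f :: "'k::group_add fls"
  by (simp add: vge_def)

lemma vge_add_cancel: "vge n g \<Longrightarrow> vge n (f + g) \<longleftrightarrow> vge n f"
  for f :: "'k::group_add fls"
  by (simp add: vge_def)

lemma vge_mono: "vge n f \<Longrightarrow> m \<le> n \<Longrightarrow> vge m f"
  by (simp add: vge_def)

lemma vge_mult: "vge m f \<Longrightarrow> vge n g \<Longrightarrow> vge (m + n) (f * g)"
  for f :: "'k::field fls"
  by (cases "f * g = 0") (auto simp: vge_iff)

lemma vge_0_mult: "vge 0 f \<Longrightarrow> vge n g \<Longrightarrow> vge n (f * g)"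
  for f :: "'k::field fls"
  using vge_mult[of 0 f n g] by simp

lemma vge_sum: "(\<And>i. i \<in> A \<Longrightarrow> vge n (f i)) \<Longrightarrow> vge n (\<Sum>i\<in>A. f i)"
  for f :: "_ \<Rightarrow> 'k::field fls"
  by (induction A rule: infinite_finite_induct) (auto intro: vge_add)

lemma vge_shift [simp]: "vge n (fls_shift m f) \<longleftrightarrow> vge (n + m) f"
proof
  assume "vge n (fls_shift m f)"
  then have *: "fls_nth f (k + m) = 0" if "k < n" for k
    using that by (simp add: vge_def)
  show "vge (n + m) f"
    unfolding vge_def
  proof (intro allI impI)
    fix k assume "k < n + m"
    then show "fls_nth f k = 0"
      using *[of "k - m"] by simp
  qed
qed (simp add: vge_def)

lemma vge_1 [simp]: "vge n (1 :: 'k::field fls) \<longleftrightarrow> n \<le> 0"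
  by (simp add: vge_iff)

lemma vge_X_power_iff [simp]: "vge n (fls_X ^ m :: 'k::field fls) \<longleftrightarrow> n \<le> int m"
  by (simp add: vge_iff)

lemma vge_mult_iff: "f \<noteq> 0 \<Longrightarrow> vge n (f * g) \<longleftrightarrow> vge (n - fls_subdegree f) g"
  for f :: "'k::field fls"
  by (cases "g = 0") (auto simp: vge_iff)

lemma vge_X_power_mult [simp]: "vge n (fls_X ^ m * f) \<longleftrightarrow> vge (n - int m) f"
  for f :: "'k::field fls"
  by (simp add: vge_mult_iff)

lemma vge_X_mult [simp]: "vge n (fls_X * f) \<longleftrightarrow> vge (n - 1) f"
  for f :: "'k::field fls"
  by (simp add: vge_mult_iff)

lemma vge_fps_to_fls [simp]: "n \<le> 0 \<Longrightarrow> vge n (fps_to_fls f)"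
  by (simp add: vge_def)

lemma vge_0_imp_fps: "vge 0 f \<Longrightarrow> \<exists>g. f = fps_to_fls g"
  using fls_eq0_below_subdegree
  by (intro exI[of _ "fls_regpart f"]) (auto simp: fls_eq_iff vge_def)

lemma vge_fls_subdegree [simp]: "vge (fls_subdegree f) f"
  by (simp add: vge_def)

lemma subdegree_unit_iff: "is_unit u \<longleftrightarrow> fps_to_fls u \<noteq> 0 \<and> fls_subdegree (fps_to_fls u) = 0"
  for u :: "'k::field fps"
  by (auto simp: fls_subdegree_fls_to_fps subdegree_eq_0_iff)

lemma subdegree_0_imp_unit:
  fixes f :: "'k::field fls"
  assumes "f \<noteq> 0" "fls_subdegree f = 0"
  shows "\<exists>u. is_unit u \<and> f = fps_to_fls u"
proof -
  have "vge 0 f"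
    using assms by (simp add: vge_iff)
  then obtain u where "f = fps_to_fls u"
    using vge_0_imp_fps by blast
  then show ?thesis
    using assms subdegree_unit_iff by blast
qed

subsection \<open>Coordinates on the cubic extension\<close>

definition emb :: "'k::field fls \<Rightarrow> 'k fls" where
  "emb a = fls_compose_power a 3"

lemma emb_nth: "fls_nth (emb a) n = (if 3 dvd n then fls_nth a (n div 3) else 0)"
  by (simp add: emb_def fls_nth_compose_power)

lemma emb_simps [simp]:
  "emb 0 = 0" "emb 1 = 1" "emb (a + b) = emb a + emb b" "emb (a - b) = emb a - emb b"
  "emb (- a) = - emb a" "emb (a * b) = emb a * emb b"
  by (simp_all add: emb_def)

lemma emb_X [simp]: "emb fls_X = fls_X ^ 3"
  by (simp add: emb_def fls_X_power_conv_shift_1)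

lemma emb_X_power [simp]: "emb (fls_X ^ n) = fls_X ^ (3 * n)"
  by (induction n) (simp_all add: power_add power3_eq_cube)

lemma X_power_mult_nth: "fls_nth (fls_X ^ i * f) n = fls_nth f (n - int i)"
  for f :: "'k::field fls"
  by (simp add: fls_X_power_times_conv_shift)

lemma X_mult_nth: "fls_nth (fls_X * f) n = fls_nth f (n - 1)"
  for f :: "'k::field fls"
  by (simp add: fls_X_times_conv_shift)

lemma mod3_cases: 
  fixes n :: int
  obtains "n mod 3 = 0" "3 dvd n" "\<not> 3 dvd n - 1" "\<not> 3 dvd n - 2"
   | "n mod 3 = 1" "\<not> 3 dvd n" "3 dvd n - 1" "\<not> 3 dvd n - 2"
   | "n mod 3 = 2" "\<not> 3 dvd n" "\<not> 3 dvd n - 1" "3 dvd n - 2"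
proof -
  have "n mod 3 = 0 \<and> 3 dvd n \<and> \<not> 3 dvd n - 1 \<and> \<not> 3 dvd n - 2 \<or>
    n mod 3 = 1 \<and> \<not> 3 dvd n \<and> 3 dvd n - 1 \<and> \<not> 3 dvd n - 2 \<or>
    n mod 3 = 2 \<and> \<not> 3 dvd n \<and> \<not> 3 dvd n - 1 \<and> 3 dvd n - 2"
    by presburger
  then show ?thesis using that by metis
qed

lemma E3_decomp:
  "w = emb (E3_part 0 w) + fls_X * emb (E3_part 1 w) + fls_X ^ 2 * emb (E3_part 2 w)"
  for w :: "'k::field fls"
proof (rule fls_eqI)
  fix n
  show "fls_nth w n = fls_nth (emb (E3_part 0 w) + fls_X * emb (E3_part 1 w) + fls_X ^ 2 * emb (E3_part 2 w)) n"
    by (cases n rule: mod3_cases) (simp_all add: X_power_mult_nth X_mult_nth emb_nth E3_part_nth)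
qed

lemma E3_part_add: "E3_part r (v + w) = E3_part r v + E3_part r w"
  and E3_part_diff: "E3_part r (v - w) = E3_part r v - E3_part r w"
  for v w :: "'k::field fls"
  by (simp_all add: fls_eq_iff E3_part_nth)

text \<open>Shifting the index by 3 in E3 is one power of \<epsilon> in F. This turns the parts of
  negative index in \<open>E3_mat\<close> into multiples of \<open>fls_X\<close>.\<close>

lemma E3_part_minus_3: "E3_part (r - 3) w = fls_X * E3_part r w"
  by (simp add: fls_eq_iff E3_part_nth X_mult_nth algebra_simps)

lemma E3_part_combo [simp]:
  fixes a b c :: "'k::field fls"
  shows "E3_part 0 (emb a + fls_X * emb b + fls_X ^ 2 * emb c) = a"
    and "E3_part 1 (emb a + fls_X * emb b + fls_X ^ 2 * emb c) = b"
    and "E3_part 2 (emb a + fls_X * emb b + fls_X ^ 2 * emb c) = c"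
proof -
  have "\<not> 3 dvd 1 + 3 * n" "\<not> 3 dvd 2 + 3 * n" "\<not> 3 dvd 3 * n - 1" "\<not> 3 dvd 3 * n - 2" for n :: int
    by presburger+
  then show "E3_part 0 (emb a + fls_X * emb b + fls_X ^ 2 * emb c) = a"
    and "E3_part 1 (emb a + fls_X * emb b + fls_X ^ 2 * emb c) = b"
    and "E3_part 2 (emb a + fls_X * emb b + fls_X ^ 2 * emb c) = c"
    by (simp_all add: fls_eq_iff E3_part_nth X_power_mult_nth X_mult_nth emb_nth add.commute)
qed

text \<open>Products of basis elements are reduced by X^3 = \<epsilon>, where X generates E3; every
  factor \<open>fls_X\<close> on the right is such a carry.\<close>

lemma E3_part_mult:
  fixes v w :: "'k::field fls"
  defines "v0 \<equiv> E3_part 0 v" and "v1 \<equiv> E3_part 1 v" and "v2 \<equiv> E3_part 2 v"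
    and "w0 \<equiv> E3_part 0 w" and "w1 \<equiv> E3_part 1 w" and "w2 \<equiv> E3_part 2 w"
  shows "E3_part 0 (v * w) = v0 * w0 + fls_X * (v1 * w2 + v2 * w1)"
    and "E3_part 1 (v * w) = v0 * w1 + v1 * w0 + fls_X * (v2 * w2)"
    and "E3_part 2 (v * w) = v0 * w2 + v1 * w1 + v2 * w0"
proof -
  have v: "v = emb v0 + fls_X * emb v1 + fls_X ^ 2 * emb v2"
    and w: "w = emb w0 + fls_X * emb w1 + fls_X ^ 2 * emb w2"
    unfolding assms by (rule E3_decomp)+
  have "v * w = emb (v0 * w0 + fls_X * (v1 * w2 + v2 * w1)) +
      fls_X * emb (v0 * w1 + v1 * w0 + fls_X * (v2 * w2)) +
      fls_X ^ 2 * emb (v0 * w2 + v1 * w1 + v2 * w0)"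
    by (subst v, subst w)
      (simp add: emb_X algebra_simps power2_eq_square power3_eq_cube)
  note * = this
  show "E3_part 0 (v * w) = v0 * w0 + fls_X * (v1 * w2 + v2 * w1)"
    and "E3_part 1 (v * w) = v0 * w1 + v1 * w0 + fls_X * (v2 * w2)"
    and "E3_part 2 (v * w) = v0 * w2 + v1 * w1 + v2 * w0"
    unfolding * by (rule E3_part_combo)+
qed

lemma E3_part_emb: "E3_part 0 (emb a) = a" "E3_part 1 (emb a) = 0" "E3_part 2 (emb a) = 0"
  for a :: "'k::field fls"
  using E3_part_combo[of a 0 0] by simp_all

lemma E3_part_emb_mult [simp]:
  fixes a :: "'k::field fls"
  shows "E3_part 0 (emb a * w) = a * E3_part 0 w" "E3_part 1 (emb a * w) = a * E3_part 1 w"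
   "E3_part 2 (emb a * w) = a * E3_part 2 w"
  by (simp_all add: E3_part_mult E3_part_emb)

text \<open>Column vectors carry the basis \<open>\<epsilon>\<^sup>2\<^sup>/\<^sup>3, \<epsilon>\<^sup>1\<^sup>/\<^sup>3, 1\<close>, in which \<open>E3_mat x\<close> is again multiplication by
  \<open>x\<close>; the basis in the opposite order belongs to its action on rows.\<close>

definition E3_vec :: "'k::field fls \<Rightarrow> 'k fls ^ 3" where
  "E3_vec w = vector [E3_part 2 w, E3_part 1 w, E3_part 0 w]"

lemma E3_vec_nth [simp]: "E3_vec w $ 1 = E3_part 2 w" "E3_vec w $ 2 = E3_part 1 w"
  "E3_vec w $ 3 = E3_part 0 w"
  by (simp_all add: E3_vec_def)

lemma E3_vec_surj: "\<exists>w. E3_vec w = v"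
  by (rule exI[of _ "emb (v $ 3) + fls_X * emb (v $ 2) + fls_X ^ 2 * emb (v $ 1)"])
    (simp add: vec_eq_iff forall_3)

lemma E3_vec_add: "E3_vec (v + w) = E3_vec v + E3_vec w"
  by (simp add: vec_eq_iff forall_3 E3_part_add)

lemma E3_vec_emb_mult: "E3_vec (emb a * w) = a *s E3_vec w"
  by (simp add: vec_eq_iff forall_3)

lemma E3_mat_nth [simp]:
  fixes x :: "'k::field fls"
  shows "E3_mat x $ 1 $ 1 = E3_part 0 x" "E3_mat x $ 1 $ 2 = E3_part 1 x"
    "E3_mat x $ 1 $ 3 = E3_part 2 x" "E3_mat x $ 2 $ 1 = fls_X * E3_part 2 x"
    "E3_mat x $ 2 $ 2 = E3_part 0 x" "E3_mat x $ 2 $ 3 = E3_part 1 x"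
    "E3_mat x $ 3 $ 1 = fls_X * E3_part 1 x" "E3_mat x $ 3 $ 2 = fls_X * E3_part 2 x"
    "E3_mat x $ 3 $ 3 = E3_part 0 x"
  using E3_part_minus_3[of 2 x] E3_part_minus_3[of 1 x] by (simp_all add: E3_mat_def)

lemma E3_mat_mult_vec: "E3_mat x *v E3_vec w = E3_vec (x * w)"
  by (simp add: vec_eq_iff forall_3 matrix_vector_mult_def sum_3 E3_part_mult algebra_simps)

lemma E3_mat_mult: "E3_mat (x * y) = E3_mat x ** E3_mat y"
  by (simp add: vec_eq_iff forall_3 matrix_matrix_mult_def sum_3 E3_part_mult algebra_simps)

lemma E3_part_1: "E3_part 0 1 = (1 :: 'k::field fls)" "E3_part 1 1 = (0 :: 'k::field fls)"
   "E3_part 2 1 = (0 :: 'k::field fls)"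
  using E3_part_emb[of 1] by simp_all

lemma E3_mat_1: "E3_mat 1 = mat 1"
  by (simp add: vec_eq_iff forall_3 mat_def E3_part_1)

lemma E3_mat_inverse:
  assumes "x \<noteq> 0"
  shows "E3_mat x ** E3_mat (inverse x) = mat 1" "E3_mat (inverse x) ** E3_mat x = mat 1"
  using assms by (simp_all flip: E3_mat_mult add: E3_mat_1)

lemma invertible_E3_mat: "x \<noteq> 0 \<Longrightarrow> invertible (E3_mat x)"
  unfolding invertible_def using E3_mat_inverse by blast

text \<open>The bound 3n is the one that translates into the same bound n on all three coordinates,
  since the coordinates occupy the indices 3i, 3i + 1 and 3i + 2.\<close>

lemma vge_E3_part: "vge (3 * n) w \<longleftrightarrow> vge n (E3_part 0 w) \<and> vge n (E3_part 1 w) \<and> vge n (E3_part 2 w)"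
proof
  assume "vge (3 * n) w"
  then show "vge n (E3_part 0 w) \<and> vge n (E3_part 1 w) \<and> vge n (E3_part 2 w)"
    by (simp add: vge_def E3_part_nth)
next
  assume *: "vge n (E3_part 0 w) \<and> vge n (E3_part 1 w) \<and> vge n (E3_part 2 w)"
  show "vge (3 * n) w"
    unfolding vge_def
  proof (intro allI impI)
    fix k assume "k < 3 * n"
    then have "k div 3 < n" by presburger
    moreover have "k = 3 * (k div 3) + k mod 3" by simp
    moreover have "k mod 3 = 0 \<or> k mod 3 = 1 \<or> k mod 3 = 2" by presburger
    ultimately show "fls_nth w k = 0"
      using * unfolding vge_def E3_part_nth by (metis add.right_neutral)
  qed
qed

subsection \<open>Integral matrices\<close>

lemma matrix_inv_inverse:
  fixes A :: "'a::field ^ 'n ^ 'n"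
  assumes "invertible A"
  shows matrix_inv_right: "A ** matrix_inv A = mat 1"
    and matrix_inv_left: "matrix_inv A ** A = mat 1"
  using someI_ex[OF assms[unfolded invertible_def]] unfolding matrix_inv_def by blast+

lemma matrix_inv_unique:
  fixes A :: "'a::field ^ 'n ^ 'n"
  assumes "A ** B = mat 1"
  shows "matrix_inv A = B"
proof -
  have "invertible A"
    using assms invertible_right_inverse by blast
  then have "matrix_inv A = matrix_inv A ** (A ** B)"
    by (simp add: assms)
  also have "\<dots> = B"
    using \<open>invertible A\<close> by (simp add: matrix_mul_assoc matrix_inv_left)
  finally show ?thesis .
qed

lemma invertible_matrix_inv: "invertible A \<Longrightarrow> invertible (matrix_inv A)"
  for A :: "'a::field ^ 'n ^ 'n"
  using matrix_inv_left matrix_inv_right unfolding invertible_def by blast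

lemma matrix_inv_matrix_inv: "invertible A \<Longrightarrow> matrix_inv (matrix_inv A) = A"
  for A :: "'a::field ^ 'n ^ 'n"
  by (simp add: matrix_inv_unique matrix_inv_left)

lemma matrix_inv_mult:
  fixes A B :: "'a::field ^ 'n ^ 'n"
  assumes "invertible A" "invertible B"
  shows "matrix_inv (A ** B) = matrix_inv B ** matrix_inv A"
proof (rule matrix_inv_unique)
  have "A ** B ** (matrix_inv B ** matrix_inv A) = A ** (B ** matrix_inv B) ** matrix_inv A"
    by (simp only: matrix_mul_assoc)
  then show "A ** B ** (matrix_inv B ** matrix_inv A) = mat 1"
    using assms by (simp add: matrix_inv_right)
qed

lemma matrix_inv_cancel:
  fixes A :: "'a::field ^ 'n ^ 'n" and B :: "'a ^ 'm ^ 'n"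
  assumes "invertible A"
  shows "A ** (matrix_inv A ** B) = B" "matrix_inv A ** (A ** B) = B"
  using assms by (simp_all add: matrix_mul_assoc matrix_inv_left matrix_inv_right)

lemma gl3_O_iff: "A \<in> gl3_O \<longleftrightarrow> (\<forall>i j. vge 0 (A $ i $ j))"
proof
  show "A \<in> gl3_O \<Longrightarrow> \<forall>i j. vge 0 (A $ i $ j)"
    by (auto simp: gl3_O_def)
next
  assume *: "\<forall>i j. vge 0 (A $ i $ j)"
  then have "A = map_matrix fps_to_fls (\<chi> i j. SOME f. A $ i $ j = fps_to_fls f)"
    using someI_ex[OF vge_0_imp_fps] by (auto simp: vec_eq_iff)
  then show "A \<in> gl3_O"
    by (auto simp: gl3_O_def)
qed

lemma vge_mat_mult:
  fixes A :: "'k::field fls ^ 'n ^ 'm" and B :: "'k fls ^ 'l ^ 'n"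
  assumes "\<And>i j. vge m (A $ i $ j)" "\<And>i j. vge n (B $ i $ j)"
  shows "vge (m + n) ((A ** B) $ i $ j)"
  unfolding matrix_matrix_mult_def using assms by (auto intro!: vge_sum vge_mult)

lemma vge_mat_vec_mult:
  fixes A :: "'k::field fls ^ 'n ^ 'm" and v :: "'k fls ^ 'n"
  assumes "\<And>i j. vge m (A $ i $ j)" "\<And>i. vge n (v $ i)"
  shows "vge (m + n) ((A *v v) $ i)"
  unfolding matrix_vector_mult_def using assms by (auto intro!: vge_sum vge_mult)

lemma vge_mat_ex:
  fixes A :: "'k::field fls ^ 'n ^ 'm"
  shows "\<exists>D. \<forall>i j. vge D (A $ i $ j)"
proof -
  have "vge (Min (range (\<lambda>(i, j). fls_subdegree (A $ i $ j)))) (A $ i $ j)" for i j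
    by (rule vge_mono[OF vge_fls_subdegree]) (auto intro!: Min_le)
  then show ?thesis
    by blast
qed

lemma gl3_O_mult: "A \<in> gl3_O \<Longrightarrow> B \<in> gl3_O \<Longrightarrow> A ** B \<in> gl3_O"
  using vge_mat_mult[of 0 A 0 B] by (auto simp: gl3_O_iff)

lemma gl3_O_mat_1: "mat 1 \<in> gl3_O"
  by (simp add: gl3_O_iff mat_def)

lemma vge_det: "A \<in> gl3_O \<Longrightarrow> vge 0 (det A)"
  unfolding det_3 gl3_O_iff by (intro vge_add vge_diff vge_0_mult) auto

lemma map_matrix_fps_to_fls_mult:
  "map_matrix fps_to_fls (A ** B) = map_matrix fps_to_fls A ** map_matrix fps_to_fls B"
  for A B :: "'k::field fps ^ 3 ^ 3"
  by (simp add: vec_eq_iff matrix_matrix_mult_def sum_3 fls_times_fps_to_fls)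

lemma map_matrix_fps_to_fls_mat_1: "map_matrix fps_to_fls (mat 1) = (mat 1 :: 'k::field fls ^ 3 ^ 3)"
  by (simp add: vec_eq_iff mat_def)

lemma map_matrix_fps_to_fls_inject:
  "map_matrix fps_to_fls A = map_matrix fps_to_fls B \<longleftrightarrow> A = B"
  by (auto simp: vec_eq_iff)

text \<open>Invertibility over power series becomes integrality of the matrix and of its inverse
  over F; the inverse descends because the embedding of power series is injective and
  multiplicative.\<close>

lemma GL3_O_iff:
  "g \<in> GL3_O \<longleftrightarrow> g \<in> gl3_O \<and> invertible g \<and> matrix_inv g \<in> gl3_O"
  for g :: "'k::field fls ^ 3 ^ 3"
proof
  assume "g \<in> GL3_O"
  then obtain k l :: "'k fps ^ 3 ^ 3" where k: "g = map_matrix fps_to_fls k" "k ** l = mat 1" "l ** k = mat 1"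
    unfolding GL3_O_def invertible_def by blast
  then have *: "g ** map_matrix fps_to_fls l = mat 1"
    by (metis map_matrix_fps_to_fls_mat_1 map_matrix_fps_to_fls_mult)
  then show "g \<in> gl3_O \<and> invertible g \<and> matrix_inv g \<in> gl3_O"
    using k invertible_right_inverse matrix_inv_unique[OF *] by (auto simp: gl3_O_def)
next
  assume *: "g \<in> gl3_O \<and> invertible g \<and> matrix_inv g \<in> gl3_O"
  then obtain k l where k: "g = map_matrix fps_to_fls k" "matrix_inv g = map_matrix fps_to_fls l"
    unfolding gl3_O_def by blast
  then have "map_matrix fps_to_fls (k ** l) = map_matrix fps_to_fls (mat 1)"
      "map_matrix fps_to_fls (l ** k) = map_matrix fps_to_fls (mat 1)"
    using * matrix_inv_inverse[of g]
    by (simp_all only: map_matrix_fps_to_fls_mult map_matrix_fps_to_fls_mat_1)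
  then have "invertible k"
    unfolding map_matrix_fps_to_fls_inject invertible_def by blast
  then show "g \<in> GL3_O"
    using k by (auto simp: GL3_O_def)
qed

lemma GL3_O_mult: "g \<in> GL3_O \<Longrightarrow> h \<in> GL3_O \<Longrightarrow> g ** h \<in> GL3_O"
  by (auto simp: GL3_O_iff gl3_O_mult invertible_mult matrix_inv_mult)

lemma GL3_O_inverse: "g \<in> GL3_O \<Longrightarrow> matrix_inv g \<in> GL3_O"
  by (auto simp: GL3_O_iff invertible_matrix_inv matrix_inv_matrix_inv)

lemma GL3_O_mat_1: "mat 1 \<in> GL3_O"
proof -
  have "matrix_inv (mat 1 :: 'a fls ^ 3 ^ 3) = mat 1"
    by (rule matrix_inv_unique) simp
  then show ?thesis
    by (auto simp: GL3_O_iff gl3_O_mat_1 invertible_def intro: exI[of _ "mat 1"])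
qed

lemma det_GL3_O:
  assumes "g \<in> GL3_O"
  shows "det g \<noteq> 0" "fls_subdegree (det g) = 0"
proof -
  have "det g * det (matrix_inv g) = 1"
    using assms by (metis GL3_O_iff det_I det_mul matrix_inv_right)
  moreover have "vge 0 (det g)" "vge 0 (det (matrix_inv g))"
    using assms by (auto simp: GL3_O_iff intro: vge_det)
  moreover from calculation(1) show "det g \<noteq> 0" by auto
  moreover from calculation(1) have "det (matrix_inv g) \<noteq> 0" by auto
  ultimately show "fls_subdegree (det g) = 0"
    using fls_subdegree_mult[of "det g" "det (matrix_inv g)"] by (auto simp: vge_iff)
qed

text \<open>By Cramer's rule the entries of the inverse are determinants of integral matrices
  divided by \<open>det g\<close>, which is a unit.\<close>

lemma GL3_O_iff_det:
  fixes g :: "'k::field fls ^ 3 ^ 3"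
  shows "g \<in> GL3_O \<longleftrightarrow> g \<in> gl3_O \<and> det g \<noteq> 0 \<and> fls_subdegree (det g) = 0"
proof
  assume "g \<in> GL3_O"
  then show "g \<in> gl3_O \<and> det g \<noteq> 0 \<and> fls_subdegree (det g) = 0"
    using det_GL3_O by (auto simp: GL3_O_iff)
next
  assume *: "g \<in> gl3_O \<and> det g \<noteq> 0 \<and> fls_subdegree (det g) = 0"
  have "vge 0 (matrix_inv g $ k $ l)" for k l
  proof -
    have "g *v column l (matrix_inv g) = axis l 1"
    proof -
      have "g *v column l (matrix_inv g) = column l (g ** matrix_inv g)"
        by (simp add: vec_eq_iff matrix_vector_mult_def matrix_matrix_mult_def column_def)
      also have "g ** matrix_inv g = mat 1"
        using * by (simp add: invertible_det_nz matrix_inv_right)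
      finally show ?thesis
        by (simp add: vec_eq_iff column_def mat_def axis_def)
    qed
    then have "column l (matrix_inv g) =
        (\<chi> k. det (\<chi> i j. if j = k then axis l 1 $ i else g $ i $ j) / det g)"
      using * cramer by blast
    then have "matrix_inv g $ k $ l = det (\<chi> i j. if j = k then axis l 1 $ i else g $ i $ j) / det g"
      by (simp add: column_def vec_eq_iff)
    moreover have "vge 0 (det (\<chi> i j. if j = k then axis l 1 $ i else g $ i $ j))"
      using * by (intro vge_det) (auto simp: gl3_O_iff axis_def)
    ultimately show ?thesis
      using * by (cases "det (\<chi> i j. if j = k then axis l 1 $ i else g $ i $ j) = 0")
        (simp_all add: vge_iff fls_divide_subdegree)
  qed
  then show "g \<in> GL3_O"
    using * by (auto simp: GL3_O_iff gl3_O_iff invertible_det_nz)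
qed

lemma mem_coset_iff:
  assumes "invertible g"
  shows "h \<in> g <#\<^bsub>GL3\<^esub> GL3_O \<longleftrightarrow> matrix_inv g ** h \<in> GL3_O"
proof
  assume "h \<in> g <#\<^bsub>GL3\<^esub> GL3_O"
  then show "matrix_inv g ** h \<in> GL3_O"
    using assms by (auto simp: l_coset_def GL3_def matrix_inv_cancel)
next
  assume "matrix_inv g ** h \<in> GL3_O"
  then show "h \<in> g <#\<^bsub>GL3\<^esub> GL3_O"
    using assms matrix_inv_cancel(1)[of g h] by (force simp: l_coset_def GL3_def)
qed

lemma coset_self: "invertible g \<Longrightarrow> g \<in> g <#\<^bsub>GL3\<^esub> GL3_O"
  by (simp add: mem_coset_iff matrix_inv_left GL3_O_mat_1)

lemma coset_eq_iff:
  assumes "invertible g" "invertible h"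
  shows "g <#\<^bsub>GL3\<^esub> GL3_O = h <#\<^bsub>GL3\<^esub> GL3_O \<longleftrightarrow> matrix_inv g ** h \<in> GL3_O"
proof
  assume "g <#\<^bsub>GL3\<^esub> GL3_O = h <#\<^bsub>GL3\<^esub> GL3_O"
  then show "matrix_inv g ** h \<in> GL3_O"
    using coset_self[OF assms(2)] mem_coset_iff[OF assms(1)] by blast
next
  assume *: "matrix_inv g ** h \<in> GL3_O"
  have "matrix_inv (matrix_inv g ** h) ** (matrix_inv g ** x) = matrix_inv h ** x" for x
    using assms
    by (simp add: matrix_inv_mult invertible_matrix_inv matrix_inv_matrix_inv matrix_inv_cancel flip: matrix_mul_assoc)
  moreover have "(matrix_inv g ** h) ** (matrix_inv h ** x) = matrix_inv g ** x" for x
    using assms by (simp add: matrix_inv_cancel flip: matrix_mul_assoc)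
  ultimately have "matrix_inv g ** x \<in> GL3_O \<longleftrightarrow> matrix_inv h ** x \<in> GL3_O" for x
    using * by (metis GL3_O_inverse GL3_O_mult)
  then show "g <#\<^bsub>GL3\<^esub> GL3_O = h <#\<^bsub>GL3\<^esub> GL3_O"
    using assms by (auto simp: mem_coset_iff)
qed

text \<open>This is g O^3 transported to E3 by \<open>E3_vec\<close>, phrased as a membership test
  so that no spans have to be handled.\<close>

definition lattice_of :: "'k::field fls ^ 3 ^ 3 \<Rightarrow> 'k fls set" where
  "lattice_of g = {w. \<forall>i. vge 0 ((matrix_inv g *v E3_vec w) $ i)}"

text \<open>The columns of h lie in its lattice and generate it, so the inclusion is tested on them,
  and their coordinates with respect to g are the columns of
  \<open>matrix_inv g ** h\<close>.\<close>

lemma lattice_of_subset_iff: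
  fixes g h :: "'k::field fls ^ 3 ^ 3"
  assumes "invertible g" "invertible h"
  shows "lattice_of h \<subseteq> lattice_of g \<longleftrightarrow> matrix_inv g ** h \<in> gl3_O"
proof
  assume *: "lattice_of h \<subseteq> lattice_of g"
  have "vge 0 ((matrix_inv g ** h) $ i $ j)" for i j
  proof -
    obtain w where w: "E3_vec w = column j h"
      using E3_vec_surj by blast
    have col: "A *v column j h = column j (A ** h)" for A :: "'k fls ^ 3 ^ 3"
      by (simp add: vec_eq_iff matrix_vector_mult_def matrix_matrix_mult_def column_def)
    have "w \<in> lattice_of h"
      using assms by (simp add: lattice_of_def w col matrix_inv_left) (simp add: column_def mat_def)
    then have "w \<in> lattice_of g"
      using * by blast
    then show ?thesis
      by (simp add: lattice_of_def w col) (simp add: column_def)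
  qed
  then show "matrix_inv g ** h \<in> gl3_O"
    by (simp add: gl3_O_iff)
next
  assume *: "matrix_inv g ** h \<in> gl3_O"
  show "lattice_of h \<subseteq> lattice_of g"
  proof
    fix w assume "w \<in> lattice_of h"
    then have "\<forall>i. vge 0 (((matrix_inv g ** h) *v (matrix_inv h *v E3_vec w)) $ i)"
      using * vge_mat_vec_mult[of 0 "matrix_inv g ** h" 0 "matrix_inv h *v E3_vec w"]
      by (auto simp: lattice_of_def gl3_O_iff)
    also have "(matrix_inv g ** h) *v (matrix_inv h *v E3_vec w) = matrix_inv g *v E3_vec w"
      using assms by (simp add: matrix_vector_mul_assoc matrix_inv_right flip: matrix_mul_assoc)
    finally show "w \<in> lattice_of g"
      by (simp add: lattice_of_def)
  qed
qed

text \<open>The two inclusions say that \<open>matrix_inv g ** h\<close> and its inverse are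
  integral, which is membership in K.\<close>

lemma lattice_of_eq_iff:
  assumes "invertible g" "invertible h"
  shows "lattice_of g = lattice_of h \<longleftrightarrow> g <#\<^bsub>GL3\<^esub> GL3_O = h <#\<^bsub>GL3\<^esub> GL3_O"
proof -
  have "matrix_inv (matrix_inv g ** h) = matrix_inv h ** g"
    using assms by (simp add: matrix_inv_mult invertible_matrix_inv matrix_inv_matrix_inv)
  then have "matrix_inv g ** h \<in> GL3_O \<longleftrightarrow> matrix_inv g ** h \<in> gl3_O \<and> matrix_inv h ** g \<in> gl3_O"
    using assms by (simp add: GL3_O_iff invertible_mult invertible_matrix_inv)
  then show ?thesis
    using assms by (auto simp: coset_eq_iff simp flip: lattice_of_subset_iff)
qed

subsection \<open>The torus\<close>

lemma E3_part_0 [simp]: "E3_part r 0 = 0"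
  by (simp add: fls_eq_iff E3_part_nth)

lemma matrix_diff_ldistrib: "A ** (B - C) = A ** B - A ** C"
  and matrix_diff_rdistrib: "(B - C) ** A = B ** A - C ** A"
  for A B C :: "'a::ring_1 ^ 'n ^ 'n"
  by (simp_all add: vec_eq_iff matrix_matrix_mult_def algebra_simps sum_subtractf)

lemma subdegree_det_E3_mat_unit:
  assumes "x \<noteq> 0" "fls_subdegree x = 0"
  shows "fls_subdegree (det (E3_mat x)) = 0"
proof -
  have "E3_mat y \<in> gl3_O" if "vge 0 y" for y :: "'a fls"
    using that vge_E3_part[of 0 y] by (auto simp: gl3_O_iff forall_3 intro: vge_mono[of 0])
  moreover have "vge 0 x" "vge 0 (inverse x)"
    using assms by (simp_all add: vge_iff)
  moreover have "matrix_inv (E3_mat x) = E3_mat (inverse x)"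
    using assms E3_mat_inverse matrix_inv_unique by blast
  ultimately have "E3_mat x \<in> GL3_O"
    using assms by (simp add: GL3_O_iff invertible_E3_mat)
  then show ?thesis
    by (rule det_GL3_O)
qed

lemma det_E3_mat_X: "det (E3_mat fls_X) = (fls_X :: 'k::field fls)"
proof -
  have "E3_part 0 fls_X = (0 :: 'k fls)" "E3_part 1 fls_X = (1 :: 'k fls)" "E3_part 2 fls_X = (0 :: 'k fls)"
    using E3_part_combo[of "0 :: 'k fls" 1 0] by simp_all
  then show ?thesis
    by (simp add: det_3)
qed

lemma det_E3_mat_nonzero: "x \<noteq> 0 \<Longrightarrow> det (E3_mat x) \<noteq> 0"
  using invertible_E3_mat invertible_det_nz by blast

lemma subdegree_det_E3_mat_X_power: "fls_subdegree (det (E3_mat (fls_X ^ n))) = int n"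
  by (induction n) (simp_all add: E3_mat_1 E3_mat_mult det_mul det_E3_mat_X det_E3_mat_nonzero)

text \<open>The determinant is the norm of E3 over F. Units have norm of valuation 0 and X has norm
  \<epsilon>. Writing the valuation of x as a difference of naturals reduces to these two cases by
  cross-multiplication, without negative powers of X.\<close>

lemma subdegree_det_E3_mat:
  fixes x :: "'k::field fls"
  assumes "x \<noteq> 0"
  shows "fls_subdegree (det (E3_mat x)) = fls_subdegree x"
proof -
  obtain m n :: nat where mn: "fls_subdegree x = int m - int n"
    by (metis int_diff_cases)
  define y where "y = x * fls_X ^ n * inverse (fls_X ^ m)"
  have y: "y \<noteq> 0" "fls_subdegree y = 0"
    using assms mn by (simp_all add: y_def)
  have "fls_X ^ m * y = fls_X ^ n * x"
    by (simp add: y_def)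
  then have "det (E3_mat (fls_X ^ m)) * det (E3_mat y) = det (E3_mat (fls_X ^ n)) * det (E3_mat x)"
    by (metis E3_mat_mult det_mul)
  then have "fls_subdegree (det (E3_mat (fls_X ^ m)) * det (E3_mat y)) =
     fls_subdegree (det (E3_mat (fls_X ^ n)) * det (E3_mat x))"
    by simp
  then show ?thesis
    using y assms mn
    by (simp add: det_E3_mat_nonzero subdegree_det_E3_mat_X_power subdegree_det_E3_mat_unit)
qed

lemma E3_units_iff: "x \<in> E3_units \<longleftrightarrow> x \<noteq> 0 \<and> fls_subdegree x = 0"
proof
  assume "x \<in> E3_units"
  then obtain u where "x = fps_to_fls u" "is_unit u"
    unfolding E3_units_def by blast
  then show "x \<noteq> 0 \<and> fls_subdegree x = 0"
    using subdegree_unit_iff[of u] by simp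
next
  assume "x \<noteq> 0 \<and> fls_subdegree x = 0"
  then obtain u where "x = fps_to_fls u" "is_unit u"
    using subdegree_0_imp_unit[of x] by blast
  then show "x \<in> E3_units"
    unfolding E3_units_def by blast
qed

lemma E3_mat_combo:
  fixes B C :: "'k::field fls"
  shows "E3_mat (fls_X * emb B + fls_X ^ 2 * emb C) =
    vector [vector [0, B, C], vector [fls_X * C, 0, B], vector [fls_X * B, fls_X * C, 0]]"
  using E3_part_combo[of 0 B C] by (simp add: vec_eq_iff forall_3)

text \<open>The first rows of 1, \<gamma> and \<gamma>^2 form a basis of F^3, so a matrix commuting
  with \<gamma> is determined by its first row; every first row is already realised by some
  \<open>E3_mat x\<close>.\<close>

lemma centralizer_E3_mat:
  fixes B C :: "'k::field fls"
  assumes "B \<noteq> 0" "C \<noteq> 0"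
  shows "centralizer (E3_mat (fls_X * emb B + fls_X ^ 2 * emb C)) = {E3_mat x | x. x \<noteq> 0}"
    (is "centralizer ?\<gamma> = _")
proof
  show "{E3_mat x | x. x \<noteq> 0} \<subseteq> centralizer ?\<gamma>"
    by (auto simp: centralizer_def GL3_def invertible_E3_mat mult.commute simp flip: E3_mat_mult)
next
  show "centralizer ?\<gamma> \<subseteq> {E3_mat x | x. x \<noteq> 0}"
  proof
    fix t assume t: "t \<in> centralizer ?\<gamma>"
    define x where "x = emb (t $ 1 $ 1) + fls_X * emb (t $ 1 $ 2) + fls_X ^ 2 * emb (t $ 1 $ 3)"
    define s where "s = t - E3_mat x"
    have "?\<gamma> ** E3_mat x = E3_mat x ** ?\<gamma>"
      by (simp add: mult.commute flip: E3_mat_mult)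
    then have comm: "?\<gamma> ** s = s ** ?\<gamma>"
      using t by (simp add: s_def centralizer_def matrix_diff_ldistrib matrix_diff_rdistrib)
    have "(?\<gamma> ** ?\<gamma>) ** s = ?\<gamma> ** (s ** ?\<gamma>)"
      by (simp only: comm flip: matrix_mul_assoc)
    also have "\<dots> = (s ** ?\<gamma>) ** ?\<gamma>"
      by (simp only: comm matrix_mul_assoc)
    also have "\<dots> = s ** (?\<gamma> ** ?\<gamma>)"
      by (rule matrix_mul_assoc[symmetric])
    finally have comm2: "(?\<gamma> ** ?\<gamma>) ** s = s ** (?\<gamma> ** ?\<gamma>)" .
    have s1: "s $ 1 $ j = 0" for j
      using exhaust_3[of j] by (auto simp: s_def x_def)
    \<comment> \<open>The first rows of \<gamma> s and \<gamma>^2 s vanish, which is a linear system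
      for rows 2 and 3 of s. D is its determinant; it is nonzero since the valuations of its two
      terms differ modulo 3.\<close>
    define D where "D = B ^ 3 - fls_X * C ^ 3"
    have "fls_subdegree (B ^ 3) \<noteq> fls_subdegree (fls_X * C ^ 3)"
      using assms by (simp add: fls_subdegree_pow) presburger
    then have D: "D \<noteq> 0"
      by (auto simp: D_def)
    have s23: "s $ 2 $ j = 0 \<and> s $ 3 $ j = 0" for j
    proof -
      have "(s ** A) $ 1 $ j = 0" for A
        using s1 by (simp add: matrix_matrix_mult_def sum_3)
      then have 0: "(?\<gamma> ** s) $ 1 $ j = 0" "((?\<gamma> ** ?\<gamma>) ** s) $ 1 $ j = 0"
        unfolding comm comm2 by blast+
      have 1: "B * s $ 2 $ j + C * s $ 3 $ j = 0"
        using 0(1) s1 unfolding E3_mat_combo by (simp add: matrix_matrix_mult_def sum_3)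
      have 2: "fls_X * C\<^sup>2 * s $ 2 $ j + B\<^sup>2 * s $ 3 $ j = 0"
        using 0(2) s1 unfolding E3_mat_combo
        by (simp add: matrix_matrix_mult_def sum_3 algebra_simps power2_eq_square)
      have "D * s $ 2 $ j = B\<^sup>2 * (B * s $ 2 $ j + C * s $ 3 $ j) - C * (fls_X * C\<^sup>2 * s $ 2 $ j + B\<^sup>2 * s $ 3 $ j)"
        by (simp add: D_def algebra_simps power2_eq_square power3_eq_cube)
      then have "s $ 2 $ j = 0"
        using 1 2 D by simp
      then show ?thesis
        using 1 assms by simp
    qed
    have "s = 0"
      using s1 s23 by (simp add: vec_eq_iff forall_3)
    then have "t = E3_mat x"
      by (simp add: s_def)
    moreover have "x \<noteq> 0"
    proof
      assume "x = 0"
      then have "det t = 0"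
        using \<open>t = E3_mat x\<close> \<open>x = 0\<close> by (simp add: det_3)
      moreover have "invertible t"
        using t by (simp add: centralizer_def GL3_def)
      ultimately show False
        by (simp add: invertible_det_nz)
    qed
    ultimately show "t \<in> {E3_mat x | x. x \<noteq> 0}"
      by blast
  qed
qed

subsection \<open>Lattices and their normal forms\<close>

definition vals :: "'k::field fls set \<Rightarrow> int set" where
  "vals L = {fls_subdegree w | w. w \<in> L \<and> w \<noteq> 0}"

lemma valsI: "w \<in> L \<Longrightarrow> w \<noteq> 0 \<Longrightarrow> fls_subdegree w \<in> vals L"
  by (auto simp: vals_def)

text \<open>The last two conditions place L between two fractional ideals of E3; they stand for full
  rank and finite generation.\<close>

definition O_lattice :: "'k::field fls set \<Rightarrow> bool" where
  "O_lattice L \<longleftrightarrow>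
     (\<forall>v\<in>L. \<forall>w\<in>L. v + w \<in> L) \<and> (\<forall>a. \<forall>w\<in>L. vge 0 a \<longrightarrow> emb a * w \<in> L) \<and>
     (\<exists>C. \<forall>w. vge C w \<longrightarrow> w \<in> L) \<and> (\<exists>D. \<forall>w\<in>L. vge D w)"

lemma lattice_add: "O_lattice L \<Longrightarrow> v \<in> L \<Longrightarrow> w \<in> L \<Longrightarrow> v + w \<in> L"
  and lattice_emb: "O_lattice L \<Longrightarrow> vge 0 a \<Longrightarrow> w \<in> L \<Longrightarrow> emb a * w \<in> L"
  by (auto simp: O_lattice_def)

lemma lattice_diff: "O_lattice L \<Longrightarrow> v \<in> L \<Longrightarrow> w \<in> L \<Longrightarrow> v - w \<in> L"
  using lattice_add[of L v "- w"] lattice_emb[of L "-1" w] by simp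

lemma lattice_const: 
  assumes "O_lattice L" "w \<in> L"
  shows "fls_const c * w \<in> L"
  using lattice_emb[OF assms(1) _ assms(2), of "fls_const c"] by (simp add: emb_def vge_iff)

text \<open>Discarding coefficients keeps the support bounded below. This supplies the truncations
  and tails of series used later.\<close>

lemma fls_filter_ex: "\<exists>g. \<forall>i. fls_nth g i = (if P i then fls_nth f i else 0)"
proof -
  have "fls_nth (Abs_fls (\<lambda>i. if P i then fls_nth f i else 0)) i = (if P i then fls_nth f i else 0)" for i
    by (rule nth_Abs_fls_ex_lower_bound) (auto intro!: exI[of _ "fls_subdegree f"])
  then show ?thesis
    by blast
qed

text \<open>Gaussian elimination; a tail of \<open>x\<close> of high valuation lies in \<open>L\<close>, so only finitely many
  coefficients have to be cleared.\<close>

lemma reduced_element_ex: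
  fixes L :: "'k::field fls set"
  assumes L: "O_lattice L" and a: "a \<in> vals L"
  shows "\<exists>x\<in>L. fls_nth x a = 1 \<and> (\<forall>j<a. fls_nth x j = 0) \<and> (\<forall>j\<in>vals L. j > a \<longrightarrow> fls_nth x j = 0)"
proof -
  obtain C where C: "\<And>w. vge C w \<Longrightarrow> w \<in> L"
    using L by (auto simp: O_lattice_def)
  have step: "\<exists>x\<in>L. fls_nth x a = 1 \<and> (\<forall>j<a. fls_nth x j = 0) \<and>
      (\<forall>j\<in>vals L. a < j \<and> j < a + int t \<longrightarrow> fls_nth x j = 0)" for t
  proof (induction t)
    case 0
    obtain w where w: "w \<in> L" "w \<noteq> 0" "a = fls_subdegree w"
      using a by (auto simp: vals_def)
    then have "fls_const (inverse (fls_nth w a)) * w \<in> L"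
      using L lattice_const by blast
    with w show ?case
      by (intro bexI[of _ "fls_const (inverse (fls_nth w a)) * w"]) auto
  next
    case (Suc t)
    then obtain x where x: "x \<in> L" "fls_nth x a = 1" "\<And>j. j < a \<Longrightarrow> fls_nth x j = 0"
      "\<And>j. j \<in> vals L \<Longrightarrow> a < j \<Longrightarrow> j < a + int t \<Longrightarrow> fls_nth x j = 0"
      by blast
    define b where "b = a + int t"
    show ?case
    proof (cases "b \<in> vals L \<and> b > a")
      case True
      then obtain w where w: "w \<in> L" "w \<noteq> 0" "b = fls_subdegree w"
        by (auto simp: vals_def)
      define x' where "x' = x - fls_const (fls_nth x b / fls_nth w b) * w"
      have *: "fls_nth x' j = fls_nth x j - fls_nth x b / fls_nth w b * fls_nth w j" for j
        by (simp add: x'_def)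
      have "x' \<in> L"
        unfolding x'_def using L w x by (intro lattice_diff lattice_const)
      moreover have "fls_nth x' j = fls_nth x j" if "j < b" for j
        using that w by (simp add: *)
      moreover have "fls_nth x' b = 0"
        using w by (simp add: *)
      moreover have "fls_nth x' j = 0" if "j \<in> vals L" "a < j" "j < a + int (Suc t)" for j
        using that x(4)[of j] calculation(2)[of j] calculation(3) by (cases "j = b") (auto simp: b_def)
      ultimately show ?thesis
        using x True by (intro bexI[of _ x']) (auto simp: b_def)
    next
      case False
      then have "fls_nth x j = 0" if "j \<in> vals L" "a < j" "j < a + int (Suc t)" for j
        using that x(4)[of j] by (cases "j = b") (auto simp: b_def)
      then show ?thesis
        using x by (intro bexI[of _ x]) auto
    qed
  qed
  obtain x where x: "x \<in> L" "fls_nth x a = 1" "\<And>j. j < a \<Longrightarrow> fls_nth x j = 0"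
    "\<And>j. j \<in> vals L \<Longrightarrow> a < j \<Longrightarrow> j < a + int (nat (C - a) + 1) \<Longrightarrow> fls_nth x j = 0"
    using step[of "nat (C - a) + 1"] by blast
  define N where "N = a + int (nat (C - a) + 1)"
  obtain g where g: "\<And>i. fls_nth g i = (if N \<le> i then fls_nth x i else 0)"
    using fls_filter_ex[of "\<lambda>i. N \<le> i" x] by blast
  have "g \<in> L"
    by (rule C) (auto simp: vge_def g N_def)
  then have "x - g \<in> L"
    using L x lattice_diff by blast
  then show ?thesis
    using x by (intro bexI[of _ "x - g"]) (auto simp: g N_def)
qed

lemma E3_decomp':
  fixes w :: "'k::field fls"
  assumes "r = 1 \<or> r = 2"
  shows "w = emb (E3_part 0 w) + fls_X ^ r * emb (E3_part (int r) w) + fls_X ^ (3 - r) * emb (E3_part (int (3 - r)) w)"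
  using assms E3_decomp[of w] by (auto simp: algebra_simps)

lemma E3_part_combo' [simp]:
  fixes a b c :: "'k::field fls"
  assumes "r = 1 \<or> r = 2"
  shows "E3_part 0 (emb a + fls_X ^ r * emb b + fls_X ^ (3 - r) * emb c) = a"
    and "E3_part (int r) (emb a + fls_X ^ r * emb b + fls_X ^ (3 - r) * emb c) = b"
    and "E3_part (int (3 - r)) (emb a + fls_X ^ r * emb b + fls_X ^ (3 - r) * emb c) = c"
  using assms E3_part_combo[of a b c] E3_part_combo[of a c b] by (auto simp: algebra_simps)

lemma E3_part_emb_mult':
  fixes a :: "'k::field fls"
  assumes "r = 1 \<or> r = 2"
  shows "E3_part (int r) (emb a * w) = a * E3_part (int r) w" 
    "E3_part (int (3 - r)) (emb a * w) = a * E3_part (int (3 - r)) w"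
  using assms by auto

text \<open>This is the span of 1, \<open>y\<close> and \<open>z = X\<^sup>3\<^sup>\<kappa>\<^sup>+\<^sup>3\<^sup>-\<^sup>r\<close>, where \<open>X = \<epsilon>\<^sup>1\<^sup>/\<^sup>3\<close> and \<open>y\<close> has coordinates \<open>\<epsilon>\<^sup>\<beta>\<close> at \<open>X\<^sup>r\<close>
  and \<open>p \<epsilon>\<^sup>\<beta>\<close> at \<open>X\<^sup>3\<^sup>-\<^sup>r\<close>.\<close>

definition nf_lattice :: "nat \<Rightarrow> nat \<Rightarrow> nat \<Rightarrow> 'k::field fls \<Rightarrow> 'k fls set" where
  "nf_lattice r \<beta> \<kappa> p = {w. vge 0 (E3_part 0 w) \<and> vge (int \<beta>) (E3_part (int r) w) \<and>
     vge (int \<kappa>) (E3_part (int (3 - r)) w - p * E3_part (int r) w)}"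

text \<open>In both cases \<beta> + r \<le> \<kappa> + 1 means 3 \<beta> + r < 3 \<kappa> + 3 - r: y
  has smaller valuation than z. The lower bound r - 1 on the exponents of p says that the term of y
  at X^r is its leading one; the upper bound holds after subtracting multiples of z from y, which
  makes p unique.\<close>

definition nf_ok :: "nat \<Rightarrow> nat \<Rightarrow> nat \<Rightarrow> 'k::field fls \<Rightarrow> bool" where
  "nf_ok r \<beta> \<kappa> p \<longleftrightarrow> (r = 1 \<or> r = 2) \<and> \<beta> + r \<le> \<kappa> + 1 \<and>
     (\<forall>i. fls_nth p i \<noteq> 0 \<longrightarrow> int r - 1 \<le> i \<and> i < int \<kappa> - int \<beta>)"

lemma nf_ok_vge: "nf_ok r \<beta> \<kappa> p \<Longrightarrow> vge (int r - 1) p"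
  by (auto simp: nf_ok_def vge_def)

text \<open>Taking the last coordinate in the form \<open>c + p * b\<close> decouples the three
  membership conditions.\<close>

lemma combo_mem_nf_lattice:
  assumes "r = 1 \<or> r = 2" 
  shows "emb a + fls_X ^ r * emb b + fls_X ^ (3 - r) * emb (c + p * b) \<in> nf_lattice r \<beta> \<kappa> p \<longleftrightarrow>
    vge 0 a \<and> vge (int \<beta>) b \<and> vge (int \<kappa>) c"
  using E3_part_combo'[OF assms, of a b "c + p * b"] by (simp add: nf_lattice_def)

lemma one_mem_nf_lattice: "r = 1 \<or> r = 2 \<Longrightarrow> 1 \<in> nf_lattice r \<beta> \<kappa> p"
  using combo_mem_nf_lattice[of r 1 0 0] by simp

lemma nf_lattice_diff: "v \<in> nf_lattice r \<beta> \<kappa> p \<Longrightarrow> w \<in> nf_lattice r \<beta> \<kappa> p \<Longrightarrow> v - w \<in> nf_lattice r \<beta> \<kappa> p"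
proof -
  assume "v \<in> nf_lattice r \<beta> \<kappa> p" "w \<in> nf_lattice r \<beta> \<kappa> p"
  have "E3_part (int (3 - r)) (v - w) - p * E3_part (int r) (v - w) =
    (E3_part (int (3 - r)) v - p * E3_part (int r) v) - (E3_part (int (3 - r)) w - p * E3_part (int r) w)"
    by (simp add: E3_part_diff algebra_simps)
  note * = this
  show ?thesis
    using \<open>v \<in> _\<close> \<open>w \<in> _\<close> unfolding nf_lattice_def mem_Collect_eq *
    by (auto simp: E3_part_diff intro: vge_diff)
qed

text \<open>The valuations of 1, y and z are pairwise incongruent modulo 3, so leading terms of
  their multiples cannot cancel.\<close>

lemma vals_nf_lattice:
  fixes p :: "'k::field fls"
  assumes ok: "nf_ok r \<beta> \<kappa> p"
  shows "vals (nf_lattice r \<beta> \<kappa> p) = {j. j mod 3 = 0 \<and> 0 \<le> j \<or>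
    j mod 3 = int r \<and> 3 * int \<beta> + int r \<le> j \<or> j mod 3 = 3 - int r \<and> 3 * int \<kappa> + 3 - int r \<le> j}"
    (is "_ = ?R")
proof
  have r: "r = 1 \<or> r = 2" and \<beta>\<kappa>: "\<beta> + r \<le> \<kappa> + 1"
    using ok by (auto simp: nf_ok_def)
  show "vals (nf_lattice r \<beta> \<kappa> p) \<subseteq> ?R"
  proof
    fix j assume "j \<in> vals (nf_lattice r \<beta> \<kappa> p)"
    then obtain w where w: "w \<in> nf_lattice r \<beta> \<kappa> p" "w \<noteq> 0" "j = fls_subdegree w"
      by (auto simp: vals_def)
    have nz: "fls_nth w j \<noteq> 0" and below: "\<And>i. i < j \<Longrightarrow> fls_nth w i = 0"
      using w by simp_all
    define m where "m = j div 3"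
    have "j = 3 * m \<or> j = 3 * m + int r \<or> j = 3 * m + 3 - int r"
      unfolding m_def using r by (elim disjE; simp only: of_nat_1 of_nat_numeral; presburger)
    then consider "j = 3 * m" | "j = 3 * m + int r" | "j = 3 * m + 3 - int r"
      by blast
    then show "j \<in> ?R"
    proof cases
      case 1
      then have "fls_nth (E3_part 0 w) m \<noteq> 0"
        using nz by (simp add: E3_part_nth)
      then have "0 \<le> m"
        using w(1) by (force simp: nf_lattice_def vge_def)
      then show ?thesis
        using 1 by simp
    next
      case 2
      then have "fls_nth (E3_part (int r) w) m \<noteq> 0"
        using nz by (simp add: E3_part_nth)
      moreover have "vge (int \<beta>) (E3_part (int r) w)"
        using w(1) by (simp add: nf_lattice_def)
      ultimately have "int \<beta> \<le> m"
        by (meson linorder_not_le vge_def)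
      then show ?thesis
        using 2 r by auto
    next
      case 3
      \<comment> \<open>The leading term lies in the class of 3 - r. Hence b starts at m - r + 2 or
        later, and p starts at r - 1 or later, so \<open>p * b\<close> does not reach the
        coefficient at m and the leading term comes from z.\<close>
      define b where "b = E3_part (int r) w"
      have "vge (m - int r + 2) b"
        unfolding vge_def b_def
      proof (intro allI impI)
        fix i assume "i < m - int r + 2"
        then have "3 * i + int r < j"
          using r 3 by auto
        then show "fls_nth (E3_part (int r) w) i = 0"
          by (simp add: E3_part_nth below)
      qed
      then have "vge (m + 1) (p * b)"
        using vge_mult[OF nf_ok_vge[OF ok], of "m - int r + 2" b] by (simp add: add.commute)
      then have "fls_nth (p * b) m = 0"
        by (simp add: vge_def)
      moreover have "fls_nth (E3_part (int (3 - r)) w) m \<noteq> 0"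
        using nz 3 r by (auto simp: E3_part_nth add.commute)
      ultimately have "fls_nth (E3_part (int (3 - r)) w - p * b) m \<noteq> 0"
        by simp
      moreover have "vge (int \<kappa>) (E3_part (int (3 - r)) w - p * b)"
        using w(1) by (simp add: nf_lattice_def b_def)
      ultimately have "int \<kappa> \<le> m"
        by (meson linorder_not_le vge_def)
      then show ?thesis
        using 3 r by auto
    qed
  qed
  have valI: "j \<in> vals (nf_lattice r \<beta> \<kappa> p)"
    if "emb a + fls_X ^ r * emb b + fls_X ^ (3 - r) * emb (c + p * b) = w" "fls_nth w j \<noteq> 0"
      "\<And>i. i < j \<Longrightarrow> fls_nth w i = 0" "vge 0 a" "vge (int \<beta>) b" "vge (int \<kappa>) c" for a b c w j
  proof -
    have "w \<in> nf_lattice r \<beta> \<kappa> p"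
      using combo_mem_nf_lattice[OF r, of a b c p \<beta> \<kappa>] that(4-6) unfolding that(1) by blast
    moreover have "fls_subdegree w = j" "w \<noteq> 0"
      using that fls_subdegree_eqI by auto
    ultimately show ?thesis
      unfolding vals_def by blast
  qed
  have X_nth: "fls_nth (fls_X ^ m :: 'k fls) i = (if i = int m then 1 else 0)" for i m
    by (auto simp: fls_X_power_nth)
  show "?R \<subseteq> vals (nf_lattice r \<beta> \<kappa> p)"
  proof
    fix j assume "j \<in> ?R"
    then have "0 \<le> j"
      using r by auto
    then have "0 \<le> j div 3"
      by (simp add: pos_imp_zdiv_nonneg_iff)
    then obtain m where "j div 3 = int m"
      by (rule nonneg_int_cases)
    then have m: "j = 3 * int m + j mod 3"
      using mult_div_mod_eq[of 3 j] by simp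
    note \<open>j \<in> ?R\<close>
    then consider "j mod 3 = 0" "0 \<le> j" | "j mod 3 = int r" "3 * int \<beta> + int r \<le> j"
      | "j mod 3 = 3 - int r" "3 * int \<kappa> + 3 - int r \<le> j"
      by blast
    then show "j \<in> vals (nf_lattice r \<beta> \<kappa> p)"
    proof cases
      case 1
      then have j: "j = 3 * int m"
        using m by simp
      show ?thesis
        by (rule valI[of "fls_X ^ m" 0 0, OF refl]) (auto simp: X_nth j)
    next
      case 2
      then have j: "j = 3 * int m + int r"
        using m by simp
      have m: "\<beta> \<le> m"
        using 2 j by simp
      \<comment> \<open>The component of \<epsilon>^(m - \<beta>) y in the class of 3 - r lies
        strictly above j, so its leading term is that of X^(3m + r).\<close>
      have 3: "fls_nth (fls_X ^ (3 - r) * emb (p * fls_X ^ m)) i = 0" if "i \<le> j" for i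
      proof (cases "3 dvd i - int (3 - r)")
        case True
        then obtain l where "i - int (3 - r) = 3 * l"
          by blast
        then have l: "i = 3 * l + 3 - int r"
          using r by auto
        then have "l - int m < int r - 1"
          using that j r by auto
        then have "fls_nth p (l - int m) = 0"
          using nf_ok_vge[OF ok] by (simp add: vge_def)
        then show ?thesis
          using l r by (auto simp: X_power_mult_nth emb_nth mult.commute[of p] simp del: emb_simps)
      qed (simp add: X_power_mult_nth emb_nth del: emb_simps)
      show ?thesis
        by (rule valI[of 0 "fls_X ^ m" 0, OF refl])
          (use m 3 in \<open>auto simp: X_nth j simp del: emb_simps(6) simp flip: power_add\<close>)
    next
      case 3
      then have j: "j = 3 * int m + int (3 - r)"
        using m r by auto
      have m: "\<kappa> \<le> m"
        using 3 j r by auto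
      show ?thesis
        by (rule valI[of 0 0 "fls_X ^ m", OF refl]) (use m in \<open>auto simp: X_nth j simp flip: power_add\<close>)
    qed
  qed
qed

text \<open>Comparing the two valuation sets at the valuations of the generators identifies r,
  \<beta> and \<kappa>. Then y of the first lattice, tested against the second, gives p = p' modulo
  \<epsilon>^(\<kappa> - \<beta>), and neither has coefficients from there on.\<close>

lemma nf_lattice_inject:
  assumes ok: "nf_ok r \<beta> \<kappa> p" "nf_ok r' \<beta>' \<kappa>' p'"
    and eq: "nf_lattice r \<beta> \<kappa> p = nf_lattice r' \<beta>' \<kappa>' p'"
  shows "r = r' \<and> \<beta> = \<beta>' \<and> \<kappa> = \<kappa>' \<and> p = p'"
proof -
  have r: "r = 1 \<or> r = 2" "r' = 1 \<or> r' = 2" and \<beta>\<kappa>: "\<beta> + r \<le> \<kappa> + 1" "\<beta>' + r' \<le> \<kappa>' + 1"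
    using ok by (auto simp: nf_ok_def)
  note v = vals_nf_lattice[OF ok(1)] vals_nf_lattice[OF ok(2), folded eq]
  have *: "j mod 3 = 0 \<and> 0 \<le> j \<or>
      j mod 3 = int r \<and> 3 * int \<beta> + int r \<le> j \<or> j mod 3 = 3 - int r \<and> 3 * int \<kappa> + 3 - int r \<le> j
    \<longleftrightarrow> j mod 3 = 0 \<and> 0 \<le> j \<or>
      j mod 3 = int r' \<and> 3 * int \<beta>' + int r' \<le> j \<or> j mod 3 = 3 - int r' \<and> 3 * int \<kappa>' + 3 - int r' \<le> j" for j
    using v by auto
  have 1: "r = r' \<and> \<beta> = \<beta>' \<and> \<kappa> = \<kappa>'"
    using *[of "3 * int \<beta> + int r"] *[of "3 * int \<beta>' + int r'"]
      *[of "3 * int \<kappa> + 3 - int r"] *[of "3 * int \<kappa>' + 3 - int r'"] r \<beta>\<kappa>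
    by (elim disjE) (simp_all add: mod_simps)
  have "emb 0 + fls_X ^ r * emb (fls_X ^ \<beta>) + fls_X ^ (3 - r) * emb (0 + p * fls_X ^ \<beta>) \<in> nf_lattice r \<beta> \<kappa> p"
    by (subst combo_mem_nf_lattice[OF r(1)]) simp
  moreover have "0 + p * fls_X ^ \<beta> = (p - p') * fls_X ^ \<beta> + p' * fls_X ^ \<beta>"
    by (simp add: algebra_simps)
  ultimately have "vge (int \<kappa>) ((p - p') * fls_X ^ \<beta>)"
    using 1 combo_mem_nf_lattice[OF r(1), of 0 "fls_X ^ \<beta>" "(p - p') * fls_X ^ \<beta>" p'] eq by metis
  then have "vge (int \<kappa> - int \<beta>) (p - p')"
    by (simp add: mult.commute[of _ "fls_X ^ \<beta>"])
  moreover have "fls_nth p i = 0" "fls_nth p' i = 0" if "\<not> i < int \<kappa> - int \<beta>" for i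
    using ok 1 that by (auto simp: nf_ok_def)
  ultimately have "fls_nth p i = fls_nth p' i" for i
    by (cases "i < int \<kappa> - int \<beta>") (auto simp: vge_def)
  then show ?thesis
    using 1 by (auto simp: fls_eq_iff)
qed

text \<open>The element y comes from an element of least valuation among those with vanishing
  coordinate at 1; z is the first multiple of X^(3 - r) by a power of \<epsilon> in L. Subtracting
  suitable multiples of 1 and y from any element leaves a multiple of X^(3 - r), whose membership is
  governed by \<kappa>.\<close>

lemma nf_lattice_exists:
  fixes L :: "'k::field fls set"
  assumes L: "O_lattice L" and one: "1 \<in> L" and nonneg: "\<And>w. w \<in> L \<Longrightarrow> vge 0 w"
  shows "\<exists>r \<beta> \<kappa> p. nf_ok r \<beta> \<kappa> p \<and> L = nf_lattice r \<beta> \<kappa> p"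
proof -
  obtain C where C: "\<And>w. vge C w \<Longrightarrow> w \<in> L"
    using L by (auto simp: O_lattice_def)
  \<comment> \<open>Elements of L have integral coordinate at 1, and 1 lies in L, so L is the direct
    sum of O and M.\<close>
  define M where "M = {w \<in> L. E3_part 0 w = 0}"
  have emb_L: "emb a \<in> L" if "vge 0 a" for a
    using lattice_emb[OF L that one] by simp
  have emb_M: "emb a * w \<in> M" if "vge 0 a" "w \<in> M" for a w
    using that lattice_emb[OF L] by (simp add: M_def)
  have M_nonneg: "0 \<le> fls_subdegree w" if "w \<in> M" for w
    using nonneg[of w] that by (auto simp: M_def vge_iff)
  have "\<exists>n w. w \<in> M \<and> w \<noteq> 0 \<and> fls_subdegree w = int n"
  proof -
    \<comment> \<open>The exponent is large enough for L and congruent to 1 modulo 3, which puts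
      this power into M.\<close>
    have "fls_X ^ (3 * nat C + 1) \<in> L"
      by (rule C) simp
    moreover have "E3_part 0 (fls_X ^ (3 * nat C + 1)) = (0 :: 'k fls)"
      using E3_part_combo(1)[of 0 "fls_X ^ nat C :: 'k fls" 0] by (simp add: power_add mult.commute)
    ultimately have "fls_X ^ (3 * nat C + 1) \<in> M"
      by (simp add: M_def)
    then show ?thesis
      by (intro exI[of _ "3 * nat C + 1"] exI[of _ "fls_X ^ (3 * nat C + 1)"]) auto
  qed
  then obtain b' where b': "\<exists>w. w \<in> M \<and> w \<noteq> 0 \<and> fls_subdegree w = int b'"
      "\<And>n. n < b' \<Longrightarrow> \<not> (\<exists>w. w \<in> M \<and> w \<noteq> 0 \<and> fls_subdegree w = int n)"
    using exists_least_iff[of "\<lambda>n. \<exists>w. w \<in> M \<and> w \<noteq> 0 \<and> fls_subdegree w = int n"] by blast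
  then obtain y0 where y0: "y0 \<in> M" "y0 \<noteq> 0" "fls_subdegree y0 = int b'"
    by blast
  have M_ge: "vge (int b') w" if "w \<in> M" for w
  proof (cases "w = 0")
    case False
    then have "\<not> nat (fls_subdegree w) < b'"
      using b'(2)[of "nat (fls_subdegree w)"] that M_nonneg[OF that] by auto
    then show ?thesis
      using M_nonneg[OF that] by (simp add: vge_iff nat_less_iff)
  qed simp
  define r where "r = b' mod 3"
  define \<beta> where "\<beta> = b' div 3"
  have nz: "fls_nth y0 (int b') \<noteq> 0"
    using y0 by (metis nth_fls_subdegree_nonzero)
  have "r \<noteq> 0"
  proof
    \<comment> \<open>A leading exponent divisible by 3 would be visible in the coordinate at 1,
      which vanishes on M.\<close>
    assume "r = 0"
    then have "int b' = 3 * (int b' div 3) + 0"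
      by (auto simp: r_def)
    then have "fls_nth (E3_part 0 y0) (int b' div 3) \<noteq> 0"
      using nz unfolding E3_part_nth by metis
    then show False
      using y0 by (simp add: M_def)
  qed
  then have r: "r = 1 \<or> r = 2"
    by (auto simp: r_def)
  have b'_eq: "int b' = 3 * int \<beta> + int r"
    by (simp add: r_def \<beta>_def zdiv_int zmod_int)
  have part_r_ge: "vge (int \<beta>) (E3_part (int r) w)" if "w \<in> M" for w
    unfolding vge_def
  proof (intro allI impI)
    fix i assume "i < int \<beta>"
    then show "fls_nth (E3_part (int r) w) i = 0"
      using M_ge[OF that] by (simp add: E3_part_nth vge_def b'_eq)
  qed
  have part_r'_ge: "vge (int \<beta> + int r - 1) (E3_part (int (3 - r)) w)" if "w \<in> M" for w
    unfolding vge_def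
  proof (intro allI impI)
    fix i assume "i < int \<beta> + int r - 1"
    then have "3 * i + int (3 - r) < int b'"
      using r by (auto simp: b'_eq)
    then show "fls_nth (E3_part (int (3 - r)) w) i = 0"
      using M_ge[OF that] by (simp add: E3_part_nth vge_def)
  qed
  define f where "f = E3_part (int r) y0"
  have f: "fls_nth f (int \<beta>) \<noteq> 0"
    using nz by (simp add: f_def E3_part_nth b'_eq)
  then have f0: "f \<noteq> 0"
    by auto
  have f_sub: "fls_subdegree f = int \<beta>"
    using part_r_ge[OF y0(1)] f0 f fls_subdegree_leI[of f "int \<beta>"] by (simp add: f_def vge_iff)
  define y1 where "y1 = emb (fls_X ^ \<beta> * inverse f) * y0"
  have y1: "y1 \<in> M"
    unfolding y1_def using y0 f0 by (intro emb_M) (simp_all add: vge_iff f_sub)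
  have y1_r: "E3_part (int r) y1 = fls_X ^ \<beta>"
    using f0 by (simp add: y1_def E3_part_emb_mult'[OF r] f_def del: emb_simps)
  \<comment> \<open>Minimality of the valuation of y bounds p0 below by r - 1; nothing bounds its
    exponents above yet.\<close>
  define p0 where "p0 = inverse (fls_X ^ \<beta>) * E3_part (int (3 - r)) y1"
  have y1_r': "E3_part (int (3 - r)) y1 = p0 * fls_X ^ \<beta>"
    by (simp add: p0_def)
  have p0: "vge (int r - 1) p0"
    using part_r'_ge[OF y1] by (simp add: y1_r' mult.commute[of p0] del: of_nat_diff)
  have y1_eq: "y1 = fls_X ^ r * emb (fls_X ^ \<beta>) + fls_X ^ (3 - r) * emb (p0 * fls_X ^ \<beta>)"
    using E3_decomp'[OF r, of y1] y1 unfolding y1_r y1_r' by (simp add: M_def)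
  have "\<exists>m. fls_X ^ (3 - r) * emb (fls_X ^ m) \<in> L"
    by (rule exI[of _ "nat C"], rule C) simp
  then obtain \<kappa> where \<kappa>: "fls_X ^ (3 - r) * emb (fls_X ^ \<kappa>) \<in> L"
    "\<And>m. m < \<kappa> \<Longrightarrow> fls_X ^ (3 - r) * emb (fls_X ^ m) \<notin> L"
    using exists_least_iff[of "\<lambda>m. fls_X ^ (3 - r) * emb (fls_X ^ m) \<in> L"] by blast
  have c_iff: "fls_X ^ (3 - r) * emb c \<in> L \<longleftrightarrow> vge (int \<kappa>) c" for c
  proof
    assume "vge (int \<kappa>) c"
    then have "vge 0 (c * inverse (fls_X ^ \<kappa>))"
      by (simp add: mult.commute[of c] vge_mult_iff)
    then have "emb (c * inverse (fls_X ^ \<kappa>)) * (fls_X ^ (3 - r) * emb (fls_X ^ \<kappa>)) \<in> L"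
      using L \<kappa>(1) lattice_emb by blast
    also have "emb (c * inverse (fls_X ^ \<kappa>)) * (fls_X ^ (3 - r) * emb (fls_X ^ \<kappa>)) =
        fls_X ^ (3 - r) * emb (c * inverse (fls_X ^ \<kappa>) * fls_X ^ \<kappa>)"
      by (simp only: emb_simps mult_ac)
    also have "c * inverse (fls_X ^ \<kappa>) * fls_X ^ \<kappa> = c"
      by simp
    finally show "fls_X ^ (3 - r) * emb c \<in> L" .
  next
    assume *: "fls_X ^ (3 - r) * emb c \<in> L"
    show "vge (int \<kappa>) c"
    proof (cases "c = 0")
      case False
      have "fls_nth (fls_X ^ (3 - r) * emb c) (3 * fls_subdegree c + int (3 - r)) = fls_nth c (fls_subdegree c)"
        by (simp add: X_power_mult_nth emb_nth)
      then have "0 \<le> 3 * fls_subdegree c + int (3 - r)"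
        using nonneg[OF *] False unfolding vge_def
        by (metis linorder_not_le nth_fls_subdegree_nonzero)
      then have "0 \<le> fls_subdegree c"
        using r by auto
      then obtain m where m: "fls_subdegree c = int m"
        using nonneg_int_cases by blast
      have "emb (fls_X ^ m * inverse c) * (fls_X ^ (3 - r) * emb c) \<in> L"
        using False by (intro lattice_emb[OF L _ *]) (simp add: vge_iff m)
      also have "emb (fls_X ^ m * inverse c) * (fls_X ^ (3 - r) * emb c) =
          fls_X ^ (3 - r) * emb (fls_X ^ m * inverse c * c)"
        by (simp only: emb_simps mult_ac)
      also have "fls_X ^ m * inverse c * c = fls_X ^ m"
        using False by simp
      finally have "\<kappa> \<le> m"
        using \<kappa>(2) linorder_not_le by blast
      then show ?thesis
        by (simp add: vge_iff m)
    qed simp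
  qed
  have "fls_X ^ (3 - r) * emb (fls_X ^ \<kappa>) \<in> M"
    using \<kappa>(1) E3_part_combo'(1)[OF r, of 0 0 "fls_X ^ \<kappa>"] by (simp add: M_def)
  then have "int b' \<le> int (3 - r) + 3 * int \<kappa>"
    using M_ge by (force simp flip: power_add)
  then have \<beta>\<kappa>: "\<beta> + r \<le> \<kappa> + 1"
    using r by (auto simp: b'_eq)
  \<comment> \<open>Coefficients of p0 from \<kappa> - \<beta> on change y only by O-multiples of z,
    so they can be cut off without changing L.\<close>
  obtain p where p: "\<And>i. fls_nth p i = (if i < int \<kappa> - int \<beta> then fls_nth p0 i else 0)"
    using fls_filter_ex[of "\<lambda>i. i < int \<kappa> - int \<beta>" p0] by blast
  have pp0: "vge (int \<kappa> - int \<beta>) (p0 - p)"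
    by (simp add: vge_def p)
  have "nf_ok r \<beta> \<kappa> p"
    using r \<beta>\<kappa> p0 unfolding nf_ok_def p vge_def by (meson linorder_not_le)
  moreover have "w \<in> L \<longleftrightarrow> w \<in> nf_lattice r \<beta> \<kappa> p" for w
  proof -
    define w0 wr wr' where "w0 = E3_part 0 w" and "wr = E3_part (int r) w" and "wr' = E3_part (int (3 - r)) w"
    have w: "w = emb w0 + fls_X ^ r * emb wr + fls_X ^ (3 - r) * emb wr'"
      unfolding w0_def wr_def wr'_def by (rule E3_decomp'[OF r])
    have w_eq: "w = emb w0 + emb (wr * inverse (fls_X ^ \<beta>)) * y1 + fls_X ^ (3 - r) * emb (wr' - p0 * wr)"
    proof -
      have "emb (wr * inverse (fls_X ^ \<beta>)) * y1 =
          fls_X ^ r * emb (wr * inverse (fls_X ^ \<beta>) * fls_X ^ \<beta>) +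
          fls_X ^ (3 - r) * emb (p0 * (wr * inverse (fls_X ^ \<beta>) * fls_X ^ \<beta>))"
        unfolding y1_eq by (simp only: emb_simps) (simp add: algebra_simps)
      also have "wr * inverse (fls_X ^ \<beta>) * fls_X ^ \<beta> = wr"
        by simp
      finally show ?thesis
        by (simp add: w algebra_simps)
    qed
    have mid: "emb (wr * inverse (fls_X ^ \<beta>)) * y1 \<in> M" if "vge (int \<beta>) wr"
      using y1 that by (intro emb_M) (simp_all add: mult.commute[of wr] vge_mult_iff)
    have "w \<in> L \<longleftrightarrow> vge 0 w0 \<and> vge (int \<beta>) wr \<and> vge (int \<kappa>) (wr' - p0 * wr)"
    proof
      assume wL: "w \<in> L"
      then have 1: "vge 0 w0"
        using nonneg[OF wL] vge_E3_part[of 0 w] by (simp add: w0_def)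
      then have w': "w - emb w0 \<in> M"
        using lattice_diff[OF L wL emb_L[OF 1]] E3_part_emb[of w0] by (simp add: M_def E3_part_diff w0_def)
      moreover have "E3_part (int r) (w - emb w0) = wr"
        using r E3_part_emb[of w0] by (auto simp: E3_part_diff wr_def)
      ultimately have 2: "vge (int \<beta>) wr"
        using part_r_ge by metis
      have "w - emb w0 - emb (wr * inverse (fls_X ^ \<beta>)) * y1 \<in> L"
        using w' mid[OF 2] L lattice_diff by (auto simp: M_def)
      then have "fls_X ^ (3 - r) * emb (wr' - p0 * wr) \<in> L"
        by (subst (asm) w_eq) (simp add: algebra_simps)
      then show "vge 0 w0 \<and> vge (int \<beta>) wr \<and> vge (int \<kappa>) (wr' - p0 * wr)"
        using 1 2 c_iff by blast
    next
      assume *: "vge 0 w0 \<and> vge (int \<beta>) wr \<and> vge (int \<kappa>) (wr' - p0 * wr)"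
      then have "emb w0 \<in> L" "emb (wr * inverse (fls_X ^ \<beta>)) * y1 \<in> L" "fls_X ^ (3 - r) * emb (wr' - p0 * wr) \<in> L"
        using emb_L mid c_iff unfolding M_def by blast+
      then show "w \<in> L"
        by (subst w_eq) (intro lattice_add[OF L])
    qed
    also have "\<dots> \<longleftrightarrow> vge 0 w0 \<and> vge (int \<beta>) wr \<and> vge (int \<kappa>) (wr' - p * wr)"
    proof (intro conj_cong refl)
      assume "vge (int \<beta>) wr"
      then have "vge (int \<kappa>) ((p0 - p) * wr)"
        using vge_mult[OF pp0, of "int \<beta>" wr] by simp
      moreover have "wr' - p * wr = (wr' - p0 * wr) + (p0 - p) * wr"
        by (simp add: algebra_simps)
      ultimately show "vge (int \<kappa>) (wr' - p0 * wr) \<longleftrightarrow> vge (int \<kappa>) (wr' - p * wr)"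
        by (simp only: vge_add_cancel)
    qed
    finally show ?thesis
      by (simp add: nf_lattice_def w0_def wr_def wr'_def)
  qed
  ultimately show ?thesis
    by blast
qed

section \<open>Normal forms as matrices and stability under \<gamma>\<close>

lemma Ad_matrix_inv: "invertible g \<Longrightarrow> Ad (matrix_inv g) \<gamma> = matrix_inv g ** \<gamma> ** g"
  by (simp add: Ad_def matrix_inv_matrix_inv)

lemma O_lattice_lattice_of:
  fixes g :: "'k::field fls ^ 3 ^ 3"
  assumes "invertible g"
  shows "O_lattice (lattice_of g)"
  unfolding O_lattice_def
proof (intro conjI ballI allI impI)
  fix v w assume "v \<in> lattice_of g" "w \<in> lattice_of g"
  then show "v + w \<in> lattice_of g"
    by (simp add: lattice_of_def E3_vec_add matrix_vector_right_distrib vge_add)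
next
  fix a w :: "'k fls" assume "w \<in> lattice_of g" "vge 0 a"
  then show "emb a * w \<in> lattice_of g"
    by (simp add: lattice_of_def E3_vec_emb_mult vector_scalar_commute vge_0_mult)
next
  obtain D where D: "\<And>i j. vge D (matrix_inv g $ i $ j)"
    using vge_mat_ex by blast
  have "w \<in> lattice_of g" if "vge (3 * (- D)) w" for w
  proof -
    have "vge (- D) (E3_vec w $ i)" for i
      using that vge_E3_part[of "- D" w] exhaust_3[of i] by auto
    then have "vge (D + - D) ((matrix_inv g *v E3_vec w) $ i)" for i
      using D by (intro vge_mat_vec_mult)
    then show ?thesis
      by (simp add: lattice_of_def)
  qed
  then show "\<exists>C. \<forall>w. vge C w \<longrightarrow> w \<in> lattice_of g"
    by blast
next
  obtain D where D: "\<And>i j. vge D (g $ i $ j)"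
    using vge_mat_ex by blast
  have "vge (3 * D) w" if "w \<in> lattice_of g" for w
  proof -
    have "g *v (matrix_inv g *v E3_vec w) = E3_vec w"
      using assms by (simp add: matrix_vector_mul_assoc matrix_inv_right)
    moreover have "vge (D + 0) ((g *v (matrix_inv g *v E3_vec w)) $ i)" for i
      using D that by (intro vge_mat_vec_mult) (auto simp: lattice_of_def)
    ultimately have "vge D (E3_vec w $ i)" for i
      by simp
    from this[of 1] this[of 2] this[of 3] show ?thesis
      by (simp add: vge_E3_part)
  qed
  then show "\<exists>D. \<forall>w\<in>lattice_of g. vge D w"
    by blast
qed

text \<open>The columns are y, z and 1 in the coordinates of \<open>E3_vec\<close>. The two cases
  differ only in which of the first two rows belongs to X^r.\<close>

definition nf_mat :: "nat \<Rightarrow> nat \<Rightarrow> nat \<Rightarrow> 'k::field fls \<Rightarrow> 'k fls ^ 3 ^ 3" where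
  "nf_mat r \<beta> \<kappa> p = (if r = 2
     then vector [vector [fls_X ^ \<beta>, 0, 0], vector [p * fls_X ^ \<beta>, fls_X ^ \<kappa>, 0], vector [0, 0, 1]]
     else vector [vector [p * fls_X ^ \<beta>, fls_X ^ \<kappa>, 0], vector [fls_X ^ \<beta>, 0, 0], vector [0, 0, 1]])"

definition nf_inv :: "nat \<Rightarrow> nat \<Rightarrow> nat \<Rightarrow> 'k::field fls \<Rightarrow> 'k fls ^ 3 ^ 3" where
  "nf_inv r \<beta> \<kappa> p = (if r = 2
     then vector [vector [inverse (fls_X ^ \<beta>), 0, 0],
                  vector [- p * inverse (fls_X ^ \<kappa>), inverse (fls_X ^ \<kappa>), 0], vector [0, 0, 1]]
     else vector [vector [0, inverse (fls_X ^ \<beta>), 0],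
                  vector [inverse (fls_X ^ \<kappa>), - p * inverse (fls_X ^ \<kappa>), 0], vector [0, 0, 1]])"

lemma nf_mat_inv: "nf_mat r \<beta> \<kappa> p ** nf_inv r \<beta> \<kappa> p = mat 1"
  by (simp add: nf_mat_def nf_inv_def vec_eq_iff forall_3 matrix_matrix_mult_def sum_3 mat_def)

lemma invertible_nf_mat: "invertible (nf_mat r \<beta> \<kappa> p)"
  using nf_mat_inv invertible_right_inverse by blast

lemma matrix_inv_nf_mat: "matrix_inv (nf_mat r \<beta> \<kappa> p) = nf_inv r \<beta> \<kappa> p"
  using nf_mat_inv matrix_inv_unique by blast

lemma subdegree_det_nf_mat: "fls_subdegree (det (nf_mat r \<beta> \<kappa> p)) = int (\<beta> + \<kappa>)"
  by (simp add: nf_mat_def det_3)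

lemma vge_inverse_X_power_mult [simp]:
  "vge n (inverse (fls_X ^ m) * f) \<longleftrightarrow> vge (n + int m) f" for f :: "'k::field fls"
  by (simp add: vge_mult_iff)

lemma lattice_of_nf_mat:
  assumes "r = 1 \<or> r = 2" "x \<noteq> 0"
  shows "lattice_of (E3_mat x ** nf_mat r \<beta> \<kappa> p) = (\<lambda>w. x * w) ` nf_lattice r \<beta> \<kappa> p"
proof -
  have 1: "nf_inv r \<beta> \<kappa> p *v E3_vec w =
      vector [inverse (fls_X ^ \<beta>) * E3_part (int r) w,
        inverse (fls_X ^ \<kappa>) * (E3_part (int (3 - r)) w - p * E3_part (int r) w), E3_part 0 w]" for w
    using assms(1)
    by (auto simp: vec_eq_iff forall_3 nf_inv_def matrix_vector_mult_def sum_3 algebra_simps)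
  have 2: "(\<forall>i. vge 0 ((nf_inv r \<beta> \<kappa> p *v E3_vec w) $ i)) \<longleftrightarrow> w \<in> nf_lattice r \<beta> \<kappa> p" for w
    unfolding 1 nf_lattice_def by (auto simp: forall_3 simp del: of_nat_diff)
  have "matrix_inv (E3_mat x ** nf_mat r \<beta> \<kappa> p) *v E3_vec w = nf_inv r \<beta> \<kappa> p *v E3_vec (inverse x * w)" for w
  proof -
    have "matrix_inv (E3_mat x ** nf_mat r \<beta> \<kappa> p) = nf_inv r \<beta> \<kappa> p ** E3_mat (inverse x)"
      using assms matrix_inv_unique[OF E3_mat_inverse(1)[OF assms(2)]]
      by (simp add: matrix_inv_mult invertible_E3_mat invertible_nf_mat matrix_inv_nf_mat)
    then show ?thesis
      by (simp add: E3_mat_mult_vec flip: matrix_vector_mul_assoc)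
  qed
  then have "lattice_of (E3_mat x ** nf_mat r \<beta> \<kappa> p) = {w. inverse x * w \<in> nf_lattice r \<beta> \<kappa> p}"
    using 2 by (simp add: lattice_of_def)
  also have "\<dots> = (\<lambda>w. x * w) ` nf_lattice r \<beta> \<kappa> p"
  proof (intro Set.set_eqI iffI)
    fix w assume "w \<in> {w. inverse x * w \<in> nf_lattice r \<beta> \<kappa> p}"
    then show "w \<in> (\<lambda>w. x * w) ` nf_lattice r \<beta> \<kappa> p"
      using assms(2) by (intro image_eqI[of _ _ "inverse x * w"]) (simp_all flip: mult.assoc)
  qed (use assms(2) in \<open>auto simp flip: mult.assoc\<close>)
  finally show ?thesis .
qed

text \<open>The leading coefficient of f survives the subtraction, so f alone decides the
  valuation.\<close>

lemma vge_diff_dominant: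
  fixes f g :: "'k::field fls"
  assumes "f \<noteq> 0" "vge (fls_subdegree f + 1) g"
  shows "vge m (f - g) \<longleftrightarrow> m \<le> fls_subdegree f"
proof
  assume *: "vge m (f - g)"
  have "fls_nth g (fls_subdegree f) = 0"
    using assms(2) by (simp add: vge_def)
  then have "fls_nth (f - g) (fls_subdegree f) \<noteq> 0"
    using assms(1) by simp
  then show "m \<le> fls_subdegree f"
    using * by (meson linorder_not_le vge_def)
next
  assume "m \<le> fls_subdegree f"
  then show "vge m (f - g)"
    using assms by (auto intro!: vge_diff vge_mono[OF assms(2)] simp: vge_iff[of m f])
qed

text \<open>Since \<open>B\<close> has larger valuation than \<open>C\<close>, the terms quadratic in \<open>p\<close> never matter.\<close>

lemma stable_nf_mat_iff:
  fixes B C p :: "'k::field fls"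
  assumes ok: "nf_ok r \<beta> \<kappa> p" and BC: "B \<noteq> 0" "C \<noteq> 0"
    and val: "fls_subdegree B = int n1" "fls_subdegree C = int n" "n < n1"
  defines "\<gamma> \<equiv> E3_mat (fls_X * emb B + fls_X ^ 2 * emb C)"
  shows "nf_inv r \<beta> \<kappa> p ** \<gamma> ** nf_mat r \<beta> \<kappa> p \<in> gl3_O \<longleftrightarrow>
    (if r = 2 then \<beta> \<le> n \<and> \<kappa> \<le> \<beta> + n + 1 \<and> vge (int \<kappa>) (B - C * p) else \<kappa> \<le> n)"
proof -
  have r: "r = 1 \<or> r = 2" and \<beta>\<kappa>: "\<beta> + r \<le> \<kappa> + 1"
    using ok by (auto simp: nf_ok_def)
  have p: "vge (int r - 1) p"
    using ok by (rule nf_ok_vge)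
  have B: "vge m B \<longleftrightarrow> m \<le> int n1" and C: "vge m C \<longleftrightarrow> m \<le> int n" for m
    using BC val by (simp_all add: vge_iff)
  have pB: "vge (int r - 1 + int n1) (p * B)" and pC: "vge (int r - 1 + int n) (p * C)"
    using vge_mult[OF p] B C by simp_all
  define xb xk :: "'k fls" where "xb = fls_X ^ \<beta>" and "xk = fls_X ^ \<kappa>"
  have nz: "xb \<noteq> 0" "xk \<noteq> 0"
    by (simp_all add: xb_def xk_def)
  show ?thesis
  proof (cases "r = 2")
    case True
    \<comment> \<open>The columns are the coordinates of \<gamma> y, \<gamma> z and \<gamma> in the
      basis y, z, 1. The bounds come from three entries: C / \<epsilon>^\<beta>, (B - C p) /
      \<epsilon>^\<kappa>, and the z-coordinate of \<gamma> y, where \<epsilon> C dominates. The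
      others are integral automatically.\<close>
    have "nf_inv r \<beta> \<kappa> p ** \<gamma> ** nf_mat r \<beta> \<kappa> p = vector
      [vector [p * B, inverse (xb) * (xk * B), inverse (xb) * C],
       vector [inverse (xk) * (xb * (fls_X * C - p * (p * B))), - (p * B), inverse (xk) * (B - C * p)],
       vector [xb * (fls_X * (B + p * C)), xk * (fls_X * C), 0]]"
      unfolding True \<gamma>_def E3_mat_combo nf_inv_def nf_mat_def xb_def[symmetric] xk_def[symmetric]
      using nz by (simp add: vec_eq_iff forall_3 matrix_matrix_mult_def sum_3 field_simps)
    note this[unfolded xb_def xk_def]
    moreover have "vge (int \<kappa> - int \<beta>) (fls_X * C - p * (p * B)) \<longleftrightarrow> int \<kappa> - int \<beta> \<le> int n + 1"
      using vge_mono[OF vge_mult[OF p pB], of "int n + 2"] BC val True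
      by (subst vge_diff_dominant) (simp_all add: add.commute)
    moreover have "vge 0 (p * B)"
      using vge_mono[OF pB, of 0] True by simp
    moreover have "vge (- int \<beta> - 1) (B + p * C)"
      using vge_mono[OF pC, of "- int \<beta> - 1"] True by (intro vge_add) (simp_all add: B)
    ultimately show ?thesis
      using True \<beta>\<kappa> by (auto simp: gl3_O_iff forall_3 B C)
  next
    case False
    then have r1: "r = 1" using r by simp
    have "nf_inv r \<beta> \<kappa> p ** \<gamma> ** nf_mat r \<beta> \<kappa> p = vector
      [vector [fls_X * (p * C), inverse (xb) * (xk * (fls_X * C)), inverse (xb) * B],
       vector [inverse (xk) * (xb * (B - fls_X * (p * (p * C)))), - (fls_X * (p * C)), inverse (xk) * (C - p * B)],
       vector [xb * (fls_X * (p * B + C)), xk * (fls_X * B), 0]]"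
      unfolding r1 \<gamma>_def E3_mat_combo nf_inv_def nf_mat_def xb_def[symmetric] xk_def[symmetric]
      using nz by (simp add: vec_eq_iff forall_3 matrix_matrix_mult_def sum_3 field_simps)
    note this[unfolded xb_def xk_def]
    \<comment> \<open>Here the z-coordinate of \<gamma> decides: C dominates p B because n < n1.
      Once \<kappa> \<le> n, the remaining entries are integral since \<beta> \<le>
      \<kappa>.\<close>
    moreover have "vge (int \<kappa>) (C - p * B) \<longleftrightarrow> int \<kappa> \<le> int n"
      using vge_mono[OF pB, of "int n + 1"] BC val r1 by (subst vge_diff_dominant) simp_all
    moreover have "vge (int \<kappa> - int \<beta>) (B - fls_X * (p * (p * C)))" if "\<kappa> \<le> n"
      using vge_mono[OF vge_mult[OF p pC], of "int \<kappa> - int \<beta> - 1"] that val r1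
      by (intro vge_diff) (simp_all add: B)
    moreover have "vge (- int \<beta> - 1) (p * B + C)"
      using vge_mono[OF pB, of "- int \<beta> - 1"] r1 by (intro vge_add) (simp_all add: C)
    moreover have "vge (-1) (p * C)"
      using vge_mono[OF pC, of "-1"] r1 by simp
    ultimately show ?thesis
      using r1 \<beta>\<kappa> val by (auto simp: gl3_O_iff forall_3 B C)
  qed
qed

text \<open>The unit by which a lattice differs from its normal form \<open>M\<close>, up to a power of \<open>\<epsilon>\<^sup>1\<^sup>/\<^sup>3\<close>.\<close>

definition reduced_units :: "'k::field fls set \<Rightarrow> 'k fls set" where
  "reduced_units M = {u. fls_nth u 0 = 1 \<and> (\<forall>j<0. fls_nth u j = 0) \<and> (\<forall>j\<in>vals M. j > 0 \<longrightarrow> fls_nth u j = 0)}"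

text \<open>The scaled lattices have least valuations - n and - n', so n = n'. If u and u' differed,
  their difference would lie in both u M and u' M' with positive valuation. That valuation would
  occur in M and in M', where u and u' have zero coefficients by reducedness: a
  contradiction.\<close>

lemma scaled_nf_lattice_inject:
  fixes p p' u u' :: "'k::field fls"
  assumes ok: "nf_ok r \<beta> \<kappa> p" "nf_ok r' \<beta>' \<kappa>' p'"
    and u: "u \<in> reduced_units (nf_lattice r \<beta> \<kappa> p)" "u' \<in> reduced_units (nf_lattice r' \<beta>' \<kappa>' p')"
    and eq: "(\<lambda>w. u * inverse (fls_X ^ n) * w) ` nf_lattice r \<beta> \<kappa> p =
       (\<lambda>w. u' * inverse (fls_X ^ n') * w) ` nf_lattice r' \<beta>' \<kappa>' p'"
  shows "r = r' \<and> \<beta> = \<beta>' \<and> \<kappa> = \<kappa>' \<and> p = p' \<and> u = u'"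
proof -
  define M M' where "M = nf_lattice r \<beta> \<kappa> p" and "M' = nf_lattice r' \<beta>' \<kappa>' p'"
  have nonneg: "vge 0 w" if "nf_ok r \<beta> \<kappa> p" "w \<in> nf_lattice r \<beta> \<kappa> p" for r \<beta> \<kappa> and p w :: "'k fls"
  proof (cases "w = 0")
    case False
    then have "fls_subdegree w \<in> vals (nf_lattice r \<beta> \<kappa> p)"
      using that unfolding vals_def by auto
    then have "0 \<le> fls_subdegree w"
      using that vals_nf_lattice[OF that(1)] by (auto simp: nf_ok_def)
    then show ?thesis
      by (simp add: vge_iff)
  qed simp
  have one: "1 \<in> M" "1 \<in> M'"
    using ok by (auto simp: M_def M'_def nf_ok_def intro!: one_mem_nf_lattice)
  have unit: "u \<noteq> 0" "fls_subdegree u = 0" if "u \<in> reduced_units M" for u :: "'k fls" and M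
    using that by (auto simp: reduced_units_def intro!: fls_subdegree_eqI)
  have le: "n \<le> n'"
    if prems: "u \<in> reduced_units A" "u' \<in> reduced_units A'" "1 \<in> A" "\<And>w. w \<in> A' \<Longrightarrow> vge 0 w"
      "(\<lambda>w. u * inverse (fls_X ^ n) * w) ` A \<subseteq> (\<lambda>w. u' * inverse (fls_X ^ n') * w) ` A'"
    for u u' :: "'k fls" and A A' n n'
  proof -
    obtain w where w: "w \<in> A'" "u * inverse (fls_X ^ n) = u' * inverse (fls_X ^ n') * w"
      using prems(3,5) by force
    have nz: "u * inverse (fls_X ^ n) \<noteq> 0"
      using unit[OF prems(1)] by simp
    have "fls_subdegree (u * inverse (fls_X ^ n)) = - int n"
      using unit[OF prems(1)] by simp
    moreover have "w \<noteq> 0"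
      using nz w(2) by auto
    then have "fls_subdegree (u' * inverse (fls_X ^ n') * w) = - int n' + fls_subdegree w" "0 \<le> fls_subdegree w"
      using unit[OF prems(2)] prems(4)[OF w(1)] by (simp_all add: vge_iff)
    ultimately show ?thesis
      using w(2) by simp
  qed
  have "n = n'"
    using le[OF u one(1)[unfolded M_def] nonneg[OF ok(2)]] le[OF u(2,1) one(2)[unfolded M'_def] nonneg[OF ok(1)]] eq
    by (simp add: le_antisym)
  have cancel: "inverse (fls_X ^ n) * x = inverse (fls_X ^ n) * y \<longleftrightarrow> x = y" for x y :: "'k fls"
    by simp
  have image_eq: "(\<lambda>w. u * w) ` M = (\<lambda>w. u' * w) ` M'"
  proof (intro Set.set_eqI)
    fix x
    have "x \<in> (\<lambda>w. v * w) ` A \<longleftrightarrow> inverse (fls_X ^ n) * x \<in> (\<lambda>w. v * inverse (fls_X ^ n) * w) ` A" for v and A :: "'k fls set"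
      by (auto simp: image_iff mult.assoc mult.left_commute[of v])
    then show "x \<in> (\<lambda>w. u * w) ` M \<longleftrightarrow> x \<in> (\<lambda>w. u' * w) ` M'"
      using eq \<open>n = n'\<close> by (simp add: M_def M'_def)
  qed
  have sub0: "fls_nth v (fls_subdegree d) = 0"
    if "v \<in> reduced_units A" "d \<in> (\<lambda>w. v * w) ` A" "d \<noteq> 0" "0 < fls_subdegree d" for v d :: "'k fls" and A
  proof -
    obtain w where w: "w \<in> A" "d = v * w"
      using \<open>d \<in> _\<close> by blast
    then have "w \<noteq> 0" "v \<noteq> 0"
      using \<open>d \<noteq> 0\<close> by auto
    then have "fls_subdegree w = fls_subdegree d"
      using w(2) unit[OF that(1)] by simp
    then have "fls_subdegree d \<in> vals A"
      using w(1) \<open>w \<noteq> 0\<close> unfolding vals_def by (metis (mono_tags, lifting) mem_Collect_eq)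
    then show ?thesis
      using that by (simp add: reduced_units_def)
  qed
  have "u = u'"
  proof (rule ccontr)
    assume "u \<noteq> u'"
    define d where "d = u - u'"
    have "d \<noteq> 0"
      using \<open>u \<noteq> u'\<close> by (simp add: d_def)
    have "u \<in> (\<lambda>w. u * w) ` M" "u' \<in> (\<lambda>w. u' * w) ` M'"
      using one by force+
    then obtain w where w: "u' = u * w" "w \<in> M"
      using image_eq by blast
    have "d = u * (1 - w)"
      by (simp add: d_def w(1) algebra_simps)
    moreover have "1 - w \<in> M"
      using one w(2) unfolding M_def by (intro nf_lattice_diff)
    ultimately have d: "d \<in> (\<lambda>w. u * w) ` M"
      by blast
    then have d': "d \<in> (\<lambda>w. u' * w) ` M'"
      using image_eq by blast
    have "fls_nth d j = 0" if "j \<le> 0" for j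
      using u that by (cases "j = 0") (auto simp: d_def reduced_units_def)
    then have pos: "0 < fls_subdegree d"
      using \<open>d \<noteq> 0\<close> by (meson linorder_not_le nth_fls_subdegree_nonzero)
    have "fls_nth u (fls_subdegree d) = 0" "fls_nth u' (fls_subdegree d) = 0"
      using sub0[OF u(1) d[unfolded M_def] \<open>d \<noteq> 0\<close> pos] sub0[OF u(2) d'[unfolded M'_def] \<open>d \<noteq> 0\<close> pos] by simp_all
    then have "fls_nth d (fls_subdegree d) = 0"
      by (simp add: d_def)
    then show False
      using \<open>d \<noteq> 0\<close> by simp
  qed
  then have "M = M'"
    using image_eq unit[OF u(1)] by (simp add: inj_image_eq_iff inj_on_def)
  then show ?thesis
    using nf_lattice_inject[OF ok] \<open>u = u'\<close> by (simp add: M_def M'_def)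
qed

section \<open>The degree-zero fiber and its parameters\<close>

definition springer_set :: "'k::field fls ^ 3 ^ 3 \<Rightarrow> ('k fls ^ 3 ^ 3) set" where
  "springer_set \<gamma> = {g. invertible g \<and> Ad (matrix_inv g) \<gamma> \<in> gl3_O \<and> fls_subdegree (det g) = 0}"

lemma stable_coset_invariant:
  assumes "invertible g" "h \<in> g <#\<^bsub>GL3\<^esub> GL3_O"
  shows "invertible h" "Ad (matrix_inv h) \<gamma> \<in> gl3_O \<longleftrightarrow> Ad (matrix_inv g) \<gamma> \<in> gl3_O"
    "fls_subdegree (det h) = fls_subdegree (det g)"
proof -
  obtain k where k: "k \<in> GL3_O" "h = g ** k"
    using assms(2) by (auto simp: l_coset_def GL3_def)
  then show inv: "invertible h"
    using assms(1) by (simp add: invertible_mult GL3_O_iff)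
  show "fls_subdegree (det h) = fls_subdegree (det g)"
    using assms(1) det_GL3_O[OF k(1)] by (simp add: k(2) det_mul invertible_det_nz)
  have kk: "k \<in> gl3_O" "invertible k" "matrix_inv k \<in> gl3_O"
    using k(1) by (simp_all add: GL3_O_iff)
  have eq: "Ad (matrix_inv h) \<gamma> = matrix_inv k ** (Ad (matrix_inv g) \<gamma>) ** k"
    unfolding Ad_matrix_inv[OF inv] Ad_matrix_inv[OF assms(1)]
    using assms(1) kk by (simp add: k(2) matrix_inv_mult matrix_mul_assoc)
  moreover have "Ad (matrix_inv g) \<gamma> = k ** (Ad (matrix_inv h) \<gamma>) ** matrix_inv k"
    unfolding eq using kk by (simp add: matrix_inv_cancel matrix_inv_right flip: matrix_mul_assoc)
  ultimately show "Ad (matrix_inv h) \<gamma> \<in> gl3_O \<longleftrightarrow> Ad (matrix_inv g) \<gamma> \<in> gl3_O"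
    using kk gl3_O_mult by metis
qed

lemma springer_set_coset:
  assumes "g \<in> springer_set \<gamma>" "h \<in> g <#\<^bsub>GL3\<^esub> GL3_O"
  shows "h \<in> springer_set \<gamma>"
  using assms stable_coset_invariant[of g h] by (simp add: springer_set_def)

lemma affine_Springer_fiber0_eq: "affine_Springer_fiber0 \<gamma> = (\<lambda>g. g <#\<^bsub>GL3\<^esub> GL3_O) ` springer_set \<gamma>"
proof (intro Set.set_eqI iffI)
  fix x assume "x \<in> affine_Springer_fiber0 \<gamma>"
  then obtain g where "x = g <#\<^bsub>GL3\<^esub> GL3_O" "invertible g" "Ad (matrix_inv g) \<gamma> \<in> gl3_O" "\<forall>g\<in>x. fls_subdegree (det g) = 0"
    by (auto simp: affine_Springer_fiber0_def affine_Springer_fiber_def GL3_def)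
  then show "x \<in> (\<lambda>g. g <#\<^bsub>GL3\<^esub> GL3_O) ` springer_set \<gamma>"
    using coset_self by (auto simp: springer_set_def)
next
  fix x assume "x \<in> (\<lambda>g. g <#\<^bsub>GL3\<^esub> GL3_O) ` springer_set \<gamma>"
  then obtain g where g: "g \<in> springer_set \<gamma>" "x = g <#\<^bsub>GL3\<^esub> GL3_O"
    by blast
  then have "\<forall>h\<in>x. fls_subdegree (det h) = 0"
    using springer_set_coset by (auto simp: springer_set_def)
  then show "x \<in> affine_Springer_fiber0 \<gamma>"
    using g by (auto simp: springer_set_def affine_Springer_fiber0_def affine_Springer_fiber_def GL3_def)
qed

text \<open>Two maps with the same fibers have images in bijection. This passes from lattices to
  cosets without choosing representatives.\<close>

lemma card_image_cong_kernel:
  assumes "\<And>x y. x \<in> A \<Longrightarrow> y \<in> A \<Longrightarrow> f x = f y \<longleftrightarrow> g x = g y"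
  shows "card (f ` A) = card (g ` A)" "finite (f ` A) \<longleftrightarrow> finite (g ` A)"
proof -
  define h where "h y = g (SOME x. x \<in> A \<and> f x = y)" for y
  have h: "h (f x) = g x" if "x \<in> A" for x
    using someI_ex[of "\<lambda>y. y \<in> A \<and> f y = f x"] that assms unfolding h_def by blast
  have "bij_betw h (f ` A) (g ` A)"
    unfolding bij_betw_def by (auto simp: inj_on_def h assms image_image)
  then show "card (f ` A) = card (g ` A)" "finite (f ` A) \<longleftrightarrow> finite (g ` A)"
    by (auto simp: bij_betw_same_card bij_betw_finite)
qed

text \<open>The power of X in the divisor is not a parameter: determinant valuation 0 forces the
  exponent - (\<beta> + \<kappa>).\<close>

definition springer_params :: "'k::field fls \<Rightarrow> 'k fls \<Rightarrow> ((nat \<times> nat \<times> nat) \<times> 'k fls \<times> 'k fls) set" where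
  "springer_params B C = {((r, \<beta>, \<kappa>), p, u). nf_ok r \<beta> \<kappa> p \<and>
     nf_inv r \<beta> \<kappa> p ** E3_mat (fls_X * emb B + fls_X ^ 2 * emb C) ** nf_mat r \<beta> \<kappa> p \<in> gl3_O \<and>
     u \<in> reduced_units (nf_lattice r \<beta> \<kappa> p)}"

text \<open>Multiplications in E3 commute, so x drops out of the conjugated matrix and matters only
  for the determinant.\<close>

lemma scaled_nf_mat_mem_springer_set_iff:
  assumes "x \<noteq> 0"
  shows "E3_mat x ** nf_mat r \<beta> \<kappa> p \<in> springer_set (E3_mat g) \<longleftrightarrow>
    nf_inv r \<beta> \<kappa> p ** E3_mat g ** nf_mat r \<beta> \<kappa> p \<in> gl3_O \<and> fls_subdegree x + int (\<beta> + \<kappa>) = 0"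
proof -
  have inv: "invertible (E3_mat x ** nf_mat r \<beta> \<kappa> p)"
    by (simp add: assms invertible_E3_mat invertible_mult invertible_nf_mat)
  have "matrix_inv (E3_mat x ** nf_mat r \<beta> \<kappa> p) = nf_inv r \<beta> \<kappa> p ** E3_mat (inverse x)"
    using assms matrix_inv_unique[OF E3_mat_inverse(1)[OF assms]]
    by (simp add: matrix_inv_mult invertible_E3_mat invertible_nf_mat matrix_inv_nf_mat)
  then have "Ad (matrix_inv (E3_mat x ** nf_mat r \<beta> \<kappa> p)) (E3_mat g) =
      nf_inv r \<beta> \<kappa> p ** E3_mat (inverse x * g * x) ** nf_mat r \<beta> \<kappa> p"
    unfolding Ad_matrix_inv[OF inv] by (simp add: E3_mat_mult matrix_mul_assoc)
  also have "inverse x * g * x = g"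
    using assms by simp
  finally have "Ad (matrix_inv (E3_mat x ** nf_mat r \<beta> \<kappa> p)) (E3_mat g) =
      nf_inv r \<beta> \<kappa> p ** E3_mat g ** nf_mat r \<beta> \<kappa> p" .
  moreover have "det (nf_mat r \<beta> \<kappa> p) \<noteq> 0"
    using invertible_nf_mat invertible_det_nz by blast
  ultimately show ?thesis
    using inv assms by (simp add: springer_set_def det_mul subdegree_det_E3_mat det_E3_mat_nonzero subdegree_det_nf_mat)
qed

text \<open>The divisor is taken to be a reduced element x of least valuation in L. Then x^(-1) L
  contains 1 and lies in the ring of integers, so it has a normal form, and the determinant fixes
  the valuation of x.\<close>

lemma lattice_of_springer_set:
  fixes B C :: "'k::field fls"
  defines "\<gamma> \<equiv> E3_mat (fls_X * emb B + fls_X ^ 2 * emb C)"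
  shows "lattice_of ` springer_set \<gamma> =
    (\<lambda>((r, \<beta>, \<kappa>), p, u). (\<lambda>w. u * inverse (fls_X ^ (\<beta> + \<kappa>)) * w) ` nf_lattice r \<beta> \<kappa> p) ` springer_params B C"
proof (intro Set.set_eqI iffI)
  fix L assume "L \<in> lattice_of ` springer_set \<gamma>"
  then obtain g where g: "g \<in> springer_set \<gamma>" "L = lattice_of g"
    by blast
  then have invg: "invertible g" and L: "O_lattice L"
    by (auto simp: springer_set_def O_lattice_lattice_of)
  obtain C0 D0 where C0: "\<And>w. vge C0 w \<Longrightarrow> w \<in> L" and D0: "\<And>w. w \<in> L \<Longrightarrow> vge D0 w"
    using L unfolding O_lattice_def by blast
  have "fls_X ^ nat C0 \<in> L"
    by (rule C0) simp
  then have "int (nat C0) \<in> vals L"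
    unfolding vals_def by (force intro!: exI[of _ "fls_X ^ nat C0"])
  moreover have vals_D0: "D0 \<le> j" if "j \<in> vals L" for j
    using that D0 by (auto simp: vals_def vge_iff)
  ultimately have ex: "\<exists>m. D0 + int m \<in> vals L"
    by (metis nonneg_int_cases le_add_diff_inverse diff_ge_0_iff_ge)
  \<comment> \<open>Valuations in L are bounded below by D0; counting from there turns the minimum
    into a \<open>LEAST\<close> over naturals.\<close>
  define m where "m = (LEAST m. D0 + int m \<in> vals L)"
  define a where "a = D0 + int m"
  have a: "a \<in> vals L"
    unfolding a_def m_def using ex by (rule LeastI_ex)
  have a_min: "a \<le> j" if j: "j \<in> vals L" for j
  proof -
    obtain l where "j = D0 + int l"
      using vals_D0[OF j] by (metis nonneg_int_cases le_add_diff_inverse diff_ge_0_iff_ge)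
    then show ?thesis
      using j Least_le[of "\<lambda>m. D0 + int m \<in> vals L" l] by (simp add: a_def m_def)
  qed
  obtain x where x: "x \<in> L" "fls_nth x a = 1" "\<And>j. j < a \<Longrightarrow> fls_nth x j = 0"
    "\<And>j. j \<in> vals L \<Longrightarrow> j > a \<Longrightarrow> fls_nth x j = 0"
    using reduced_element_ex[OF L a] by blast
  have x0: "x \<noteq> 0" and x_sub: "fls_subdegree x = a"
    using x by (auto intro!: fls_subdegree_eqI)
  define L' where "L' = {w. x * w \<in> L}"
  have L_eq: "L = (\<lambda>w. x * w) ` L'"
  proof (intro Set.set_eqI iffI)
    fix w assume "w \<in> L"
    then show "w \<in> (\<lambda>w. x * w) ` L'"
      using x0 by (intro image_eqI[of _ _ "inverse x * w"]) (simp_all add: L'_def flip: mult.assoc)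
  qed (auto simp: L'_def)
  have nonneg: "vge 0 w" if "w \<in> L'" for w
  proof (cases "w = 0")
    case False
    have "fls_subdegree (x * w) \<in> vals L"
      using that False x0 by (intro valsI) (simp_all add: L'_def)
    then show ?thesis
      using a_min False x0 x_sub by (force simp: vge_iff)
  qed simp
  have "O_lattice L'"
    unfolding O_lattice_def
  proof (intro conjI ballI allI impI)
    fix v w assume "v \<in> L'" "w \<in> L'"
    then show "v + w \<in> L'"
      using lattice_add[OF L] by (simp add: L'_def distrib_left)
  next
    fix b w :: "'k fls" assume "w \<in> L'" "vge 0 b"
    then show "emb b * w \<in> L'"
      using lattice_emb[OF L, of b "x * w"] by (simp add: L'_def mult.left_commute)
  next
    show "\<exists>C. \<forall>w. vge C w \<longrightarrow> w \<in> L'"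
      using C0 x0 by (intro exI[of _ "C0 - a"]) (simp add: L'_def vge_mult_iff x_sub)
  next
    show "\<exists>D. \<forall>w\<in>L'. vge D w"
      using nonneg by blast
  qed
  then obtain r \<beta> \<kappa> p where nf: "nf_ok r \<beta> \<kappa> p" "L' = nf_lattice r \<beta> \<kappa> p"
    using nf_lattice_exists[of L'] x(1) nonneg by (auto simp: L'_def)
  have r: "r = 1 \<or> r = 2"
    using nf(1) by (simp add: nf_ok_def)
  have "lattice_of (E3_mat x ** nf_mat r \<beta> \<kappa> p) = lattice_of g"
    using lattice_of_nf_mat[OF r x0] L_eq g nf by simp
  moreover have h: "invertible (E3_mat x ** nf_mat r \<beta> \<kappa> p)"
    by (simp add: x0 invertible_E3_mat invertible_mult invertible_nf_mat)
  ultimately have "E3_mat x ** nf_mat r \<beta> \<kappa> p \<in> g <#\<^bsub>GL3\<^esub> GL3_O"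
    using lattice_of_eq_iff[OF h invg] coset_self[OF h] by simp
  then have "E3_mat x ** nf_mat r \<beta> \<kappa> p \<in> springer_set \<gamma>"
    using g springer_set_coset by blast
  then have st: "nf_inv r \<beta> \<kappa> p ** \<gamma> ** nf_mat r \<beta> \<kappa> p \<in> gl3_O" "a = - int (\<beta> + \<kappa>)"
    using scaled_nf_mat_mem_springer_set_iff[OF x0] x_sub unfolding \<gamma>_def by auto
  define u where "u = fls_X ^ (\<beta> + \<kappa>) * x"
  have u_nth: "fls_nth u j = fls_nth x (j + a)" for j
    by (simp add: u_def st(2) X_power_mult_nth) (simp add: algebra_simps)
  have xu: "x = u * inverse (fls_X ^ (\<beta> + \<kappa>))"
    by (simp add: u_def mult.commute[of _ x] mult.assoc)
  \<comment> \<open>Multiplication by x shifts the valuations of L' by a, so the zeros of x at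
    valuations of L above a become the zeros required of u.\<close>
  have "j + a \<in> vals L" if j: "j \<in> vals L'" for j
  proof -
    obtain w where "w \<in> L'" "w \<noteq> 0" "j = fls_subdegree w"
      using j unfolding vals_def by auto
    then show ?thesis
      using x0 x_sub valsI[of "x * w" L] by (simp add: L'_def add.commute)
  qed
  then have "u \<in> reduced_units L'"
    using x by (auto simp: reduced_units_def u_nth)
  then have "((r, \<beta>, \<kappa>), p, u) \<in> springer_params B C"
    using nf st(1) by (simp add: springer_params_def \<gamma>_def)
  moreover have "L = (\<lambda>w. u * inverse (fls_X ^ (\<beta> + \<kappa>)) * w) ` nf_lattice r \<beta> \<kappa> p"
    using L_eq nf xu by simp
  ultimately show "L \<in> (\<lambda>((r, \<beta>, \<kappa>), p, u). (\<lambda>w. u * inverse (fls_X ^ (\<beta> + \<kappa>)) * w) ` nf_lattice r \<beta> \<kappa> p) ` springer_params B C"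
    by force
next
  fix L assume "L \<in> (\<lambda>((r, \<beta>, \<kappa>), p, u). (\<lambda>w. u * inverse (fls_X ^ (\<beta> + \<kappa>)) * w) ` nf_lattice r \<beta> \<kappa> p) ` springer_params B C"
  then obtain r \<beta> \<kappa> p u where *: "((r, \<beta>, \<kappa>), p, u) \<in> springer_params B C"
    "L = (\<lambda>w. u * inverse (fls_X ^ (\<beta> + \<kappa>)) * w) ` nf_lattice r \<beta> \<kappa> p"
    by auto
  define x where "x = u * inverse (fls_X ^ (\<beta> + \<kappa>))"
  have u: "u \<noteq> 0" "fls_subdegree u = 0"
    using *(1) by (auto simp: springer_params_def reduced_units_def intro!: fls_subdegree_eqI)
  then have x: "x \<noteq> 0" "fls_subdegree x = - int (\<beta> + \<kappa>)"
    by (simp_all add: x_def)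
  have "E3_mat x ** nf_mat r \<beta> \<kappa> p \<in> springer_set \<gamma>"
    using *(1) x by (simp add: springer_params_def \<gamma>_def scaled_nf_mat_mem_springer_set_iff)
  moreover have "lattice_of (E3_mat x ** nf_mat r \<beta> \<kappa> p) = L"
    using *(1) lattice_of_nf_mat[OF _ x(1)] unfolding *(2) x_def[symmetric]
    by (auto simp: springer_params_def nf_ok_def)
  ultimately show "L \<in> lattice_of ` springer_set \<gamma>"
    by blast
qed

text \<open>Finiteness is carried along separately because \<open>card\<close> is 0 on infinite
  sets.\<close>

lemma card_affine_Springer_fiber0:
  fixes B C :: "'k::field fls"
  defines "\<gamma> \<equiv> E3_mat (fls_X * emb B + fls_X ^ 2 * emb C)"
  shows "card (affine_Springer_fiber0 \<gamma>) = card (springer_params B C)"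
    and "finite (affine_Springer_fiber0 \<gamma>) \<longleftrightarrow> finite (springer_params B C)"
proof -
  define \<Psi> :: "(nat \<times> nat \<times> nat) \<times> 'k fls \<times> 'k fls \<Rightarrow> 'k fls set"
    where "\<Psi> = (\<lambda>((r, \<beta>, \<kappa>), p, u). (\<lambda>w. u * inverse (fls_X ^ (\<beta> + \<kappa>)) * w) ` nf_lattice r \<beta> \<kappa> p)"
  have "inj_on \<Psi> (springer_params B C)"
  proof (rule inj_onI)
    fix s t assume *: "s \<in> springer_params B C" "t \<in> springer_params B C" "\<Psi> s = \<Psi> t"
    obtain r \<beta> \<kappa> p u where s: "s = ((r, \<beta>, \<kappa>), p, u)"
      by (metis surj_pair)
    obtain r' \<beta>' \<kappa>' p' u' where t: "t = ((r', \<beta>', \<kappa>'), p', u')"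
      by (metis surj_pair)
    show "s = t"
      using * scaled_nf_lattice_inject[of r \<beta> \<kappa> p r' \<beta>' \<kappa>' p' u u' "\<beta> + \<kappa>" "\<beta>' + \<kappa>'"]
      by (simp add: s t \<Psi>_def springer_params_def)
  qed
  moreover have "lattice_of ` springer_set \<gamma> = \<Psi> ` springer_params B C"
    unfolding \<gamma>_def \<Psi>_def by (rule lattice_of_springer_set)
  ultimately have 1: "card (lattice_of ` springer_set \<gamma>) = card (springer_params B C)"
    "finite (lattice_of ` springer_set \<gamma>) \<longleftrightarrow> finite (springer_params B C)"
    by (simp_all add: card_image finite_image_iff)
  have "lattice_of g = lattice_of h \<longleftrightarrow> g <#\<^bsub>GL3\<^esub> GL3_O = h <#\<^bsub>GL3\<^esub> GL3_O"
    if "g \<in> springer_set \<gamma>" "h \<in> springer_set \<gamma>" for g h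
    using that by (simp add: springer_set_def lattice_of_eq_iff)
  from card_image_cong_kernel[of "springer_set \<gamma>" lattice_of, OF this] 1
  show "card (affine_Springer_fiber0 \<gamma>) = card (springer_params B C)"
    and "finite (affine_Springer_fiber0 \<gamma>) \<longleftrightarrow> finite (springer_params B C)"
    unfolding affine_Springer_fiber0_eq by simp_all
qed

subsection \<open>Counting the parameters\<close>

text \<open>All parameter sets below have this shape: s prescribes the coefficients outside the
  finite set S of free exponents.\<close>

lemma card_fls_fixed_coeffs:
  fixes s :: "'k::{zero, finite} fls"
  assumes "finite S"
  shows "card {f. \<forall>i. i \<notin> S \<longrightarrow> fls_nth f i = fls_nth s i} = CARD('k) ^ card S"
    and "finite {f. \<forall>i. i \<notin> S \<longrightarrow> fls_nth f i = fls_nth s i}"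
proof -
  let ?A = "{f. \<forall>i. i \<notin> S \<longrightarrow> fls_nth f i = fls_nth s i}"
  have "bij_betw (\<lambda>f. restrict (fls_nth f) S) ?A (S \<rightarrow>\<^sub>E UNIV)"
  proof (rule bij_betwI')
    fix f g assume "f \<in> ?A" "g \<in> ?A"
    then show "restrict (fls_nth f) S = restrict (fls_nth g) S \<longleftrightarrow> f = g"
      unfolding fls_eq_iff by (auto simp: fun_eq_iff restrict_def) metis
  next
    fix h :: "int \<Rightarrow> 'k" assume h: "h \<in> S \<rightarrow>\<^sub>E UNIV"
    define f where "f = Abs_fls (\<lambda>i. if i \<in> S then h i else fls_nth s i)"
    have "\<exists>N. \<forall>i<N. i \<notin> S"
    proof (cases "S = {}")
      case False
      then show ?thesis
        using assms by (intro exI[of _ "Min S"]) auto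
    qed simp
    then obtain N where N: "\<And>i. i < N \<Longrightarrow> i \<notin> S"
      by blast
    have "fls_nth f i = (if i \<in> S then h i else fls_nth s i)" for i
      unfolding f_def
      by (rule nth_Abs_fls_ex_lower_bound) (auto intro!: exI[of _ "min N (fls_subdegree s)"] dest: N)
    then have "f \<in> ?A" "h = restrict (fls_nth f) S"
      using h by (auto simp: fun_eq_iff PiE_def extensional_def restrict_def)
    then show "\<exists>f\<in>?A. h = restrict (fls_nth f) S"
      by blast
  qed simp
  note bij = this
  have "card (S \<rightarrow>\<^sub>E (UNIV :: 'k set)) = CARD('k) ^ card S" "finite (S \<rightarrow>\<^sub>E (UNIV :: 'k set))"
    using assms by (simp_all add: card_PiE finite_PiE)
  then show "card ?A = CARD('k) ^ card S" "finite ?A"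
    using bij_betw_same_card[OF bij] bij_betw_finite[OF bij] by simp_all
qed

text \<open>The free coefficients sit at the positive integers that are not valuations of the
  lattice: \<beta> of them in the class of r and \<kappa> in the class of 3 - r. Elsewhere u agrees
  with the series 1.\<close>

lemma card_reduced_units:
  fixes p :: "'k::{field, finite} fls"
  assumes ok: "nf_ok r \<beta> \<kappa> p"
  shows "card (reduced_units (nf_lattice r \<beta> \<kappa> p)) = CARD('k) ^ (\<beta> + \<kappa>)"
    and "finite (reduced_units (nf_lattice r \<beta> \<kappa> p))"
proof -
  have r: "r = 1 \<or> r = 2"
    using ok by (simp add: nf_ok_def)
  define G1 where "G1 = (\<lambda>i::nat. 3 * int i + int r) ` {..<\<beta>}"
  define G2 where "G2 = (\<lambda>i::nat. 3 * int i + int (3 - r)) ` {..<\<kappa>}"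
  have G: "i \<in> G1 \<union> G2 \<longleftrightarrow> 0 < i \<and> i \<notin> vals (nf_lattice r \<beta> \<kappa> p)" for i
  proof
    assume "i \<in> G1 \<union> G2"
    then show "0 < i \<and> i \<notin> vals (nf_lattice r \<beta> \<kappa> p)"
      using r unfolding vals_nf_lattice[OF ok] G1_def G2_def by (auto simp: mod_simps; presburger)
  next
    assume *: "0 < i \<and> i \<notin> vals (nf_lattice r \<beta> \<kappa> p)"
    then have "0 \<le> i div 3"
      by (simp add: pos_imp_zdiv_nonneg_iff)
    then obtain m where "i div 3 = int m"
      by (rule nonneg_int_cases)
    then have m: "i = 3 * int m + i mod 3"
      using mult_div_mod_eq[of 3 i] by simp
    have "i mod 3 = 0 \<or> i mod 3 = 1 \<or> i mod 3 = 2"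
      by presburger
    then have "i mod 3 = int r \<and> i < 3 * int \<beta> + int r \<or> i mod 3 = int (3 - r) \<and> i < 3 * int \<kappa> + int (3 - r)"
      using r * unfolding vals_nf_lattice[OF ok] by auto
    then have "i = 3 * int m + int r \<and> m < \<beta> \<or> i = 3 * int m + int (3 - r) \<and> m < \<kappa>"
      using m by auto
    then show "i \<in> G1 \<union> G2"
      unfolding G1_def G2_def by blast
  qed
  have "G1 \<inter> G2 = {}"
    using r unfolding G1_def G2_def by auto presburger+
  moreover have "card G1 = \<beta>" "card G2 = \<kappa>"
    unfolding G1_def G2_def by (subst card_image; simp add: inj_on_def)+
  ultimately have card_G: "finite (G1 \<union> G2)" "card (G1 \<union> G2) = \<beta> + \<kappa>"
    by (simp_all add: card_Un_disjoint G1_def G2_def)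
  have "reduced_units (nf_lattice r \<beta> \<kappa> p) = {u. \<forall>i. i \<notin> G1 \<union> G2 \<longrightarrow> fls_nth u i = fls_nth 1 i}"
    unfolding reduced_units_def G by (auto simp: not_less le_less)
  then show "card (reduced_units (nf_lattice r \<beta> \<kappa> p)) = CARD('k) ^ (\<beta> + \<kappa>)"
    and "finite (reduced_units (nf_lattice r \<beta> \<kappa> p))"
    using card_fls_fixed_coeffs[OF card_G(1), of 1] card_G(2) by simp_all
qed

lemma card_nf_params_1:
  assumes "\<beta> \<le> \<kappa>"
  shows "card {p :: 'k::{field, finite} fls. nf_ok 1 \<beta> \<kappa> p} = CARD('k) ^ (\<kappa> - \<beta>)"
    and "finite {p :: 'k fls. nf_ok 1 \<beta> \<kappa> p}"
proof -
  have "{p :: 'k fls. nf_ok 1 \<beta> \<kappa> p} =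
      {p. \<forall>i. i \<notin> {0..<int \<kappa> - int \<beta>} \<longrightarrow> fls_nth p i = fls_nth 0 i}"
    using assms by (auto simp: nf_ok_def)
  then show "card {p :: 'k fls. nf_ok 1 \<beta> \<kappa> p} = CARD('k) ^ (\<kappa> - \<beta>)"
    and "finite {p :: 'k fls. nf_ok 1 \<beta> \<kappa> p}"
    using card_fls_fixed_coeffs[of "{0..<int \<kappa> - int \<beta>}" "0 :: 'k fls"] assms
    by (simp_all add: nat_diff_distrib' flip: of_nat_diff)
qed

text \<open>Since B - C p = C (B/C - p), the condition makes p agree with B/C below \<kappa> - n.
  This is compatible with p starting at exponent 1, because n < n1 gives B/C positive valuation, and
  with p ending before \<kappa> - \<beta>, because \<beta> \<le> n.\<close>

lemma card_nf_params_2: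
  fixes B C :: "'k::{field, finite} fls"
  assumes BC: "B \<noteq> 0" "C \<noteq> 0" and val: "fls_subdegree B = int n1" "fls_subdegree C = int n" "n < n1"
    and le: "\<beta> \<le> n" "\<beta> < \<kappa>"
  shows "card {p. nf_ok 2 \<beta> \<kappa> p \<and> vge (int \<kappa>) (B - C * p)} = CARD('k) ^ min (\<kappa> - \<beta> - 1) (n - \<beta>)"
    and "finite {p. nf_ok 2 \<beta> \<kappa> p \<and> vge (int \<kappa>) (B - C * p)}"
proof -
  define s where "s = B * inverse C"
  have s: "vge 1 s"
    using BC val by (simp add: s_def vge_iff)
  obtain s' where s': "\<And>i. fls_nth s' i = (if i < int \<kappa> - int n then fls_nth s i else 0)"
    using fls_filter_ex[of "\<lambda>i. i < int \<kappa> - int n" s] by blast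
  define S where "S = {max 1 (int \<kappa> - int n)..<int \<kappa> - int \<beta>}"
  have "B - C * p = C * (s - p)" for p
    using BC by (simp add: s_def algebra_simps)
  then have "vge (int \<kappa>) (B - C * p) \<longleftrightarrow> (\<forall>i < int \<kappa> - int n. fls_nth p i = fls_nth s i)" for p
    using BC val unfolding \<open>\<And>p. B - C * p = C * (s - p)\<close> vge_mult_iff[OF BC(2)] by (auto simp: vge_def)
  moreover have "nf_ok 2 \<beta> \<kappa> p \<and> (\<forall>i < int \<kappa> - int n. fls_nth p i = fls_nth s i) \<longleftrightarrow>
      (\<forall>i. i \<notin> S \<longrightarrow> fls_nth p i = fls_nth s' i)" for p
  proof (intro iffI conjI allI impI)
    fix i assume "nf_ok 2 \<beta> \<kappa> p \<and> (\<forall>i < int \<kappa> - int n. fls_nth p i = fls_nth s i)" "i \<notin> S"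
    then show "fls_nth p i = fls_nth s' i"
      by (auto simp: s' nf_ok_def S_def max_def split: if_splits)
  next
    assume *: "\<forall>i. i \<notin> S \<longrightarrow> fls_nth p i = fls_nth s' i"
    have "1 \<le> i \<and> i < int \<kappa> - int \<beta>" if "fls_nth p i \<noteq> 0" for i
    proof (cases "i \<in> S")
      case False
      then have "fls_nth s' i \<noteq> 0"
        using * that by auto
      then have "i < int \<kappa> - int n" "fls_nth s i \<noteq> 0"
        by (auto simp: s' split: if_splits)
      then show ?thesis
        using s le by (auto simp: vge_def simp flip: linorder_not_less)
    qed (auto simp: S_def)
    then show "nf_ok 2 \<beta> \<kappa> p"
      using le by (auto simp: nf_ok_def)
  next
    fix i assume *: "\<forall>i. i \<notin> S \<longrightarrow> fls_nth p i = fls_nth s' i" "i < int \<kappa> - int n"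
    then show "fls_nth p i = fls_nth s i"
      by (auto simp: S_def s')
  qed
  ultimately have "{p. nf_ok 2 \<beta> \<kappa> p \<and> vge (int \<kappa>) (B - C * p)} = {p. \<forall>i. i \<notin> S \<longrightarrow> fls_nth p i = fls_nth s' i}"
    by simp
  moreover have "card S = min (\<kappa> - \<beta> - 1) (n - \<beta>)"
    using le by (auto simp: S_def)
  moreover have "finite S"
    by (simp add: S_def)
  ultimately show "card {p. nf_ok 2 \<beta> \<kappa> p \<and> vge (int \<kappa>) (B - C * p)} = CARD('k) ^ min (\<kappa> - \<beta> - 1) (n - \<beta>)"
    and "finite {p. nf_ok 2 \<beta> \<kappa> p \<and> vge (int \<kappa>) (B - C * p)}"
    using card_fls_fixed_coeffs[of S s'] by simp_all
qed

text \<open>An antidiagonal i + j = s with s \<le> n has s + 1 points. Those with s > n are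
  reflected by (i, j) to (n - i, n - j) into the triangle i + j < n.\<close>

lemma sum_square_diagonals:
  fixes F :: "nat \<Rightarrow> 'a::comm_semiring_1"
  shows "(\<Sum>(i, j) \<in> {..n} \<times> {..n}. F (i + j)) =
    (\<Sum>s\<le>n. of_nat (s + 1) * F s) + (\<Sum>s<n. of_nat (s + 1) * F (2 * n - s))"
proof -
  let ?U = "{(i, j). i + j \<le> n}" and ?V = "{(i, j). i + j < n}"
  have "{..n} \<times> {..n} = ?U \<union> (\<lambda>(i, j). (n - i, n - j)) ` ?V" (is "_ = _ \<union> ?W")
  proof (intro Set.set_eqI iffI)
    fix x assume "x \<in> {..n} \<times> {..n}"
    then obtain i j where ij: "x = (i, j)" "i \<le> n" "j \<le> n"
      by blast
    show "x \<in> ?U \<union> ?W"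
    proof (cases "i + j \<le> n")
      case False
      then show ?thesis
        using ij by (intro UnI2 image_eqI[of _ _ "(n - i, n - j)"]) auto
    qed (use ij in auto)
  qed auto
  moreover have "?U \<inter> ?W = {}"
    by auto
  moreover have "finite ?U" "finite ?W"
    by (rule finite_subset[of _ "{..n} \<times> {..n}"]; auto)+
  ultimately have "(\<Sum>(i, j) \<in> {..n} \<times> {..n}. F (i + j)) = (\<Sum>(i, j) \<in> ?U. F (i + j)) + (\<Sum>(i, j) \<in> ?W. F (i + j))"
    by (simp add: sum.union_disjoint)
  also have "(\<Sum>(i, j) \<in> ?U. F (i + j)) = (\<Sum>s\<le>n. of_nat (s + 1) * F s)"
    by (simp add: sum.triangle_reindex_eq)
  also have "(\<Sum>(i, j) \<in> ?W. F (i + j)) = (\<Sum>(i, j) \<in> ?V. F (2 * n - (i + j)))"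
    by (subst sum.reindex) (auto simp: inj_on_def intro!: sum.cong arg_cong[of _ _ F])
  also have "\<dots> = (\<Sum>s<n. of_nat (s + 1) * F (2 * n - s))"
    by (subst sum.triangle_reindex) simp
  finally show ?thesis .
qed

lemma card_springer_params:
  fixes B C :: "'k::{field, finite} fls"
  assumes BC: "B \<noteq> 0" "C \<noteq> 0" and val: "fls_subdegree B = int n1" "fls_subdegree C = int n" "n < n1"
  defines "q \<equiv> CARD('k)"
  shows "card (springer_params B C) =
    (\<Sum>k\<le>n. (k + 1) * (q ^ (2 * k) + q ^ (2 * k + 1))) + (\<Sum>j<n. (j + 1) * q ^ (3 * n + 1 - j))"
    and "finite (springer_params B C)"
proof -
  define I1 where "I1 = (SIGMA \<kappa> : {..n}. {..\<kappa>})"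
  define I2 where "I2 = (SIGMA \<beta> : {..n}. {\<beta> + 1..\<beta> + n + 1})"
  define U1 where "U1 \<beta> \<kappa> = (SIGMA p : {p :: 'k fls. nf_ok 1 \<beta> \<kappa> p}. reduced_units (nf_lattice 1 \<beta> \<kappa> p))" for \<beta> \<kappa>
  define U2 where "U2 \<beta> \<kappa> = (SIGMA p : {p. nf_ok 2 \<beta> \<kappa> p \<and> vge (int \<kappa>) (B - C * p)}. reduced_units (nf_lattice 2 \<beta> \<kappa> p))" for \<beta> \<kappa>
  define S1 where "S1 = (SIGMA x : I1. U1 (snd x) (fst x))"
  define S2 where "S2 = (SIGMA x : I2. U2 (fst x) (snd x))"
  have eq: "springer_params B C = (\<lambda>((\<kappa>, \<beta>), p, u). ((1, \<beta>, \<kappa>), p, u)) ` S1 \<union> (\<lambda>((\<beta>, \<kappa>), p, u). ((2, \<beta>, \<kappa>), p, u)) ` S2"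
    (is "_ = ?T1 \<union> ?T2")
  proof (intro Set.set_eqI iffI)
    fix t assume t: "t \<in> springer_params B C"
    obtain r \<beta> \<kappa> p u where tt: "t = ((r, \<beta>, \<kappa>), p, u)"
      by (metis surj_pair)
    have ok: "nf_ok r \<beta> \<kappa> p" and u: "u \<in> reduced_units (nf_lattice r \<beta> \<kappa> p)"
      and st: "if r = 2 then \<beta> \<le> n \<and> \<kappa> \<le> \<beta> + n + 1 \<and> vge (int \<kappa>) (B - C * p) else \<kappa> \<le> n"
      using t stable_nf_mat_iff[OF _ BC val, of r \<beta> \<kappa> p] by (auto simp: springer_params_def tt)
    from ok have \<beta>\<kappa>: "\<beta> + r \<le> \<kappa> + 1" and "r = 1 \<or> r = 2"
      by (simp_all add: nf_ok_def)
    then consider "r = 1" | "r = 2" by blast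
    then show "t \<in> ?T1 \<union> ?T2"
    proof cases
      case 1
      then show ?thesis
        using ok u st \<beta>\<kappa> by (intro UnI1 image_eqI[of _ _ "((\<kappa>, \<beta>), p, u)"]) (auto simp: S1_def I1_def U1_def tt)
    next
      case 2
      then show ?thesis
        using ok u st \<beta>\<kappa> by (intro UnI2 image_eqI[of _ _ "((\<beta>, \<kappa>), p, u)"]) (auto simp: S2_def I2_def U2_def tt)
    qed
  next
    fix t assume "t \<in> ?T1 \<union> ?T2"
    then show "t \<in> springer_params B C"
      using stable_nf_mat_iff[OF _ BC val] by (auto simp: springer_params_def S1_def S2_def I1_def I2_def U1_def U2_def)
  qed
  have fin_I: "finite I1" "finite I2"
    by (simp_all add: I1_def I2_def)
  have c1: "card (U1 \<beta> \<kappa>) = q ^ (2 * \<kappa>)" and f1: "finite (U1 \<beta> \<kappa>)"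
    if "\<beta> \<le> \<kappa>" for \<beta> \<kappa>
    using card_nf_params_1[OF that, where 'k='k] that
    by (auto simp: card_SigmaI card_reduced_units U1_def q_def mult_2 simp flip: power_add)
  have c2: "card (U2 \<beta> \<kappa>) = q ^ (min (\<kappa> - \<beta> - 1) (n - \<beta>) + \<beta> + \<kappa>)" and f2: "finite (U2 \<beta> \<kappa>)"
    if "\<beta> \<le> n" "\<beta> < \<kappa>" for \<beta> \<kappa>
    using card_nf_params_2[OF BC val that] that
    by (auto simp: card_SigmaI card_reduced_units U2_def q_def add.assoc simp flip: power_add)
  have fin: "finite S1" "finite S2"
    unfolding S1_def S2_def using fin_I f1 f2 by (auto simp: I1_def I2_def intro!: finite_SigmaI)
  have "card S1 = (\<Sum>(\<kappa>, \<beta>)\<in>I1. q ^ (2 * \<kappa>))"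
    unfolding S1_def using fin_I(1) f1 c1
    by (subst card_SigmaI) (auto simp: I1_def split_def intro!: sum.cong)
  also have "\<dots> = (\<Sum>k\<le>n. (k + 1) * q ^ (2 * k))"
    unfolding I1_def by (subst sum.Sigma[symmetric]) simp_all
  finally have card_S1: "card S1 = (\<Sum>k\<le>n. (k + 1) * q ^ (2 * k))" .
  \<comment> \<open>With d = \<kappa> - \<beta> - 1 and s = \<beta> + d one has \<kappa> = s + 1, so
    the exponent from p and u together is min s n + s + 1.\<close>
  define F where "F s = q ^ min (2 * s + 1) (n + s + 1)" for s
  have "card S2 = (\<Sum>(\<beta>, \<kappa>)\<in>I2. q ^ (min (\<kappa> - \<beta> - 1) (n - \<beta>) + \<beta> + \<kappa>))"
    unfolding S2_def using fin_I(2) f2 c2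
    by (subst card_SigmaI) (auto simp: I2_def split_def intro!: sum.cong)
  also have "\<dots> = (\<Sum>(\<beta>, d)\<in>{..n} \<times> {..n}. F (\<beta> + d))"
  proof (rule sum.reindex_bij_witness[of _ "\<lambda>(\<beta>, d). (\<beta>, \<beta> + 1 + d)" "\<lambda>(\<beta>, \<kappa>). (\<beta>, \<kappa> - \<beta> - 1)"])
    fix x assume "x \<in> I2"
    then obtain \<beta> \<kappa> where x: "x = (\<beta>, \<kappa>)" "\<beta> \<le> n" "\<beta> < \<kappa>" "\<kappa> \<le> \<beta> + n + 1"
      by (auto simp: I2_def)
    then have "min (2 * (\<beta> + (\<kappa> - \<beta> - 1)) + 1) (n + (\<beta> + (\<kappa> - \<beta> - 1)) + 1) = min (\<kappa> - \<beta> - 1) (n - \<beta>) + \<beta> + \<kappa>"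
      by auto
    then show "(case (case x of (\<beta>, \<kappa>) \<Rightarrow> (\<beta>, \<kappa> - \<beta> - 1)) of (\<beta>, d) \<Rightarrow> F (\<beta> + d)) =
        (case x of (\<beta>, \<kappa>) \<Rightarrow> q ^ (min (\<kappa> - \<beta> - 1) (n - \<beta>) + \<beta> + \<kappa>))"
      by (simp only: x(1) F_def prod.case)
  qed (auto simp: I2_def)
  also have "\<dots> = (\<Sum>s\<le>n. (s + 1) * F s) + (\<Sum>s<n. (s + 1) * F (2 * n - s))"
    using sum_square_diagonals[of F n] by simp
  also have "(\<Sum>s\<le>n. (s + 1) * F s) = (\<Sum>s\<le>n. (s + 1) * q ^ (2 * s + 1))"
    by (intro sum.cong) (simp_all add: F_def min_def)
  also have "(\<Sum>s<n. (s + 1) * F (2 * n - s)) = (\<Sum>s<n. (s + 1) * q ^ (3 * n + 1 - s))"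
  proof (intro sum.cong refl)
    fix s assume "s \<in> {..<n}"
    then have "min (2 * (2 * n - s) + 1) (n + (2 * n - s) + 1) = 3 * n + 1 - s"
      by auto
    then show "(s + 1) * F (2 * n - s) = (s + 1) * q ^ (3 * n + 1 - s)"
      by (simp only: F_def)
  qed
  finally have card_S2: "card S2 = (\<Sum>s\<le>n. (s + 1) * q ^ (2 * s + 1)) + (\<Sum>s<n. (s + 1) * q ^ (3 * n + 1 - s))" .
  have "card ?T1 = card S1" "card ?T2 = card S2"
    by (intro card_image; auto simp: inj_on_def)+
  moreover have "?T1 \<inter> ?T2 = {}"
    by auto
  ultimately have "card (springer_params B C) = card S1 + card S2"
    unfolding eq using fin by (subst card_Un_disjoint) auto
  then show "card (springer_params B C) =
    (\<Sum>k\<le>n. (k + 1) * (q ^ (2 * k) + q ^ (2 * k + 1))) + (\<Sum>j<n. (j + 1) * q ^ (3 * n + 1 - j))"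
    unfolding card_S1 card_S2 by (simp add: distrib_left sum.distrib)
  show "finite (springer_params B C)"
    unfolding eq using fin by simp
qed

subsection \<open>The closed formula\<close>

lemma floor_div_3: "\<lfloor>real_of_int i / 3\<rfloor> = i div 3"
  using floor_divide_of_int_eq[of i 3, where 'a=real] by simp

lemma ceiling_div_3: "\<lceil>real_of_int i / 3\<rceil> = - ((- i) div 3)"
  using floor_div_3[of "- i"] by (simp add: ceiling_def)

lemma sum_int_atLeastAtMost_Suc:
  "a \<le> int n + 1 \<Longrightarrow> sum f {a..int (Suc n)} = sum f {a..int n} + f (int n + 1)"
proof -
  assume "a \<le> int n + 1"
  then have "{a..int (Suc n)} = insert (int n + 1) {a..int n}"
    by auto
  then show ?thesis
    by (simp add: add.commute)
qed

lemma sum_int_div_3_Suc: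
  fixes f :: "int \<Rightarrow> 'a::comm_monoid_add"
  assumes "a \<le> (k + 1) div 3"
  shows "sum f {a..(k + 1) div 3} =
    sum f {a..k div 3} + (if 3 dvd k + 1 then f ((k + 1) div 3) else 0)"
proof (cases "3 dvd k + 1")
  case True
  then have "k div 3 = (k + 1) div 3 - 1"
    by presburger
  then have "{a..(k + 1) div 3} = insert ((k + 1) div 3) {a..k div 3}"
    using assms by auto
  then show ?thesis
    using True \<open>k div 3 = _\<close> by (simp add: add.commute)
next
  case False
  then have "k div 3 = (k + 1) div 3"
    by presburger
  then show ?thesis
    using False by simp
qed

text \<open>The exponent 2n - 1 is negative at n = 0, hence the integer powers and the division by
  q.\<close>

lemma powi_shift:
  fixes q :: real
  assumes "q \<noteq> 0"
  shows "q powi (2 * int n - 1) = q ^ (2 * n) / q" "q powi (2 * int n) = q ^ (2 * n)"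
    "q powi (3 * int n + 1) = q ^ (3 * n) * q"
  using assms
  by (simp_all add: power_int_diff power_int_add power_int_mult power_mult)

lemma mod3E:
  fixes k :: int
  obtains m where "k = 3 * m" | m where "k = 3 * m + 1" | m where "k = 3 * m + 2"
proof -
  have "k mod 3 = 0 \<or> k mod 3 = 1 \<or> k mod 3 = 2"
    by presburger
  then show ?thesis
    using that[of "k div 3"] mult_div_mod_eq[of 3 k] by (metis add.right_neutral)
qed

text \<open>These are the recurrences for the boundary coefficients in \<open>lower_part\<close>;
  the quotients by 3 are explicit in each residue class of k.\<close>

lemma lower_coeff:
  fixes k :: int
  defines "c \<equiv> \<lambda>i::int. i - 2 * (i div 3) - 1"
  defines "d \<equiv> if 3 dvd k + 1 then 2 else 0"
  shows "c (k + 2) = k + 1 - 2 * c (k + 1) - d \<and>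
    (if 3 dvd k + 2 then 2 else 0) = 3 * c (k + 1) + d - k"
proof (cases k rule: mod3E)
  case (1 m)
  have "(k + 1) div 3 = m" "(k + 2) div 3 = m" "\<not> 3 dvd k + 1" "\<not> 3 dvd k + 2"
    using 1 by presburger+
  then show ?thesis
    using 1 by (simp add: c_def d_def)
next
  case (2 m)
  have "(k + 1) div 3 = m" "(k + 2) div 3 = m + 1" "\<not> 3 dvd k + 1" "3 dvd k + 2"
    using 2 by presburger+
  then show ?thesis
    using 2 by (simp add: c_def d_def)
next
  case (3 m)
  have "(k + 1) div 3 = m + 1" "(k + 2) div 3 = m + 1" "3 dvd k + 1" "\<not> 3 dvd k + 2"
    using 3 by presburger+
  then show ?thesis
    using 3 by (simp add: c_def d_def)
qed

lemma upper_coeff: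
  fixes k :: int
  defines "c \<equiv> \<lambda>j::int. j + 2 * ((- j) div 3) + 1"
  defines "d \<equiv> if 3 dvd k - 1 then 2 else 0"
  shows "k + 2 - 2 * c k = (if 3 dvd k - 2 then 2 else 0) + c (k - 1) + d"
proof (cases k rule: mod3E)
  case (1 m)
  have "(- k) div 3 = - m" "(- (k - 1)) div 3 = - m" "\<not> 3 dvd k - 1" "\<not> 3 dvd k - 2"
    using 1 by presburger+
  then show ?thesis
    using 1 by (simp add: c_def d_def)
next
  case (2 m)
  have "(- k) div 3 = - m - 1" "(- (k - 1)) div 3 = - m" "3 dvd k - 1" "\<not> 3 dvd k - 2"
    using 2 by presburger+
  then show ?thesis
    using 2 by (simp add: c_def d_def)
next
  case (3 m)
  have "(- k) div 3 = - m - 1" "(- (k - 1)) div 3 = - m - 1" "\<not> 3 dvd k - 1" "3 dvd k - 2"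
    using 3 by presburger+
  then show ?thesis
    using 3 by (simp add: c_def d_def)
qed

lemma middle_coeff:
  fixes k :: int
  shows "k + 2 * ((1 - k) div 3) = k - 2 * ((k + 1) div 3) \<and>
    k + 1 - 2 * (k - 2 * ((k + 1) div 3)) - (if 3 dvd k + 1 then 2 else 0)
      + 2 * (- ((1 - 2 * k) div 3) - (k - 2) div 3 - 1) + (if 3 dvd k - 2 then 2 else 0) = k + 1"
proof (cases k rule: mod3E)
  case (1 m)
  have "(1 - k) div 3 = - m" "(k + 1) div 3 = m" "(1 - 2 * k) div 3 = - 2 * m" "(k - 2) div 3 = m - 1"
    "\<not> 3 dvd k + 1" "\<not> 3 dvd k - 2"
    using 1 by presburger+
  then show ?thesis
    using 1 by simp
next
  case (2 m)
  have "(1 - k) div 3 = - m" "(k + 1) div 3 = m" "(1 - 2 * k) div 3 = - 2 * m - 1" "(k - 2) div 3 = m - 1"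
    "\<not> 3 dvd k + 1" "\<not> 3 dvd k - 2"
    using 2 by presburger+
  then show ?thesis
    using 2 by simp
next
  case (3 m)
  have "(1 - k) div 3 = - m - 1" "(k + 1) div 3 = m + 1" "(1 - 2 * k) div 3 = - 2 * m - 1" "(k - 2) div 3 = m"
    "3 dvd k + 1" "3 dvd k - 2"
    using 3 by presburger+
  then show ?thesis
    using 3 by simp
qed

text \<open>A term of index i in the second sum covers the exponents 2i - 3 to 2i and so overlaps
  with the next one. The corrections at q^(2n) and q^(2n) / q account for what the terms of the next
  index would still contribute there: c (n + 1) at the lower power, 2 c (n + 1) at the upper one,
  and 2 more if 3 divides n + 1.\<close>

lemma lower_part:
  fixes q :: real
  assumes q: "q \<noteq> 0"
  defines "c \<equiv> \<lambda>i::int. i - 2 * (i div 3) - 1"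
  shows "1 + 2 * (\<Sum>i\<in>{1..int n div 3}. q powi (2 * (3 * i - 1)) * (q\<^sup>2 + q + 1))
    + (\<Sum>i\<in>{1..int n}. of_int (c i) * q powi (2 * i - 3) * (q ^ 3 + 2 * q\<^sup>2 + 2 * q + 1)) =
    (\<Sum>k<n. (real k + 1) * (q ^ (2 * k) + q ^ (2 * k + 1)))
    + of_int (int n + 1 - 2 * c (int n + 1) - (if 3 dvd int n + 1 then 2 else 0)) * q ^ (2 * n)
    - of_int (c (int n + 1)) * q ^ (2 * n) / q"
proof (induction n)
  case 0
  show ?case
    by (simp add: c_def)
next
  case (Suc n)
  define Q where "Q = q ^ (2 * n)"
  define d :: int where "d = (if 3 dvd int n + 1 then 2 else 0)"
  have A: "2 * (\<Sum>i\<in>{1..int (Suc n) div 3}. q powi (2 * (3 * i - 1)) * (q\<^sup>2 + q + 1)) =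
      2 * (\<Sum>i\<in>{1..int n div 3}. q powi (2 * (3 * i - 1)) * (q\<^sup>2 + q + 1)) + of_int d * (Q * (q\<^sup>2 + q + 1))"
  proof (cases "3 dvd int n + 1")
    case True
    then have "1 \<le> (int n + 1) div 3" "2 * (3 * ((int n + 1) div 3) - 1) = 2 * int n"
      by presburger+
    then show ?thesis
      using True sum_int_div_3_Suc[of 1 "int n" "\<lambda>i. q powi (2 * (3 * i - 1)) * (q\<^sup>2 + q + 1)"]
      by (simp only: of_nat_Suc add.commute[of 1] powi_shift[OF q]) (simp add: d_def Q_def)
  next
    case False
    then have "int (Suc n) div 3 = int n div 3"
      by (simp only: of_nat_Suc) presburger
    then show ?thesis
      using False by (simp add: d_def)
  qed
  have "2 * (int n + 1) - 3 = 2 * int n - 1"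
    by simp
  then have B: "(\<Sum>i\<in>{1..int (Suc n)}. of_int (c i) * q powi (2 * i - 3) * (q ^ 3 + 2 * q\<^sup>2 + 2 * q + 1)) =
      (\<Sum>i\<in>{1..int n}. of_int (c i) * q powi (2 * i - 3) * (q ^ 3 + 2 * q\<^sup>2 + 2 * q + 1))
      + of_int (c (int n + 1)) * (Q / q) * (q ^ 3 + 2 * q\<^sup>2 + 2 * q + 1)"
    by (subst sum_int_atLeastAtMost_Suc) (simp_all add: Q_def powi_shift[OF q])
  have "int (Suc n) + 1 = int n + 2"
    by simp
  then have c2: "c (int (Suc n) + 1) = int n + 1 - 2 * c (int n + 1) - d"
    and s2: "(if 3 dvd int (Suc n) + 1 then 2 else 0) = 3 * c (int n + 1) + d - int n"
    using lower_coeff[of "int n"] unfolding c_def d_def by metis+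
  define X1 X2 X3 where "X1 = (\<Sum>i\<in>{1..int n div 3}. q powi (2 * (3 * i - 1)) * (q\<^sup>2 + q + 1))"
    and "X2 = (\<Sum>i\<in>{1..int n}. of_int (c i) * q powi (2 * i - 3) * (q ^ 3 + 2 * q\<^sup>2 + 2 * q + 1))"
    and "X3 = (\<Sum>k<n. (real k + 1) * (q ^ (2 * k) + q ^ (2 * k + 1)))"
  note X = this[symmetric]
  define c1 where "c1 = c (int n + 1)"
  have Q2: "q ^ (2 * Suc n) = Q * q\<^sup>2" "q ^ (2 * n + 1) = Q * q"
    by (simp_all add: Q_def power2_eq_square)
  \<comment> \<open>The induction hypothesis is solved for the second sum, which leaves a polynomial
    identity after clearing the division by q.\<close>
  have X2: "X2 = X3 + of_int (int n + 1 - 2 * c1 - d) * Q - of_int c1 * Q / q - 1 - 2 * X1"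
    using Suc.IH unfolding X d_def[symmetric] Q_def[symmetric] c1_def[symmetric] by linarith
  show ?case
    unfolding A B c2 s2 Q2 sum.lessThan_Suc X d_def[symmetric] Q_def[symmetric] c1_def[symmetric] X2
    using q by (simp add: field_simps power2_eq_square power3_eq_cube)
qed

text \<open>Measured downwards from the top exponent, the coefficients do not depend on n, so
  passing from n to n + 1 multiplies everything by q^3 and adds terms near q^(2n). The last two
  summands are the leftovers at q^(2n + 1) and q^(2n).\<close>

lemma upper_part:
  fixes q :: real
  assumes q: "q \<noteq> 0"
  defines "c \<equiv> \<lambda>j::int. j + 2 * ((- j) div 3) + 1"
  shows "(\<Sum>i\<in>{int n + 2..2 * int n}. of_int (c (2 * int n - i)) * q powi (i + int n - 1) * (1 + 2 * q))
    + 2 * (\<Sum>i\<in>{0..(int n - 2) div 3}. q powi (3 * (int n - i) - 2) * (1 + q)) + q powi (3 * int n + 1) =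
    (\<Sum>j<n. (real j + 1) * q ^ (3 * n + 1 - j))
    + of_int (int n + 1 - 2 * c (int n - 1)) * q ^ (2 * n + 1)
    + of_int (if 3 dvd int n - 2 then 2 else 0) * q ^ (2 * n)"
proof -
  \<comment> \<open>With j = 2n - i only the range and the offset 3n of the exponent depend on
    n.\<close>
  have reindex: "(\<Sum>i\<in>{int n + 2..2 * int n}. of_int (c (2 * int n - i)) * q powi (i + int n - 1) * (1 + 2 * q)) =
     (\<Sum>j\<in>{0..int n - 2}. of_int (c j) * q powi (3 * int n - j - 1) * (1 + 2 * q))" for n
    by (rule sum.reindex_bij_witness[of _ "\<lambda>j. 2 * int n - j" "\<lambda>i. 2 * int n - i"])
      (auto simp: algebra_simps)
  show ?thesis
    unfolding reindex
  proof (induction n)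
    case 0
    show ?case
      by (simp add: c_def)
  next
    case (Suc n)
    define Q where "Q = q ^ (2 * n)"
    define d :: int where "d = (if 3 dvd int n - 1 then 2 else 0)"
    have pow3: "q powi (k + 3) = q ^ 3 * q powi k" for k
      using q by (simp add: power_int_add)
    have powQ: "q powi (2 * int n + 2) = Q * q\<^sup>2" "q powi (2 * int n + 3) = Q * q ^ 3"
      using q by (simp_all add: power_int_add power_int_mult power_mult Q_def)
    have A: "(\<Sum>j\<in>{0..int (Suc n) - 2}. of_int (c j) * q powi (3 * int (Suc n) - j - 1) * (1 + 2 * q)) =
       q ^ 3 * (\<Sum>j\<in>{0..int n - 2}. of_int (c j) * q powi (3 * int n - j - 1) * (1 + 2 * q))
       + of_int (c (int n - 1)) * (Q * q ^ 3) * (1 + 2 * q)"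
    proof -
      have "(\<Sum>j\<in>{0..int (Suc n) - 2}. of_int (c j) * q powi (3 * int (Suc n) - j - 1) * (1 + 2 * q)) =
        (\<Sum>j\<in>{0..int n - 2}. of_int (c j) * q powi (3 * int (Suc n) - j - 1) * (1 + 2 * q))
        + of_int (c (int n - 1)) * (Q * q ^ 3) * (1 + 2 * q)"
      proof (cases "n = 0")
        case False
        then have "{0..int (Suc n) - 2} = insert (int n - 1) {0..int n - 2}"
          by auto
        moreover have "3 * int (Suc n) - (int n - 1) - 1 = 2 * int n + 3"
          by simp
        ultimately show ?thesis
          using powQ by (simp add: add.commute[of 3])
      qed (simp add: c_def)
      also have "(\<Sum>j\<in>{0..int n - 2}. of_int (c j) * q powi (3 * int (Suc n) - j - 1) * (1 + 2 * q)) =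
        q ^ 3 * (\<Sum>j\<in>{0..int n - 2}. of_int (c j) * q powi (3 * int n - j - 1) * (1 + 2 * q))"
        unfolding sum_distrib_left
      proof (rule sum.cong[OF refl])
        fix j
        have "3 * int (Suc n) - j - 1 = (3 * int n - j - 1) + 3"
          by simp
        then show "of_int (c j) * q powi (3 * int (Suc n) - j - 1) * (1 + 2 * q) =
            q ^ 3 * (of_int (c j) * q powi (3 * int n - j - 1) * (1 + 2 * q))"
          by (simp only: pow3 mult_ac)
      qed
      finally show ?thesis .
    qed
    have B: "2 * (\<Sum>i\<in>{0..(int (Suc n) - 2) div 3}. q powi (3 * (int (Suc n) - i) - 2) * (1 + q)) =
       q ^ 3 * (2 * (\<Sum>i\<in>{0..(int n - 2) div 3}. q powi (3 * (int n - i) - 2) * (1 + q)))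
       + of_int d * (Q * q\<^sup>2 * (1 + q))"
    proof -
      have "2 * (\<Sum>i\<in>{0..(int (Suc n) - 2) div 3}. q powi (3 * (int (Suc n) - i) - 2) * (1 + q)) =
        2 * (\<Sum>i\<in>{0..(int n - 2) div 3}. q powi (3 * (int (Suc n) - i) - 2) * (1 + q)) + of_int d * (Q * q\<^sup>2 * (1 + q))"
      proof (cases "3 dvd int n - 1")
        case True
        then have "0 \<le> (int n - 1) div 3" "(int n - 2) div 3 = (int n - 1) div 3 - 1"
          by presburger+
        then have "{0..(int (Suc n) - 2) div 3} = insert ((int n - 1) div 3) {0..(int n - 2) div 3}"
          by auto
        moreover have "3 * (int (Suc n) - (int n - 1) div 3) - 2 = 2 * int n + 2"
          using True by (simp only: of_nat_Suc) presburger
        ultimately show ?thesis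
          using True \<open>(int n - 2) div 3 = _\<close> powQ by (simp add: d_def add.commute[of 2])
      next
        case False
        then have "(int (Suc n) - 2) div 3 = (int n - 2) div 3"
          by (simp only: of_nat_Suc) presburger
        then show ?thesis
          using False by (simp add: d_def)
      qed
      also have "(\<Sum>i\<in>{0..(int n - 2) div 3}. q powi (3 * (int (Suc n) - i) - 2) * (1 + q)) =
        q ^ 3 * (\<Sum>i\<in>{0..(int n - 2) div 3}. q powi (3 * (int n - i) - 2) * (1 + q))"
        unfolding sum_distrib_left
      proof (rule sum.cong[OF refl])
        fix i
        have "3 * (int (Suc n) - i) - 2 = (3 * (int n - i) - 2) + 3"
          by simp
        then show "q powi (3 * (int (Suc n) - i) - 2) * (1 + q) = q ^ 3 * (q powi (3 * (int n - i) - 2) * (1 + q))"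
          by (simp only: pow3 mult_ac)
      qed
      finally show ?thesis
        by simp
    qed
    have "3 * int (Suc n) + 1 = (3 * int n + 1) + 3"
      by simp
    then have C: "q powi (3 * int (Suc n) + 1) = q ^ 3 * q powi (3 * int n + 1)"
      by (simp only: pow3)
    have H: "(\<Sum>j<Suc n. (real j + 1) * q ^ (3 * Suc n + 1 - j)) =
        q ^ 3 * (\<Sum>j<n. (real j + 1) * q ^ (3 * n + 1 - j)) + (real n + 1) * (Q * q ^ 4)"
    proof -
      have "(\<Sum>j<n. (real j + 1) * q ^ (3 * Suc n + 1 - j)) = q ^ 3 * (\<Sum>j<n. (real j + 1) * q ^ (3 * n + 1 - j))"
        unfolding sum_distrib_left
      proof (rule sum.cong[OF refl])
        fix j assume "j \<in> {..<n}"
        then have "3 * Suc n + 1 - j = 3 + (3 * n + 1 - j)"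
          by auto
        then show "(real j + 1) * q ^ (3 * Suc n + 1 - j) = q ^ 3 * ((real j + 1) * q ^ (3 * n + 1 - j))"
          by (simp only: power_add mult_ac)
      qed
      moreover have "3 * Suc n + 1 - n = 2 * n + 4"
        by simp
      ultimately show ?thesis
        unfolding sum.lessThan_Suc Q_def by (simp only: power_add)
    qed
    have c2: "int (Suc n) + 1 - 2 * c (int (Suc n) - 1) = (if 3 dvd int n - 2 then 2 else 0) + c (int n - 1) + d"
      "(if 3 dvd int (Suc n) - 2 then 2 else 0) = d"
      using upper_coeff[of "int n"] by (simp_all add: c_def d_def)
    have Q2: "q ^ (2 * Suc n + 1) = Q * q ^ 3" "q ^ (2 * Suc n) = Q * q\<^sup>2" "q ^ (2 * n + 1) = Q * q"
      by (simp_all add: Q_def power2_eq_square power3_eq_cube)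
    \<comment> \<open>The induction hypothesis enters multiplied by q^3, as in the recurrences for
      the individual sums.\<close>
    show ?case
      unfolding A B C H c2 Q2 using arg_cong[OF Suc.IH, of "\<lambda>x. q ^ 3 * x"]
      unfolding Q2 Q_def[symmetric]
      by (simp add: algebra_simps power2_eq_square power3_eq_cube power4_eq_xxxx)
  qed
qed

text \<open>The leftovers of the lower and upper parts, together with the two isolated terms of the
  formula, form exactly the summand for k = n.\<close>

lemma middle_part:
  fixes q :: real and n :: nat
  assumes q: "q \<noteq> 0"
  shows "of_int (int n + 1 - 2 * (int n + 1 - 2 * ((int n + 1) div 3) - 1) - (if 3 dvd int n + 1 then 2 else 0)) * q ^ (2 * n)
      - of_int (int n + 1 - 2 * ((int n + 1) div 3) - 1) * q ^ (2 * n) / q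
    + of_int (int n + 2 * ((1 - int n) div 3)) * q powi (2 * int n - 1) * (1 + 2 * q\<^sup>2)
    + 2 * q powi (2 * int n) * of_int (- ((1 - 2 * int n) div 3) - (int n - 2) div 3 - 1)
    + (of_int (int n + 1 - 2 * (int n - 1 + 2 * ((1 - int n) div 3) + 1)) * q ^ (2 * n + 1)
      + of_int (if 3 dvd int n - 2 then 2 else 0) * q ^ (2 * n)) =
    (real n + 1) * (q ^ (2 * n) + q ^ (2 * n + 1))"
proof -
  define a b u v s t where "a = (int n + 1) div 3" and "b = (1 - int n) div 3"
    and "u = (1 - 2 * int n) div 3" and "v = (int n - 2) div 3"
    and "s = (if 3 dvd int n + 1 then 2 else 0 :: int)" and "t = (if 3 dvd int n - 2 then 2 else 0 :: int)"
  note defs = this[symmetric]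
  define Q where "Q = q ^ (2 * n)"
  have "int n + 2 * b = int n - 2 * a"
    "int n + 1 - 2 * (int n - 2 * a) - s + 2 * (- u - v - 1) + t = int n + 1"
    using middle_coeff[of "int n"] unfolding defs by blast+
  \<comment> \<open>Eliminating the quotient b and the indicator t leaves an identity in which the
    remaining quotients cancel.\<close>
  then have b: "b = - a" and t: "t = 2 * int n - 4 * a + s + 2 * u + 2 * v + 2"
    by simp_all
  show ?thesis
    unfolding powi_shift[OF q] defs Q_def[symmetric] power_add power_one_right b t
    using q by (simp add: field_simps power2_eq_square)
qed

lemma closed_formula:
  fixes q :: real and n :: nat
  assumes q: "q \<noteq> 0"
  shows "1 + 2 * (\<Sum>i\<in>{1..\<lfloor>real n / 3\<rfloor>}. q powi (2 * (3 * i - 1)) * (q\<^sup>2 + q + 1))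
      + (\<Sum>i\<in>{1..int n}. of_int (i - 2 * \<lfloor>of_int i / 3 :: real\<rfloor> - 1) * q powi (2 * i - 3)
            * (q ^ 3 + 2 * q\<^sup>2 + 2 * q + 1))
      + of_int (int n - 2 * \<lceil>(real n - 1) / 3\<rceil>) * q powi (2 * int n - 1) * (1 + 2 * q\<^sup>2)
      + (\<Sum>i\<in>{int n + 2..2 * int n}.
            of_int (2 * int n - i - 2 * \<lceil>of_int (2 * int n - i) / 3 :: real\<rceil> + 1)
            * q powi (i + int n - 1) * (1 + 2 * q))
      + 2 * (\<Sum>i\<in>{0..\<lfloor>(real n - 2) / 3\<rfloor>}. q powi (3 * (int n - i) - 2) * (1 + q))
      + 2 * q powi (2 * int n)
          * of_int (\<lceil>(2 * real n - 1) / 3\<rceil> - \<lfloor>(real n - 2) / 3\<rfloor> - 1)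
      + q powi (3 * int n + 1) =
    (\<Sum>k\<le>n. (real k + 1) * (q ^ (2 * k) + q ^ (2 * k + 1))) + (\<Sum>j<n. (real j + 1) * q ^ (3 * n + 1 - j))"
proof -
  have fl: "\<lfloor>real n / 3\<rfloor> = int n div 3" "\<lfloor>(real n - 2) / 3\<rfloor> = (int n - 2) div 3"
    "\<lceil>(real n - 1) / 3\<rceil> = - ((1 - int n) div 3)" "\<lceil>(2 * real n - 1) / 3\<rceil> = - ((1 - 2 * int n) div 3)"
    using floor_div_3[of "int n"] floor_div_3[of "int n - 2"] ceiling_div_3[of "int n - 1"]
      ceiling_div_3[of "2 * int n - 1"] by simp_all
  have minus: "x - 2 * - y = x + 2 * y" for x y :: int
    by simp
  show ?thesis
    using lower_part[OF q, of n] upper_part[OF q, of n] middle_part[OF q, of n]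
    unfolding fl floor_div_3 ceiling_div_3 minus lessThan_Suc_atMost[symmetric] sum.lessThan_Suc
    by (simp only: minus_diff_eq)
qed

subsection \<open>Topology\<close>

text \<open>Points closer than 2^(-|N|) agree below N. Negative valuations of the difference are
  excluded since they give distance at least 1.\<close>

lemma open_fls_vge: "open {b :: 'k::group_add fls. vge N (b - a)}"
  unfolding open_fls_def
proof
  fix b assume b: "b \<in> {b. vge N (b - a)}"
  have "vge N (y - a)" if "dist y b < inverse (2 ^ nat \<bar>N\<bar>)" for y
  proof -
    have "vge N (y - b)"
    proof (cases "y = b")
      case False
      show ?thesis
      proof (cases "fls_subdegree (y - b) \<ge> 0")
        case True
        then have "inverse ((2 :: real) ^ nat (fls_subdegree (y - b))) < inverse (2 ^ nat \<bar>N\<bar>)"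
          using that False by (simp add: dist_fls_def)
        then have "\<bar>N\<bar> < fls_subdegree (y - b)"
          by simp
        then have "N \<le> fls_subdegree (y - b)"
          by linarith
        then show ?thesis
          by (simp add: vge_iff)
      next
        case neg: False
        have "inverse ((2 :: real) ^ nat \<bar>N\<bar>) \<le> 1"
          by (simp add: field_simps)
        also have "1 \<le> (2 :: real) ^ nat (- fls_subdegree (y - b))"
          by simp
        finally show ?thesis
          using that False neg by (simp add: dist_fls_def)
      qed
    qed simp
    then show ?thesis
      using b by (auto simp: vge_def)
  qed
  then show "\<exists>r. 0 < r \<and> {y. dist y b < r} \<subseteq> {b. vge N (b - a)}"
    by (intro exI[of _ "inverse (2 ^ nat \<bar>N\<bar>)"]) auto
qed

lemma open_fls_nhds:
  fixes a :: "'k::group_add fls"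
  assumes "open S" "a \<in> S"
  shows "\<exists>N. \<forall>b. vge N (b - a) \<longrightarrow> b \<in> S"
proof -
  obtain r where r: "r > 0" "{y. dist y a < r} \<subseteq> S"
    using assms unfolding open_fls_def by blast
  obtain n where n: "inverse (2 ^ n) < r"
    using real_arch_pow_inv[of r "1/2"] r(1) by (auto simp: power_one_over inverse_eq_divide)
  have "dist b a < r" if "vge (int n) (b - a)" for b
  proof (cases "b = a")
    case False
    then have "int n \<le> fls_subdegree (b - a)"
      using that by (simp add: vge_iff)
    then have "dist b a \<le> inverse (2 ^ n)"
      using False by (simp add: dist_fls_def le_nat_iff)
    then show ?thesis
      using n by simp
  qed (use r in simp)
  then show ?thesis
    using r(2) by blast
qed

text \<open>The relation P is abstract so that the argument applies twice: to the entries of a row,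
  and to the rows of a matrix.\<close>

lemma open_vec_nhds:
  fixes a :: "('a::{topological_space}) ^ 'n"
  assumes "open S" "a \<in> S"
    and nhds: "\<And>U x. open U \<Longrightarrow> x \<in> U \<Longrightarrow> \<exists>N :: int. \<forall>y. P N y x \<longrightarrow> y \<in> U"
    and mono: "\<And>M N x y. P N y x \<Longrightarrow> M \<le> N \<Longrightarrow> P M y x"
  shows "\<exists>N. \<forall>b. (\<forall>i. P N (b $ i) (a $ i)) \<longrightarrow> b \<in> S"
proof -
  obtain A where A: "\<And>i. open (A i)" "\<And>i. a $ i \<in> A i" "\<And>y. (\<And>i. y $ i \<in> A i) \<Longrightarrow> y \<in> S"
    using assms(1)[unfolded open_vec_def, rule_format, OF assms(2)] by blast
  have "\<forall>i. \<exists>N. \<forall>y. P N y (a $ i) \<longrightarrow> y \<in> A i"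
    using nhds[OF A(1,2)] by blast
  then obtain N where N: "\<And>i y. P (N i) y (a $ i) \<Longrightarrow> y \<in> A i"
    by metis
  have "N i \<le> Max (range N)" for i
    by (rule Max_ge) auto
  then have "b \<in> S" if "\<And>i. P (Max (range N)) (b $ i) (a $ i)" for b
    using that by (intro A(3) N) (rule mono)
  then show ?thesis
    by blast
qed

lemma open_matrix_nhds:
  fixes A :: "'k::group_add fls ^ 'n ^ 'm"
  assumes "open S" "A \<in> S"
  shows "\<exists>N. \<forall>B. (\<forall>i j. vge N (B $ i $ j - A $ i $ j)) \<longrightarrow> B \<in> S"
proof (rule open_vec_nhds[OF assms])
  fix U :: "('k fls ^ 'n) set" and x assume "open U" "x \<in> U"
  then show "\<exists>N. \<forall>y. (\<forall>j. vge N (y $ j - x $ j)) \<longrightarrow> y \<in> U"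
    by (rule open_vec_nhds) (auto intro: open_fls_nhds vge_mono)
qed (auto intro: vge_mono)

lemma open_matrixI:
  fixes S :: "('k::group_add fls ^ 'n ^ 'm) set"
  assumes "\<And>A B. A \<in> S \<Longrightarrow> (\<And>i j. vge N (B $ i $ j - A $ i $ j)) \<Longrightarrow> B \<in> S"
  shows "open S"
  unfolding open_vec_def[of S]
proof
  fix A assume A: "A \<in> S"
  have "open {y. \<forall>j. vge N (y $ j - A $ i $ j)}" for i
    unfolding open_vec_def
    by (intro ballI exI[of _ "\<lambda>j. {b. vge N (b - A $ i $ j)}"]) (auto simp: open_fls_vge)
  then show "\<exists>U. (\<forall>i. open (U i) \<and> A $ i \<in> U i) \<and> (\<forall>y. (\<forall>i. y $ i \<in> U i) \<longrightarrow> y \<in> S)"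
    using assms[OF A] by (intro exI[of _ "\<lambda>i. {y. \<forall>j. vge N (y $ j - A $ i $ j)}"]) auto
qed

text \<open>The box is a continuous image of a product of copies of the finite discrete field, one
  for each entry and exponent, which is compact by Tychonoff's theorem.\<close>

lemma compact_matrix_box: "compact {A :: 'k::{field, finite} fls ^ 'n ^ 'm. \<forall>i j. vge D (A $ i $ j)}"
proof -
  define P where "P = product_topology (\<lambda>_ :: 'm \<times> 'n \<times> nat. discrete_topology (UNIV :: 'k set)) UNIV"
  define \<Theta> :: "('m \<times> 'n \<times> nat \<Rightarrow> 'k) \<Rightarrow> 'k fls ^ 'n ^ 'm" where
    "\<Theta> a = (\<chi> i j. Abs_fls (\<lambda>n. if n \<ge> D then a (i, j, nat (n - D)) else 0))" for a
  have nth: "fls_nth (\<Theta> a $ i $ j) n = (if n \<ge> D then a (i, j, nat (n - D)) else 0)" for a i j n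
    unfolding \<Theta>_def vec_lambda_beta by (rule nth_Abs_fls_ex_lower_bound) (auto intro!: exI[of _ D])
  have "compact_space P"
    by (simp add: P_def compact_space_product_topology compact_space_discrete_topology)
  moreover have "continuous_map P euclidean \<Theta>"
    unfolding continuous_map_def
  proof (intro conjI allI impI)
    fix U :: "('k fls ^ 'n ^ 'm) set" assume "openin euclidean U"
    then have U: "open U" by simp
    show "openin P {a \<in> topspace P. \<Theta> a \<in> U}"
      unfolding P_def openin_product_topology_alt
    proof
      fix a assume "a \<in> {a \<in> topspace (product_topology (\<lambda>_ :: 'm \<times> 'n \<times> nat. discrete_topology (UNIV :: 'k set)) UNIV). \<Theta> a \<in> U}"
      then obtain N where N: "\<And>B. (\<And>i j. vge N (B $ i $ j - \<Theta> a $ i $ j)) \<Longrightarrow> B \<in> U"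
        using open_matrix_nhds[OF U] by blast
      \<comment> \<open>Only the finitely many coefficients at exponents from D up to N - 1 are
        pinned down.\<close>
      define V where "V = (\<lambda>(i :: 'm, j :: 'n, n). if n < nat (N - D) then {a (i, j, n)} else UNIV)"
      have "{x. V x \<noteq> UNIV} \<subseteq> UNIV \<times> UNIV \<times> {..<nat (N - D)}"
        by (auto simp: V_def split: if_splits)
      then have "finite {x. V x \<noteq> UNIV}"
        by (rule finite_subset) auto
      moreover have "a \<in> Pi\<^sub>E UNIV V"
        by (auto simp: V_def)
      moreover have "\<Theta> b \<in> U" if b: "b \<in> Pi\<^sub>E UNIV V" for b
      proof (rule N)
        fix i j
        have "b (i, j, n) = a (i, j, n)" if "n < nat (N - D)" for n
          using PiE_mem[OF b, of "(i, j, n)"] that by (simp add: V_def)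
        then show "vge N (\<Theta> b $ i $ j - \<Theta> a $ i $ j)"
          by (simp add: vge_def nth)
      qed
      ultimately show "\<exists>V. finite {i \<in> UNIV. V i \<noteq> topspace (discrete_topology (UNIV :: 'k set))} \<and>
          (\<forall>i\<in>UNIV. openin (discrete_topology (UNIV :: 'k set)) (V i)) \<and>
          a \<in> Pi\<^sub>E UNIV V \<and>
          Pi\<^sub>E UNIV V \<subseteq> {a \<in> topspace (product_topology (\<lambda>_ :: 'm \<times> 'n \<times> nat. discrete_topology (UNIV :: 'k set)) UNIV). \<Theta> a \<in> U}"
        by (intro exI[of _ V]) auto
    qed
  qed auto
  ultimately have "compactin euclidean (\<Theta> ` topspace P)"
    unfolding compact_space_def by (rule image_compactin)
  moreover have "\<Theta> ` topspace P = {A. \<forall>i j. vge D (A $ i $ j)}"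
  proof (intro Set.set_eqI iffI)
    fix A :: "'k fls ^ 'n ^ 'm" assume "A \<in> {A. \<forall>i j. vge D (A $ i $ j)}"
    then have "A = \<Theta> (\<lambda>(i, j, n). fls_nth (A $ i $ j) (D + int n))"
      by (auto simp: vec_eq_iff fls_eq_iff nth vge_def)
    then show "A \<in> \<Theta> ` topspace P"
      unfolding P_def by simp
  qed (auto simp: vge_def nth)
  ultimately show ?thesis
    by simp
qed

text \<open>The determinant is 1 modulo \<epsilon>: every nonidentity permutation contributes an
  off-diagonal factor.\<close>

lemma one_plus_mem_GL3_O:
  fixes E :: "'k::field fls ^ 3 ^ 3"
  assumes "\<And>i j. vge 1 (E $ i $ j)"
  shows "mat 1 + E \<in> GL3_O"
proof -
  define A where "A = mat 1 + E"
  have A1: "vge 1 (A $ i $ i - 1)" for i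
    by (simp add: A_def mat_def assms)
  have A2: "vge 1 (A $ i $ j)" if "i \<noteq> j" for i j
    using that by (simp add: A_def mat_def assms)
  have "vge 0 (E $ i $ j)" for i j
    using assms by (rule vge_mono) simp
  then have A0: "vge 0 (A $ i $ j)" for i j
    by (auto simp: A_def mat_def intro!: vge_add)
  have mult1: "vge 1 (x * y - 1)" if "vge 0 y" "vge 1 (x - 1)" "vge 1 (y - 1)" for x y :: "'k fls"
  proof -
    have eq: "x * y - 1 = y * (x - 1) + (y - 1)"
      by (simp add: algebra_simps)
    show ?thesis
      unfolding eq using that by (intro vge_add vge_0_mult)
  qed
  have diag: "vge 1 (A $ 1 $ 1 * A $ 2 $ 2 * A $ 3 $ 3 - 1)"
    by (intro mult1 A0 A1)
  have off: "vge 1 (A $ i $ j * A $ k $ l * A $ m $ n)" if "m \<noteq> n" for i j k l m n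
    by (intro vge_0_mult A0 A2 that)
  \<comment> \<open>Two terms of \<open>det_3\<close> must be reordered so that their last factor is
    off-diagonal, as \<open>off\<close> requires.\<close>
  have comm: "A $ 3 $ 3 * A $ 1 $ 2 * A $ 2 $ 1 = A $ 1 $ 2 * A $ 2 $ 1 * A $ 3 $ 3"
    "A $ 2 $ 2 * A $ 1 $ 3 * A $ 3 $ 1 = A $ 1 $ 3 * A $ 2 $ 2 * A $ 3 $ 1"
    by (simp_all only: mult_ac)
  have "vge 1 ((A $ 1 $ 1 * A $ 2 $ 2 * A $ 3 $ 3 - 1) + A $ 1 $ 2 * A $ 2 $ 3 * A $ 3 $ 1
      + A $ 1 $ 3 * A $ 2 $ 1 * A $ 3 $ 2 - A $ 1 $ 1 * A $ 2 $ 3 * A $ 3 $ 2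
      - A $ 3 $ 3 * A $ 1 $ 2 * A $ 2 $ 1 - A $ 2 $ 2 * A $ 1 $ 3 * A $ 3 $ 1)"
    by (rule vge_diff[OF vge_diff[OF vge_diff[OF vge_add[OF vge_add[OF diag off] off] off] off] off]) simp_all
  also have "(A $ 1 $ 1 * A $ 2 $ 2 * A $ 3 $ 3 - 1) + A $ 1 $ 2 * A $ 2 $ 3 * A $ 3 $ 1
      + A $ 1 $ 3 * A $ 2 $ 1 * A $ 3 $ 2 - A $ 1 $ 1 * A $ 2 $ 3 * A $ 3 $ 2
      - A $ 3 $ 3 * A $ 1 $ 2 * A $ 2 $ 1 - A $ 2 $ 2 * A $ 1 $ 3 * A $ 3 $ 1 = det A - 1"
    unfolding det_3 comm by simp
  finally have "vge 1 (det A - 1)" .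
  then have "fls_nth (det A) 0 = 1" "\<And>k. k < 0 \<Longrightarrow> fls_nth (det A) k = 0"
    by (auto simp: vge_def)
  then have "det A \<noteq> 0" "fls_subdegree (det A) = 0"
    by (auto intro!: fls_subdegree_eqI)
  then show ?thesis
    using A0 by (simp add: GL3_O_iff_det gl3_O_iff flip: A_def)
qed

text \<open>With k = g^(-1) A in K one has g^(-1) B = k (1 + k^(-1) g^(-1) (B - A)). As k^(-1) is
  integral, the bound 1 - D depends only on g, not on A.\<close>

lemma coset_nhds:
  fixes g :: "'k::field fls ^ 3 ^ 3"
  assumes g: "invertible g"
  shows "\<exists>N. \<forall>A B. A \<in> g <#\<^bsub>GL3\<^esub> GL3_O \<longrightarrow> (\<forall>i j. vge N (B $ i $ j - A $ i $ j)) \<longrightarrow> B \<in> g <#\<^bsub>GL3\<^esub> GL3_O"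
proof -
  obtain D where D: "\<And>i j. vge D (matrix_inv g $ i $ j)"
    using vge_mat_ex by blast
  have "B \<in> g <#\<^bsub>GL3\<^esub> GL3_O"
    if A: "A \<in> g <#\<^bsub>GL3\<^esub> GL3_O" and B: "\<And>i j. vge (1 - D) (B $ i $ j - A $ i $ j)"
    for A B :: "'k fls ^ 3 ^ 3"
  proof -
    define k where "k = matrix_inv g ** A"
    have k: "k \<in> GL3_O"
      using A g by (simp add: mem_coset_iff k_def)
    then have ik: "invertible k" "\<And>i j. vge 0 (matrix_inv k $ i $ j)"
      by (auto simp: GL3_O_iff gl3_O_iff)
    define E where "E = matrix_inv g ** (B - A)"
    have "vge (D + (1 - D)) (E $ i $ j)" for i j
      unfolding E_def using D B by (intro vge_mat_mult) auto
    then have "vge (0 + 1) ((matrix_inv k ** E) $ i $ j)" for i j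
      using ik by (intro vge_mat_mult) auto
    then have "k ** (mat 1 + matrix_inv k ** E) \<in> GL3_O"
      by (intro GL3_O_mult k one_plus_mem_GL3_O) simp
    also have "k ** (mat 1 + matrix_inv k ** E) = k + E"
      using ik(1) by (simp add: matrix_add_ldistrib matrix_inv_cancel)
    also have "k + E = matrix_inv g ** B"
      by (simp add: k_def E_def flip: matrix_add_ldistrib)
    finally show ?thesis
      using g by (simp add: mem_coset_iff)
  qed
  then show ?thesis
    by (intro exI[of _ "1 - D"]) blast
qed

lemma coset_box:
  fixes g :: "'k::field fls ^ 3 ^ 3"
  shows "\<exists>D. \<forall>A\<in>g <#\<^bsub>GL3\<^esub> GL3_O. \<forall>i j. vge D (A $ i $ j)"
proof -
  obtain D where D: "\<And>i j. vge D (g $ i $ j)"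
    using vge_mat_ex by blast
  have "vge (D + 0) ((g ** k) $ i $ j)" if "k \<in> GL3_O" for k i j
    using that D by (intro vge_mat_mult) (auto simp: GL3_O_iff gl3_O_iff)
  then show ?thesis
    by (auto simp: l_coset_def GL3_def intro!: exI[of _ D])
qed

lemma springer_set_eq_Union: "springer_set \<gamma> = \<Union> (affine_Springer_fiber0 \<gamma>)"
proof (intro Set.set_eqI iffI)
  fix g assume g: "g \<in> springer_set \<gamma>"
  then have "g \<in> g <#\<^bsub>GL3\<^esub> GL3_O"
    by (intro coset_self) (simp add: springer_set_def)
  then show "g \<in> \<Union> (affine_Springer_fiber0 \<gamma>)"
    using g unfolding affine_Springer_fiber0_eq by blast
next
  fix g assume "g \<in> \<Union> (affine_Springer_fiber0 \<gamma>)"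
  then show "g \<in> springer_set \<gamma>"
    using springer_set_coset unfolding affine_Springer_fiber0_eq by blast
qed

text \<open>A finite union of cosets has a common radius of openness. The closeness relation is
  symmetric, so the same radius works for the complement; compactness follows from a common
  box.\<close>

lemma springer_set_clopen_compact:
  fixes \<gamma> :: "'k::{field, finite} fls ^ 3 ^ 3"
  assumes fin: "finite (affine_Springer_fiber0 \<gamma>)"
  shows "open (springer_set \<gamma>)" "closed (springer_set \<gamma>)" "compact (springer_set \<gamma>)"
proof -
  let ?X = "affine_Springer_fiber0 \<gamma>"
  have "\<forall>x\<in>?X. \<exists>N. \<forall>A B. A \<in> x \<longrightarrow> (\<forall>i j. vge N (B $ i $ j - A $ i $ j)) \<longrightarrow> B \<in> x"
    using coset_nhds by (auto simp: affine_Springer_fiber0_eq springer_set_def)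
  then obtain N where N: "\<And>x A B. x \<in> ?X \<Longrightarrow> A \<in> x \<Longrightarrow> (\<And>i j. vge (N x) (B $ i $ j - A $ i $ j)) \<Longrightarrow> B \<in> x"
    by metis
  define M where "M = Max (insert 0 (N ` ?X))"
  have M: "N x \<le> M" if "x \<in> ?X" for x
    using that fin by (auto simp: M_def)
  have nhds: "B \<in> springer_set \<gamma>"
    if A: "A \<in> springer_set \<gamma>" and B: "\<And>i j. vge M (B $ i $ j - A $ i $ j)" for A B :: "'k fls ^ 3 ^ 3"
  proof -
    obtain x where x: "x \<in> ?X" "A \<in> x"
      using A unfolding springer_set_eq_Union by blast
    then have "B \<in> x"
      using vge_mono[OF B M[OF x(1)]] by (rule N)
    then show ?thesis
      using x(1) unfolding springer_set_eq_Union by blast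
  qed
  show "open (springer_set \<gamma>)"
    using nhds by (rule open_matrixI)
  have "open (- springer_set \<gamma>)"
  proof (rule open_matrixI)
    fix A B :: "'k fls ^ 3 ^ 3" assume "A \<in> - springer_set \<gamma>" "\<And>i j. vge M (B $ i $ j - A $ i $ j)"
    moreover from this(2) have "\<And>i j. vge M (A $ i $ j - B $ i $ j)"
      by (metis minus_diff_eq vge_uminus)
    ultimately show "B \<in> - springer_set \<gamma>"
      using nhds by blast
  qed
  then show "closed (springer_set \<gamma>)"
    by (simp add: closed_def)
  have "\<forall>x\<in>?X. \<exists>D. \<forall>A\<in>x. \<forall>i j. vge D (A $ i $ j)"
    using coset_box by (auto simp: affine_Springer_fiber0_eq)
  then obtain D where D: "\<And>x A i j. x \<in> ?X \<Longrightarrow> A \<in> x \<Longrightarrow> vge (D x) (A $ i $ j)"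
    by metis
  define D0 where "D0 = Min (insert 0 (D ` ?X))"
  have "D0 \<le> D x" if "x \<in> ?X" for x
    using that fin by (auto simp: D0_def)
  then have "springer_set \<gamma> \<subseteq> {A. \<forall>i j. vge D0 (A $ i $ j)}"
    using D vge_mono unfolding springer_set_eq_Union by blast
  then have "springer_set \<gamma> = {A. \<forall>i j. vge D0 (A $ i $ j)} \<inter> springer_set \<gamma>"
    by blast
  then show "compact (springer_set \<gamma>)"
    using compact_Int_closed[OF compact_matrix_box \<open>closed (springer_set \<gamma>)\<close>] by metis
qed

subsection \<open>The orbital integral\<close>

lemma disjoint_cosets:
  assumes "invertible g" "invertible h" "g <#\<^bsub>GL3\<^esub> GL3_O \<noteq> h <#\<^bsub>GL3\<^esub> GL3_O"
  shows "(g <#\<^bsub>GL3\<^esub> GL3_O) \<inter> (h <#\<^bsub>GL3\<^esub> GL3_O) = {}"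
proof (rule ccontr)
  assume "(g <#\<^bsub>GL3\<^esub> GL3_O) \<inter> (h <#\<^bsub>GL3\<^esub> GL3_O) \<noteq> {}"
  then obtain x where x: "x \<in> g <#\<^bsub>GL3\<^esub> GL3_O" "x \<in> h <#\<^bsub>GL3\<^esub> GL3_O"
    by blast
  then have "invertible x"
    using assms(1) stable_coset_invariant(1) by blast
  then have "g <#\<^bsub>GL3\<^esub> GL3_O = x <#\<^bsub>GL3\<^esub> GL3_O" "h <#\<^bsub>GL3\<^esub> GL3_O = x <#\<^bsub>GL3\<^esub> GL3_O"
    using x assms by (simp_all add: coset_eq_iff mem_coset_iff)
  then show False
    using assms(3) by simp
qed

text \<open>The set is a disjoint union of translates of K, each of measure 1.\<close>

lemma emeasure_springer_set:
  assumes fin: "finite (affine_Springer_fiber0 \<gamma>)"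
    and Haar: "left_Haar_measure GL3 (top_of_set (carrier GL3)) \<mu>"
    and vol: "emeasure \<mu> GL3_O = 1"
  shows "springer_set \<gamma> \<in> sets \<mu>" "emeasure \<mu> (springer_set \<gamma>) = of_nat (card (affine_Springer_fiber0 \<gamma>))"
proof -
  let ?X = "affine_Springer_fiber0 \<gamma>"
  \<comment> \<open>\<open>emeasure\<close> is 0 on nonmeasurable sets, so the value 1 forces
    measurability. The cosets and the levels of the torus are treated in the same way.\<close>
  have "GL3_O \<in> sets \<mu>"
    using vol emeasure_notin_sets by force
  then have e: "emeasure \<mu> x = 1" if "x \<in> ?X" for x
    using that Haar vol by (auto simp: affine_Springer_fiber0_eq springer_set_def left_Haar_measure_def GL3_def)
  then have s: "x \<in> sets \<mu>" if "x \<in> ?X" for x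
    using that emeasure_notin_sets by force
  then show "springer_set \<gamma> \<in> sets \<mu>"
    unfolding springer_set_eq_Union using fin by blast
  have "disjoint_family_on (\<lambda>x. x) ?X"
    unfolding disjoint_family_on_def affine_Springer_fiber0_eq
    using disjoint_cosets by (auto simp: springer_set_def)
  then have "emeasure \<mu> (\<Union>x\<in>?X. x) = (\<Sum>x\<in>?X. emeasure \<mu> x)"
    using fin s by (intro sum_emeasure[symmetric]) auto
  also have "\<dots> = of_nat (card ?X)"
    by (simp add: e)
  finally show "emeasure \<mu> (springer_set \<gamma>) = of_nat (card ?X)"
    by (simp add: springer_set_eq_Union)
qed

text \<open>Elements of valuation m form the coset of the units by X^m, and the determinant has the
  valuation of the element itself.\<close>

lemma emeasure_torus_level:
  assumes T: "T = {E3_mat x | x :: 'k::field fls. x \<noteq> 0}"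
    and Haar: "left_Haar_measure (GL3\<lparr>carrier := T\<rparr>) (top_of_set T) \<mu>"
    and vol: "emeasure \<mu> (E3_mat ` E3_units) = 1"
  shows "{t \<in> T. fls_subdegree (det t) = m} \<in> sets \<mu>"
    "emeasure \<mu> {t \<in> T. fls_subdegree (det t) = m} = 1"
proof -
  define y :: "'k fls" where "y = fls_X_intpow m"
  have y: "y \<noteq> 0" "fls_subdegree y = m"
    by (simp_all add: y_def)
  have "{t \<in> T. fls_subdegree (det t) = m} = {E3_mat x | x. x \<noteq> 0 \<and> fls_subdegree x = m}"
    by (auto simp: T subdegree_det_E3_mat)
  also have "\<dots> = (\<lambda>x. E3_mat (y * x)) ` E3_units"
  proof (intro Set.set_eqI iffI)
    fix t :: "'k fls ^ 3 ^ 3" assume "t \<in> {E3_mat x | x. x \<noteq> 0 \<and> fls_subdegree x = m}"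
    then obtain x where x: "t = E3_mat x" "x \<noteq> 0" "fls_subdegree x = m"
      by blast
    then show "t \<in> (\<lambda>x. E3_mat (y * x)) ` E3_units"
      using y by (intro image_eqI[of _ _ "inverse y * x"]) (simp_all add: E3_units_iff mult.assoc[symmetric])
  qed (use y in \<open>auto simp: E3_units_iff\<close>)
  also have "\<dots> = E3_mat y <#\<^bsub>GL3\<lparr>carrier := T\<rparr>\<^esub> (E3_mat ` E3_units)"
    by (auto simp: l_coset_def GL3_def E3_mat_mult)
  finally have eq: "{t \<in> T. fls_subdegree (det t) = m} = E3_mat y <#\<^bsub>GL3\<lparr>carrier := T\<rparr>\<^esub> (E3_mat ` E3_units)" .
  have "E3_mat ` E3_units \<in> sets \<mu>"
    using vol emeasure_notin_sets by force
  moreover have "E3_mat y \<in> carrier (GL3\<lparr>carrier := T\<rparr>)"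
    using y by (auto simp: T)
  ultimately show "emeasure \<mu> {t \<in> T. fls_subdegree (det t) = m} = 1"
    unfolding eq using Haar vol by (simp add: left_Haar_measure_def)
  then show "{t \<in> T. fls_subdegree (det t) = m} \<in> sets \<mu>"
    using emeasure_notin_sets by force
qed

text \<open>Left translation by t leaves the conjugate of \<gamma> unchanged, so t is constrained
  only through the determinant.\<close>

lemma centralizer_mult_mem_springer_set_iff:
  assumes "t \<in> centralizer \<gamma>" "invertible g"
  shows "t ** g \<in> springer_set \<gamma> \<longleftrightarrow>
    Ad (matrix_inv g) \<gamma> \<in> gl3_O \<and> fls_subdegree (det t) = - fls_subdegree (det g)"
proof -
  have t: "invertible t" "t ** \<gamma> = \<gamma> ** t"
    using assms(1) by (auto simp: centralizer_def GL3_def)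
  have tg: "invertible (t ** g)"
    using t(1) assms(2) by (rule invertible_mult)
  have "Ad (matrix_inv (t ** g)) \<gamma> = matrix_inv g ** (matrix_inv t ** (\<gamma> ** t)) ** g"
    unfolding Ad_matrix_inv[OF tg] using t(1) assms(2) by (simp add: matrix_inv_mult matrix_mul_assoc)
  also have "matrix_inv t ** (\<gamma> ** t) = \<gamma>"
    unfolding t(2)[symmetric] using t(1) by (simp add: matrix_inv_cancel)
  finally have "Ad (matrix_inv (t ** g)) \<gamma> = Ad (matrix_inv g) \<gamma>"
    by (simp add: Ad_matrix_inv assms(2))
  then show ?thesis
    using tg t(1) assms(2) by (auto simp: springer_set_def det_mul invertible_det_nz)
qed

text \<open>Weil's formula is applied to the indicator function of the elements of the fiber of determinant
  valuation 0: a translate of \<open>T\<close> meets this set in the elements of \<open>T\<close> of a fixed valuation.\<close>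

lemma orbital_integral_eq_card:
  fixes \<gamma> :: "'k::{field, finite} fls ^ 3 ^ 3"
  assumes T: "centralizer \<gamma> = {E3_mat x | x. x \<noteq> 0}"
    and fin: "finite (affine_Springer_fiber0 \<gamma>)"
    and Haar_G: "left_Haar_measure GL3 (top_of_set (carrier GL3)) \<mu>G"
    and vol_K: "emeasure \<mu>G GL3_O = 1"
    and Haar_T: "left_Haar_measure (GL3\<lparr>carrier := centralizer \<gamma>\<rparr>) (top_of_set (centralizer \<gamma>)) \<mu>T"
    and vol_E3: "emeasure \<mu>T (E3_mat ` E3_units) = 1"
    and quotient: "quotient_Haar_measure GL3 (top_of_set (carrier GL3)) (centralizer \<gamma>) \<mu>G \<mu>T \<mu>Q"
  shows "orbital_integral \<mu>Q \<gamma> = of_nat (card (affine_Springer_fiber0 \<gamma>))"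
proof -
  let ?S = "springer_set \<gamma>"
  define f :: "'k fls ^ 3 ^ 3 \<Rightarrow> real" where "f = indicator ?S"
  note S = springer_set_clopen_compact[OF fin]
  have S_sub: "?S \<subseteq> carrier GL3"
    by (auto simp: springer_set_def GL3_def)
  have "continuous_on UNIV f"
    unfolding continuous_on_open_vimage[OF open_UNIV]
  proof (intro allI impI)
    fix B :: "real set"
    have "f -` B = (if 1 \<in> B then ?S else {}) \<union> (if 0 \<in> B then - ?S else {})"
      by (auto simp: f_def indicator_def of_bool_def split: if_splits)
    then show "open (f -` B \<inter> UNIV)"
      using S by (auto simp: closed_def)
  qed
  then have "continuous_map (top_of_set (carrier GL3)) euclideanreal f"
    using continuous_on_subset by auto
  moreover have "compactin (top_of_set (carrier GL3)) ?S"
    using S S_sub by (simp add: compactin_subtopology)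
  moreover have "\<forall>g\<in>topspace (top_of_set (carrier GL3)) - ?S. f g = 0"
    by (simp add: f_def)
  moreover have "\<forall>g\<in>topspace (top_of_set (carrier GL3)). 0 \<le> f g"
    by (simp add: f_def)
  ultimately have "continuous_map (top_of_set (carrier GL3)) euclideanreal f \<and>
      (\<forall>g\<in>topspace (top_of_set (carrier GL3)). 0 \<le> f g) \<and>
      (\<exists>C. compactin (top_of_set (carrier GL3)) C \<and> (\<forall>g\<in>topspace (top_of_set (carrier GL3)) - C. f g = 0))"
    by blast
  then have weil: "(\<integral>\<^sup>+ g. ennreal (f g) \<partial>\<mu>G) =
      (\<integral>\<^sup>+ x. (\<integral>\<^sup>+ t. ennreal (f (t \<otimes>\<^bsub>GL3\<^esub> (SOME g. g \<in> x))) \<partial>\<mu>T) \<partial>\<mu>Q)"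
    by (rule quotient[unfolded quotient_Haar_measure_def, THEN conjunct2, THEN spec, THEN mp])
  have space_T: "space \<mu>T = centralizer \<gamma>"
    using Haar_T by (simp add: left_Haar_measure_def Radon_measure_def)
  have space_Q: "space \<mu>Q = (\<lambda>g. centralizer \<gamma> #>\<^bsub>GL3\<^esub> g) ` carrier GL3"
    using quotient by (simp add: quotient_Haar_measure_def Radon_measure_def topspace_quotient_topology)
  have inner: "(\<integral>\<^sup>+ t. ennreal (f (t \<otimes>\<^bsub>GL3\<^esub> (SOME g. g \<in> x))) \<partial>\<mu>T) =
      indicator gl3_O (Ad (matrix_inv (SOME g. g \<in> x)) \<gamma>)" if "x \<in> space \<mu>Q" for x
  proof -
    obtain g0 where g0: "x = centralizer \<gamma> #>\<^bsub>GL3\<^esub> g0" "invertible g0"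
      using \<open>x \<in> space \<mu>Q\<close> unfolding space_Q by (auto simp: GL3_def)
    define g where "g = (SOME g. g \<in> x)"
    \<comment> \<open>This makes the coset x nonempty, so that \<open>SOME\<close> picks one of its
      elements; only invertibility of the chosen element is used.\<close>
    have "mat 1 \<in> centralizer \<gamma>"
      by (auto simp: centralizer_def GL3_def invertible_def intro: exI[of _ "mat 1"])
    then have "g0 \<in> x"
      unfolding g0(1) r_coset_def GL3_def by force
    then have "g \<in> x"
      unfolding g_def by (rule someI)
    then have g: "invertible g"
      using g0 by (auto simp: r_coset_def GL3_def centralizer_def invertible_mult)
    define R where "R = {t \<in> centralizer \<gamma>. fls_subdegree (det t) = - fls_subdegree (det g)}"
    have "(\<integral>\<^sup>+ t. ennreal (f (t \<otimes>\<^bsub>GL3\<^esub> g)) \<partial>\<mu>T) =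
        (\<integral>\<^sup>+ t. indicator gl3_O (Ad (matrix_inv g) \<gamma>) * indicator R t \<partial>\<mu>T)"
    proof (rule nn_integral_cong)
      fix t assume "t \<in> space \<mu>T"
      then show "ennreal (f (t \<otimes>\<^bsub>GL3\<^esub> g)) = indicator gl3_O (Ad (matrix_inv g) \<gamma>) * indicator R t"
        using centralizer_mult_mem_springer_set_iff[of t \<gamma> g] g
        by (auto simp: space_T f_def GL3_def R_def indicator_def)
    qed
    also have "\<dots> = indicator gl3_O (Ad (matrix_inv g) \<gamma>) * emeasure \<mu>T R"
      unfolding R_def using emeasure_torus_level(1)[OF T Haar_T vol_E3]
      by (intro nn_integral_cmult_indicator)
    also have "emeasure \<mu>T R = 1"
      unfolding R_def by (rule emeasure_torus_level(2)[OF T Haar_T vol_E3])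
    finally show ?thesis
      by (simp add: g_def)
  qed
  have "orbital_integral \<mu>Q \<gamma> = (\<integral>\<^sup>+ g. ennreal (f g) \<partial>\<mu>G)"
    unfolding weil orbital_integral_def by (rule nn_integral_cong) (simp add: inner)
  also have "\<dots> = (\<integral>\<^sup>+ g. indicator ?S g \<partial>\<mu>G)"
    by (simp add: f_def ennreal_indicator)
  also have "\<dots> = of_nat (card (affine_Springer_fiber0 \<gamma>))"
    using emeasure_springer_set[OF fin Haar_G vol_K] by simp
  finally show ?thesis .
qed

theorem theorem8p2:
  fixes b0 c0 :: "'k::{field, finite} fps" and n1 n2 :: nat
    and \<gamma> :: "'k fls ^ 3 ^ 3"
    and \<mu>G \<mu>T :: "('k fls ^ 3 ^ 3) measure" and \<mu>Q :: "('k fls ^ 3 ^ 3) set measure"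
    and q :: real
  assumes char: "CHAR('k) > 3"
    and q: "q = real CARD('k)"
    and units: "is_unit b0" "is_unit c0"
    and \<gamma>: "\<gamma> =
      (let b = fps_to_fls b0; c = fps_to_fls c0; \<epsilon> = fls_X in vector
        [vector [0,                 b * \<epsilon> ^ n1,       c * \<epsilon> ^ n2],
         vector [c * \<epsilon> ^ (n2 + 1),  0,                b * \<epsilon> ^ n1],
         vector [b * \<epsilon> ^ (n1 + 1),  c * \<epsilon> ^ (n2 + 1), 0]])"
    and n2_less_n1: "n2 < n1"
    and Haar_G: "left_Haar_measure GL3 (top_of_set (carrier GL3)) \<mu>G"
    and vol_K: "emeasure \<mu>G GL3_O = 1"
    and Haar_T: "left_Haar_measure (GL3\<lparr>carrier := centralizer \<gamma>\<rparr>) (top_of_set (centralizer \<gamma>)) \<mu>T"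
    and vol_E3: "emeasure \<mu>T (E3_mat ` E3_units) = 1"
    and quotient: "quotient_Haar_measure GL3 (top_of_set (carrier GL3)) (centralizer \<gamma>) \<mu>G \<mu>T \<mu>Q"
  shows "orbital_integral \<mu>Q \<gamma> = of_nat (card (affine_Springer_fiber0 \<gamma>)) \<and>
    real (card (affine_Springer_fiber0 \<gamma>)) =
      1 + 2 * (\<Sum>i\<in>{1..\<lfloor>real n2 / 3\<rfloor>}. q powi (2 * (3 * i - 1)) * (q\<^sup>2 + q + 1))
      + (\<Sum>i\<in>{1..int n2}. of_int (i - 2 * \<lfloor>of_int i / 3 :: real\<rfloor> - 1) * q powi (2 * i - 3)
            * (q ^ 3 + 2 * q\<^sup>2 + 2 * q + 1))
      + of_int (int n2 - 2 * \<lceil>(real n2 - 1) / 3\<rceil>) * q powi (2 * int n2 - 1) * (1 + 2 * q\<^sup>2)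
      + (\<Sum>i\<in>{int n2 + 2..2 * int n2}.
            of_int (2 * int n2 - i - 2 * \<lceil>of_int (2 * int n2 - i) / 3 :: real\<rceil> + 1)
            * q powi (i + int n2 - 1) * (1 + 2 * q))
      + 2 * (\<Sum>i\<in>{0..\<lfloor>(real n2 - 2) / 3\<rfloor>}. q powi (3 * (int n2 - i) - 2) * (1 + q))
      + 2 * q powi (2 * int n2)
          * of_int (\<lceil>(2 * real n2 - 1) / 3\<rceil> - \<lfloor>(real n2 - 2) / 3\<rfloor> - 1)
      + q powi (3 * int n2 + 1)"
proof -
  \<comment> \<open>With these series \<gamma> is multiplication by X emb(B) + X^2 emb(C), of which
    the second term has the smaller valuation, 3 n2 + 2.\<close>
  define B where "B = fps_to_fls b0 * fls_X ^ n1"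
  define C where "C = fps_to_fls c0 * fls_X ^ n2"
  have val: "B \<noteq> 0" "C \<noteq> 0" "fls_subdegree B = int n1" "fls_subdegree C = int n2"
    using units subdegree_unit_iff[of b0] subdegree_unit_iff[of c0] unfolding B_def C_def by simp_all
  have \<gamma>_eq: "\<gamma> = E3_mat (fls_X * emb B + fls_X ^ 2 * emb C)"
    unfolding \<gamma> E3_mat_combo B_def C_def by (simp add: Let_def mult_ac)
  have T: "centralizer \<gamma> = {E3_mat x | x. x \<noteq> 0}"
    unfolding \<gamma>_eq using val(1,2) by (rule centralizer_E3_mat)
  note params = card_springer_params[OF val n2_less_n1]
  have fin: "finite (affine_Springer_fiber0 \<gamma>)"
    using params(2) unfolding \<gamma>_eq card_affine_Springer_fiber0(2) .
  have "q \<noteq> 0"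
    using q by simp
  have "real (card (affine_Springer_fiber0 \<gamma>)) =
      (\<Sum>k\<le>n2. (real k + 1) * (q ^ (2 * k) + q ^ (2 * k + 1))) + (\<Sum>j<n2. (real j + 1) * q ^ (3 * n2 + 1 - j))"
    unfolding \<gamma>_eq card_affine_Springer_fiber0(1) params(1) q by (simp add: algebra_simps)
  then show ?thesis
    using orbital_integral_eq_card[OF T fin Haar_G vol_K Haar_T vol_E3 quotient]
    unfolding closed_formula[OF \<open>q \<noteq> 0\<close>] by blast
qed

end
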